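(* Let $(\boldsymbol u,\boldsymbol B,P,T)$ be a smooth solution of the Taylor model (see context), and suppose that the magnetic flux is exact. Suppose that at some instant of time the magnetic field is nontrivial and dynamo action occurs, i.e. $\frac{\mathrm d}{\mathrm dt}\left(\frac12\int_V|\boldsymbol B|^2\,\mathrm dV\right)\ge 0$. Then at that instant $$ Ra\,A_2\,\|\nabla^2_{x,y}\overline T\|_{L^\infty_zL^2_{x,y}}\ \ge\ \frac1{Rm}. $$
   Context: Domain: $V=[0,L_x]\times[0,L_y]\times[0,1]$ with $L_x,L_y>0$; all fields are periodic in $x$ and $y$. $S_-=\{z=0\}$, $S_+=\{z=1\}$, $\boldsymbol n_\pm=\pm\boldsymbol e_z$. Taylor model (inviscid, inertialess), with positive parameters $\Lambda, Ra, Rm$: unknown velocity $\boldsymbol u$, magnetic field $\boldsymbol B$, pressure $P$, temperature $T$, satisfying $$\boldsymbol e_z\times\boldsymbol u+\nabla P=\Lambda(\nabla\times\boldsymbol B)\times\boldsymbol B+Ra\,T\boldsymbol e_z,\quad \nabla\cdot\boldsymbol u=0,\quad \partial_t\boldsymbol B-\nabla\times(\boldsymbol u\times\boldsymbol B)=\tfrac1{Rm}\nabla^2\boldsymbol B,\quad \nabla\cdot\boldsymbol B=0,$$ with boundary conditions $\boldsymbol u\cdot\boldsymbol n_\pm=0$ and $\boldsymbol B\times\boldsymbol n_\pm=0$ (ferromagnetic) on $S_\pm$. No evolution equation for $T$ is assumed; $T$ is a smooth function, periodic in $x,y$. Magnetic flux is exact if $\int_{S_\pm}\boldsymbol n_\pm\cdot\boldsymbol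 B\,\mathrm dS_\pm=0$. $\overline T(x,y,z)=\int_0^zT(x,y,z')\,\mathrm dz'$; $\nabla^2_{x,y}=\partial_x^2+\partial_y^2$ is the horizontal Laplacian; $\|f\|_{L^\infty_zL^2_{x,y}}=\sup_{z\in[0,1]}\left(\int|f(x,y,z)|^2\,\mathrm dx\,\mathrm dy\right)^{1/2}$. Constants: $\lambda_1=\min\{\pi,2\pi/L_x,2\pi/L_y\}$, $C_{\mathrm P}=1/\lambda_1$, $C_{\mathrm L}=\left(\frac{3\pi}{32}\max\{\frac{L_x}{L_y},\frac{L_y}{L_x}\}\right)^{1/4}$ (the constant in the two-dimensional Ladyzhenskaya inequality $\|g\|_{L^4_{x,y}}\le C_{\mathrm L}\|g\|_{L^2_{x,y}}^{1/2}\|\nabla_{x,y}g\|_{L^2_{x,y}}^{1/2}$ for periodic mean-zero $g$), $C_1=C_{\mathrm L}^2C_{\mathrm P}$, $C_2=\left(\frac1{6\pi}+\frac{C_{\mathrm P}}2\right)\frac1{L_xL_yC_{\mathrm L}^2}$, $A_2=C_1\max\{3,C_2\}$. *)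

theory Defs
  imports "HOL-Analysis.Analysis"
begin

type_synonym point = "real \<times> real \<times> real"

(* The layer before quotienting by the horizontal periods. Fields are functions on all of
   real^2 x [0,1] that are periodic in x and y; values outside the layer are never used. *)

definition layer :: "point set" where
  "layer = {(x, y, z). 0 \<le> z \<and> z \<le> 1}"

definition domain_V :: "real \<Rightarrow> real \<Rightarrow> point set" where
  "domain_V Lx Ly = {(x, y, z). x \<in> {0..Lx} \<and> y \<in> {0..Ly} \<and> z \<in> {0..1}}"

definition horiz_periodic :: "real \<Rightarrow> real \<Rightarrow> (point \<Rightarrow> 'a) \<Rightarrow> bool" where
  "horiz_periodic Lx Ly f \<longleftrightarrow>
     (\<forall>x y z. z \<in> {0..1} \<longrightarrow> f (x + Lx, y, z) = f (x, y, z) \<and> f (x, y + Ly, z) = f (x, y, z))"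

definition e_z :: "real^3" where
  "e_z = axis 3 1"

(* Derivatives are taken within the closed set S, so that on the boundary they are one-sided in
   the normal direction. For the sets used here (a nondegenerate interval times the layer, or the
   layer itself) the derivative within S is unique. *)

definition pderiv_within ::
    "'a set \<Rightarrow> 'a \<Rightarrow> ('a::real_normed_vector \<Rightarrow> 'b::real_normed_vector) \<Rightarrow> 'a \<Rightarrow> 'b" where
  "pderiv_within S v f p = frechet_derivative f (at p within S) v"

primrec Ck_on :: "nat \<Rightarrow> 'a set \<Rightarrow> ('a::euclidean_space \<Rightarrow> 'b::real_normed_vector) \<Rightarrow> bool" where
  "Ck_on 0 S f \<longleftrightarrow> continuous_on S f"
| "Ck_on (Suc k) S f \<longleftrightarrow>
     f differentiable_on S \<and> (\<forall>v\<in>Basis. Ck_on k S (pderiv_within S v f))"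

definition smooth_on :: "'a set \<Rightarrow> ('a::euclidean_space \<Rightarrow> 'b::real_normed_vector) \<Rightarrow> bool" where
  "smooth_on S f \<longleftrightarrow> (\<forall>k. Ck_on k S f)"

(* Jointly smooth in time and space, up to the boundary. *)
definition smooth_field :: "real set \<Rightarrow> (real \<Rightarrow> point \<Rightarrow> 'b::real_normed_vector) \<Rightarrow> bool" where
  "smooth_field I f \<longleftrightarrow> smooth_on {(t, p). t \<in> I \<and> p \<in> layer} (\<lambda>(t, p). f t p)"

definition d_x :: "(point \<Rightarrow> 'b::real_normed_vector) \<Rightarrow> point \<Rightarrow> 'b" where
  "d_x = pderiv_within layer (1, 0, 0)"

definition d_y :: "(point \<Rightarrow> 'b::real_normed_vector) \<Rightarrow> point \<Rightarrow> 'b" where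
  "d_y = pderiv_within layer (0, 1, 0)"

definition d_z :: "(point \<Rightarrow> 'b::real_normed_vector) \<Rightarrow> point \<Rightarrow> 'b" where
  "d_z = pderiv_within layer (0, 0, 1)"

definition d_t :: "real set \<Rightarrow> (real \<Rightarrow> point \<Rightarrow> 'b::real_normed_vector) \<Rightarrow> real \<Rightarrow> point \<Rightarrow> 'b" where
  "d_t I f t p = vector_derivative (\<lambda>s. f s p) (at t within I)"

definition grad :: "(point \<Rightarrow> real) \<Rightarrow> point \<Rightarrow> real^3" where
  "grad f p = vector [d_x f p, d_y f p, d_z f p]"

definition divergence :: "(point \<Rightarrow> real^3) \<Rightarrow> point \<Rightarrow> real" where
  "divergence F p = d_x F p $ 1 + d_y F p $ 2 + d_z F p $ 3"

definition curl :: "(point \<Rightarrow> real^3) \<Rightarrow> point \<Rightarrow> real^3" where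
  "curl F p = vector [d_y F p $ 3 - d_z F p $ 2,
                      d_z F p $ 1 - d_x F p $ 3,
                      d_x F p $ 2 - d_y F p $ 1]"

definition laplacian :: "(point \<Rightarrow> 'b::real_normed_vector) \<Rightarrow> point \<Rightarrow> 'b" where
  "laplacian f p = d_x (d_x f) p + d_y (d_y f) p + d_z (d_z f) p"

definition horiz_laplacian :: "(point \<Rightarrow> 'b::real_normed_vector) \<Rightarrow> point \<Rightarrow> 'b" where
  "horiz_laplacian f p = d_x (d_x f) p + d_y (d_y f) p"

(* I is the time interval on which the solution exists. *)
definition smooth_taylor_solution ::
    "real \<Rightarrow> real \<Rightarrow> real \<Rightarrow> real \<Rightarrow> real \<Rightarrow> real set \<Rightarrow>
     (real \<Rightarrow> point \<Rightarrow> real^3) \<Rightarrow> (real \<Rightarrow> point \<Rightarrow> real^3) \<Rightarrow>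
     (real \<Rightarrow> point \<Rightarrow> real) \<Rightarrow> (real \<Rightarrow> point \<Rightarrow> real) \<Rightarrow> bool" where
  "smooth_taylor_solution Lx Ly \<Lambda> Ra Rm I u B P T \<longleftrightarrow>
     smooth_field I u \<and> smooth_field I B \<and> smooth_field I P \<and> smooth_field I T \<and>
     (\<forall>t\<in>I.
        horiz_periodic Lx Ly (u t) \<and> horiz_periodic Lx Ly (B t) \<and>
        horiz_periodic Lx Ly (P t) \<and> horiz_periodic Lx Ly (T t) \<and>
        (\<forall>p\<in>layer.
           cross3 e_z (u t p) + grad (P t) p =
             \<Lambda> *\<^sub>R cross3 (curl (B t) p) (B t p) + (Ra * T t p) *\<^sub>R e_z \<and>
           divergence (u t) p = 0 \<and>
           d_t I B t p - curl (\<lambda>q. cross3 (u t q) (B t q)) p = (1 / Rm) *\<^sub>R laplacian (B t) p \<and>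
           divergence (B t) p = 0) \<and>
        (\<forall>x y. u t (x, y, 0) \<bullet> (- e_z) = 0 \<and> u t (x, y, 1) \<bullet> e_z = 0 \<and>
               cross3 (B t (x, y, 0)) (- e_z) = 0 \<and> cross3 (B t (x, y, 1)) e_z = 0))"

definition exact_flux :: "real \<Rightarrow> real \<Rightarrow> (point \<Rightarrow> real^3) \<Rightarrow> bool" where
  "exact_flux Lx Ly F \<longleftrightarrow>
     integral (cbox (0, 0) (Lx, Ly)) (\<lambda>(x, y). (- e_z) \<bullet> F (x, y, 0)) = 0 \<and>
     integral (cbox (0, 0) (Lx, Ly)) (\<lambda>(x, y). e_z \<bullet> F (x, y, 1)) = 0"

definition magnetic_energy :: "real \<Rightarrow> real \<Rightarrow> (point \<Rightarrow> real^3) \<Rightarrow> real" where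
  "magnetic_energy Lx Ly F = 1 / 2 * integral (domain_V Lx Ly) (\<lambda>p. (norm (F p))\<^sup>2)"

definition vert_primitive :: "(point \<Rightarrow> real) \<Rightarrow> point \<Rightarrow> real" where
  "vert_primitive T = (\<lambda>(x, y, z). integral {0..z} (\<lambda>z'. T (x, y, z')))"

definition norm_Linf_L2 :: "real \<Rightarrow> real \<Rightarrow> (point \<Rightarrow> real) \<Rightarrow> real" where
  "norm_Linf_L2 Lx Ly f =
     (SUP z\<in>{0..1}. sqrt (integral (cbox (0, 0) (Lx, Ly)) (\<lambda>(x, y). \<bar>f (x, y, z)\<bar>\<^sup>2)))"

definition lambda_1 :: "real \<Rightarrow> real \<Rightarrow> real" where
  "lambda_1 Lx Ly = Min {pi, 2 * pi / Lx, 2 * pi / Ly}"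

definition C_P :: "real \<Rightarrow> real \<Rightarrow> real" where
  "C_P Lx Ly = 1 / lambda_1 Lx Ly"

definition C_L :: "real \<Rightarrow> real \<Rightarrow> real" where
  "C_L Lx Ly = (3 * pi / 32 * max (Lx / Ly) (Ly / Lx)) powr (1 / 4)"

definition C_1 :: "real \<Rightarrow> real \<Rightarrow> real" where
  "C_1 Lx Ly = (C_L Lx Ly)\<^sup>2 * C_P Lx Ly"

definition C_2 :: "real \<Rightarrow> real \<Rightarrow> real" where
  "C_2 Lx Ly = (1 / (6 * pi) + C_P Lx Ly / 2) * (1 / (Lx * Ly * (C_L Lx Ly)\<^sup>2))"

definition A_2 :: "real \<Rightarrow> real \<Rightarrow> real" where
  "A_2 Lx Ly = C_1 Lx Ly * max 3 (C_2 Lx Ly)"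

end

theory Submission
  imports Defs
begin

text \<open>The magnetic energy changes at the rate \<open>Ra * J - E / Rm\<close>, where \<open>E\<close> is the squared \<open>L\<^sup>2\<close> norm of the
  gradient of \<open>B\<close>: integrating the induction equation by parts leaves the work of the Lorentz force, which
  the momentum equation identifies with the work of buoyancy. Let \<open>\<phi>\<close> be the vertical primitive of \<open>T\<close>.
  Since \<open>d_z \<phi> = T\<close> and \<open>u\<close> is solenoidal, buoyancy works against the horizontal velocity only, and the horizontal
  momentum equations express that velocity through \<open>B\<close>. This turns \<open>J\<close> into the integral of
  \<open>v \<bullet> (B \<bullet> \<nabla>) B\<close> with \<open>v = (d_y \<phi>, - d_x \<phi>, 0)\<close>.

  On each horizontal plane \<open>v\<close> and the fluctuation of \<open>B\<close> have mean zero, so Ladyzhenskaya's and Poincare's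
  inequalities bound the fluctuation part by \<open>E\<close> times the plane norm of the horizontal Laplacian of \<open>\<phi>\<close>.
  The horizontal mean of \<open>B\<close> has no vertical component, because the flux is exact, and vanishes on both
  boundary planes, so the one-dimensional Dirichlet inequality controls it. The constants obtained from
  elementary proofs of these inequalities add up to at most \<open>A_2\<close>. If \<open>dE \<ge> 0\<close>, divide by \<open>E > 0\<close>.\<close>

section \<open>Differentiation within thick sets\<close>

text \<open>Only the horizontal derivatives of \<open>\<phi>\<close> enter \<open>J\<close> because
  a temperature that depends on height alone does no work: the vertical velocity has zero mean on
  every horizontal plane. The weight \<open>\<Lambda>\<close> drops out because the work of the
  Lorentz force and the velocity produced by it carry the same factor.

  \<open>C_L\<close> enters through its value. Put q = max Lx Ly / sqrt (Lx * Ly). Then the square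
  of \<open>C_L\<close> is sqrt (3 * pi / 32) * q, and the root exceeds 0.53, so the factor 3 in
  \<open>A_2\<close> yields at least 1.59 * q * C_P. The elementary fourth power inequality,
  combined with Poincare's, charges the fluctuation at most q * C_P. The surplus 0.59 * q * C_P pays
  for the horizontal mean, which costs at most C_P / (2 * pi * sqrt (Lx * Ly)), unless max Lx Ly is
  small; there \<open>C_2\<close> takes over.

  A technical obstacle is that fields live on a closed layer, with one-sided derivatives on the
  boundary planes. Hence the calculus relative to sets within which derivatives are unique, and the
  separate proof that the vertical primitive is smooth up to the boundary.\<close>

definition thick :: "'a::euclidean_space set \<Rightarrow> bool" where
  "thick S \<longleftrightarrow> (\<forall>x\<in>S. \<forall>i\<in>Basis. \<forall>e>0. \<exists>d. 0 < \<bar>d\<bar> \<and> \<bar>d\<bar> < e \<and> x + d *\<^sub>R i \<in> S)"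

text \<open>A point of a thick set is approached within the set along every coordinate direction.
  This determines the derivative on a basis, so the choice hidden in
  \<open>frechet_derivative\<close> has only one candidate.\<close>

lemma frechet_derivative_within_thick:
  assumes "thick S" "p \<in> S" "(f has_derivative f') (at p within S)"
  shows "frechet_derivative f (at p within S) = f'"
proof -
  have "(f has_derivative frechet_derivative f (at p within S)) (at p within S)"
    using assms(3) frechet_derivative_works differentiable_def by blast
  then show ?thesis
    using assms frechet_derivative_unique_within[of f _ p S f'] unfolding thick_def by blast
qed

lemma pderiv_within_eqI:
  assumes "thick S" "p \<in> S" "(f has_derivative f') (at p within S)"
  shows "pderiv_within S v f p = f' v"
  by (simp add: pderiv_within_def frechet_derivative_within_thick[OF assms])

lemma has_derivative_pderiv_within:
  assumes "f differentiable_on S" "p \<in> S"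
  shows "(f has_derivative (\<lambda>v. pderiv_within S v f p)) (at p within S)"
  using assms frechet_derivative_works unfolding pderiv_within_def differentiable_on_def by auto

lemma pderiv_within_cong:
  assumes "\<And>q. q \<in> S \<Longrightarrow> f q = g q" "p \<in> S"
  shows "pderiv_within S v f p = pderiv_within S v g p"
proof -
  have "(f has_derivative D) (at p within S) \<longleftrightarrow> (g has_derivative D) (at p within S)" for D
    using has_derivative_transform[OF assms(2)] assms(1) by metis
  then show ?thesis
    by (simp add: pderiv_within_def frechet_derivative_def)
qed

lemma Ck_on_cong:
  assumes "\<And>q. q \<in> S \<Longrightarrow> f q = g q"
  shows "Ck_on k S f \<longleftrightarrow> Ck_on k S g"
  using assms
proof (induction k arbitrary: f g)
  case 0
  then show ?case by (simp cong: continuous_on_cong)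
next
  case (Suc k)
  have "f differentiable_on S \<longleftrightarrow> g differentiable_on S"
    using differentiable_transform_within[OF _ zero_less_one] Suc.prems
    unfolding differentiable_on_def by metis
  moreover have "Ck_on k S (pderiv_within S v f) \<longleftrightarrow> Ck_on k S (pderiv_within S v g)" for v
    by (rule Suc.IH) (simp add: pderiv_within_cong[OF Suc.prems])
  ultimately show ?case by simp
qed

text \<open>Uniqueness lets an explicit formula for the derivative replace the chosen one. With this
  introduction rule each closure property below becomes an induction on the order, with the usual
  differentiation rule as its step.\<close>

lemma Ck_on_SucI:
  assumes "thick S"
    and "\<And>p. p \<in> S \<Longrightarrow> (f has_derivative (\<lambda>v. f' v p)) (at p within S)"
    and "\<And>v. v \<in> Basis \<Longrightarrow> Ck_on k S (f' v)"
  shows "Ck_on (Suc k) S f"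
proof -
  have "f differentiable_on S"
    using assms(2) unfolding differentiable_on_def differentiable_def by blast
  moreover have "Ck_on k S (pderiv_within S v f)" if "v \<in> Basis" for v
    using assms(3)[OF that] pderiv_within_eqI[OF assms(1) _ assms(2)] by (simp cong: Ck_on_cong)
  ultimately show ?thesis by simp
qed

lemma Ck_on_mono: "Ck_on (Suc k) S f \<Longrightarrow> Ck_on k S f"
proof (induction k arbitrary: f)
  case 0
  then show ?case by (simp add: differentiable_imp_continuous_on)
next
  case (Suc k)
  then show ?case unfolding Ck_on.simps(2)[of "Suc k"] Ck_on.simps(2)[of k] by blast
qed

lemma Ck_on_bounded_linear:
  assumes "thick S" "bounded_linear h" "Ck_on k S f"
  shows "Ck_on k S (\<lambda>p. h (f p))"
  using assms(3)
proof (induction k arbitrary: f)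
  case 0
  then show ?case using assms(2) by (auto intro: bounded_linear.continuous_on)
next
  case (Suc k)
  show ?case
  proof (rule Ck_on_SucI[OF assms(1), where f' = "\<lambda>v p. h (pderiv_within S v f p)"])
    fix p assume "p \<in> S"
    then show "((\<lambda>p. h (f p)) has_derivative (\<lambda>v. h (pderiv_within S v f p))) (at p within S)"
      using bounded_linear.has_derivative[OF assms(2) has_derivative_pderiv_within] Suc.prems by auto
  qed (use Suc in auto)
qed

lemma Ck_on_add:
  assumes "thick S" "Ck_on k S f" "Ck_on k S g"
  shows "Ck_on k S (\<lambda>p. f p + g p)"
  using assms(2,3)
proof (induction k arbitrary: f g)
  case 0
  then show ?case by (auto intro: continuous_on_add)
next
  case (Suc k)
  show ?case
  proof (rule Ck_on_SucI[OF assms(1), where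
        f' = "\<lambda>v p. pderiv_within S v f p + pderiv_within S v g p"])
    fix p assume "p \<in> S"
    then show "((\<lambda>p. f p + g p) has_derivative
        (\<lambda>v. pderiv_within S v f p + pderiv_within S v g p)) (at p within S)"
      using Suc.prems by (intro has_derivative_add has_derivative_pderiv_within) auto
  qed (use Suc in auto)
qed

lemma Ck_on_mult:
  fixes f g :: "'a::euclidean_space \<Rightarrow> real"
  assumes "thick S" "Ck_on k S f" "Ck_on k S g"
  shows "Ck_on k S (\<lambda>p. f p * g p)"
  using assms(2,3)
proof (induction k arbitrary: f g)
  case 0
  then show ?case by (auto intro: continuous_on_mult)
next
  case (Suc k)
  show ?case
  proof (rule Ck_on_SucI[OF assms(1), where
        f' = "\<lambda>v p. f p * pderiv_within S v g p + pderiv_within S v f p * g p"])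
    fix p assume "p \<in> S"
    then show "((\<lambda>p. f p * g p) has_derivative
        (\<lambda>v. f p * pderiv_within S v g p + pderiv_within S v f p * g p)) (at p within S)"
      using Suc.prems by (intro has_derivative_mult has_derivative_pderiv_within) auto
  next
    fix v :: 'a assume "v \<in> Basis"
    then show "Ck_on k S (\<lambda>p. f p * pderiv_within S v g p + pderiv_within S v f p * g p)"
      using Suc.prems Ck_on_mono by (intro Ck_on_add assms(1) Suc.IH) auto
  qed
qed

lemma Ck_on_const: "thick S \<Longrightarrow> Ck_on k S (\<lambda>p. c)"
proof (induction k arbitrary: c)
  case (Suc k)
  show ?case
    by (rule Ck_on_SucI[OF Suc.prems, where f' = "\<lambda>v p. 0"]) (use Suc in auto)
qed auto

text \<open>The model assumes smoothness jointly in time and space, but its spatial derivatives are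
  taken at one instant. Composition with the affine map that sends \<open>p\<close> to
  \<open>(t, p)\<close> links the two. The induction varies \<open>F\<close> because the derivative
  in direction \<open>(0, v)\<close> is again a function on the product.\<close>

lemma Ck_on_slice:
  fixes F :: "real \<times> 'a::euclidean_space \<Rightarrow> 'b::real_normed_vector"
  assumes "thick (I \<times> S)" "thick S" "t \<in> I" "Ck_on k (I \<times> S) F"
  shows "Ck_on k S (\<lambda>p. F (t, p))"
  using assms(4)
proof (induction k arbitrary: F)
  case 0
  then show ?case
    using assms(3) by (auto intro!: continuous_on_compose2[of "I \<times> S" F] continuous_intros)
next
  case (Suc k)
  show ?case
  proof (rule Ck_on_SucI[OF assms(2), where f' = "\<lambda>v p. pderiv_within (I \<times> S) (0, v) F (t, p)"])
    fix p assume "p \<in> S"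
    then have F: "(F has_derivative (\<lambda>v. pderiv_within (I \<times> S) v F (t, p))) (at (t, p) within I \<times> S)"
      using has_derivative_pderiv_within Suc.prems assms(3) by auto
    have "((\<lambda>p. (t, p)) has_derivative (\<lambda>v. (0, v))) (at p within S)"
      by (auto intro!: derivative_eq_intros)
    moreover have "(F has_derivative (\<lambda>v. pderiv_within (I \<times> S) v F (t, p)))
        (at (t, p) within (\<lambda>p. (t, p)) ` S)"
      using F by (rule has_derivative_subset) (use assms(3) in auto)
    ultimately show "((\<lambda>p. F (t, p)) has_derivative
        (\<lambda>v. pderiv_within (I \<times> S) (0, v) F (t, p))) (at p within S)"
      using has_derivative_in_compose by fastforce
  next
    fix v :: 'a assume "v \<in> Basis"
    then have "(0::real, v) \<in> Basis" by (auto simp: Basis_prod_def)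
    then show "Ck_on k S (\<lambda>p. pderiv_within (I \<times> S) (0, v) F (t, p))"
      using Suc by auto
  qed
qed

lemma smooth_on_slice:
  fixes F :: "real \<times> 'a::euclidean_space \<Rightarrow> 'b::real_normed_vector"
  assumes "thick (I \<times> S)" "thick S" "t \<in> I" "smooth_on (I \<times> S) F"
  shows "smooth_on S (\<lambda>p. F (t, p))"
  using assms Ck_on_slice unfolding smooth_on_def by blast

lemma smooth_on_pderiv_within:
  assumes "smooth_on S f" "v \<in> Basis"
  shows "smooth_on S (pderiv_within S v f)"
  using assms Ck_on.simps(2) unfolding smooth_on_def by blast

lemma smooth_on_imp_differentiable: "smooth_on S f \<Longrightarrow> f differentiable_on S"
  using Ck_on.simps(2) unfolding smooth_on_def by blast

lemma smooth_on_imp_continuous: "smooth_on S f \<Longrightarrow> continuous_on S f"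
  using Ck_on.simps(1) unfolding smooth_on_def by blast

section \<open>Fields on the layer\<close>

lemma layer_eq: "layer = UNIV \<times> UNIV \<times> {0..1}"
  by (auto simp: layer_def)

lemma thick_Times:
  assumes "thick A" "thick B"
  shows "thick (A \<times> B)"
  unfolding thick_def
proof clarify
  fix a b and i :: "'a \<times> 'b" and e :: real
  assume ab: "a \<in> A" "b \<in> B" and i: "i \<in> Basis" and e: "e > 0"
  from i consider j where "j \<in> Basis" "i = (j, 0)" | j where "j \<in> Basis" "i = (0, j)"
    by (auto simp: Basis_prod_def)
  then show "\<exists>d. 0 < \<bar>d\<bar> \<and> \<bar>d\<bar> < e \<and> (a, b) + d *\<^sub>R i \<in> A \<times> B"
  proof cases
    case 1
    with assms(1) ab e obtain d where "0 < \<bar>d\<bar>" "\<bar>d\<bar> < e" "a + d *\<^sub>R j \<in> A"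
      unfolding thick_def by meson
    with 1 ab show ?thesis by (intro exI[of _ d]) auto
  next
    case 2
    with assms(2) ab e obtain d where "0 < \<bar>d\<bar>" "\<bar>d\<bar> < e" "b + d *\<^sub>R j \<in> B"
      unfolding thick_def by meson
    with 2 ab show ?thesis by (intro exI[of _ d]) auto
  qed
qed

lemma thick_interval:
  fixes I :: "real set"
  assumes "is_interval I" "interior I \<noteq> {}"
  shows "thick I"
  unfolding thick_def
proof clarify
  fix x i e :: real
  assume x: "x \<in> I" and i: "i \<in> Basis" and e: "e > 0"
  obtain c r where cr: "r > 0" "ball c r \<subseteq> I"
    using assms(2) by (auto simp: mem_interior)
  have "\<exists>y\<in>I. y \<noteq> x"
    using cr by (intro bexI[of _ "if x = c then c + r / 2 else c"]) (auto simp: subset_iff dist_real_def)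
  then obtain y where y: "y \<in> I" "y \<noteq> x" by blast
  \<comment> \<open>A step from \<open>x\<close> towards the other point \<open>y\<close> that does
    not pass \<open>y\<close> stays in the interval by convexity; cutting it at \<open>e / 2\<close>
    keeps it short.\<close>
  define d where "d = (if y > x then min (e / 2) (y - x) else - min (e / 2) (x - y))"
  have "x + d \<in> I"
    using mem_is_interval_1_I[OF assms(1) x y(1), of "x + d"]
      mem_is_interval_1_I[OF assms(1) y(1) x, of "x + d"] y e
    by (auto simp: d_def min_def split: if_splits)
  then show "\<exists>d. 0 < \<bar>d\<bar> \<and> \<bar>d\<bar> < e \<and> x + d *\<^sub>R i \<in> I"
    using i y e by (intro exI[of _ d]) (auto simp: d_def)
qed

lemma thick_layer: "thick layer"
  unfolding layer_eq
  by (intro thick_Times thick_interval) (auto simp: is_interval_univ is_interval_cc)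

lemma Basis_point: "(Basis :: point set) = {(1, 0, 0), (0, 1, 0), (0, 0, 1)}"
  by (auto simp: Basis_prod_def zero_prod_def)

lemma has_derivative_layer:
  fixes f :: "point \<Rightarrow> 'b::real_normed_vector"
  assumes "f differentiable_on layer" "p \<in> layer"
  shows "(f has_derivative (\<lambda>(a, b, c). a *\<^sub>R d_x f p + b *\<^sub>R d_y f p + c *\<^sub>R d_z f p)) (at p within layer)"
proof -
  let ?D = "\<lambda>v. pderiv_within layer v f p"
  have D: "(f has_derivative ?D) (at p within layer)"
    using has_derivative_pderiv_within assms by blast
  then interpret linear ?D by (rule has_derivative_linear)
  have "?D (a, b, c) = a *\<^sub>R d_x f p + b *\<^sub>R d_y f p + c *\<^sub>R d_z f p" for a b c
  proof -
    have "(a, b, c) = a *\<^sub>R (1, 0, 0) + b *\<^sub>R (0, 1, 0) + c *\<^sub>R ((0, 0, 1) :: point)" by simp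
    then show ?thesis by (simp only: add scale d_x_def d_y_def d_z_def)
  qed
  then have "?D = (\<lambda>(a, b, c). a *\<^sub>R d_x f p + b *\<^sub>R d_y f p + c *\<^sub>R d_z f p)"
    by auto
  then show ?thesis using D by simp
qed

lemma layer_derivs_eqI:
  fixes f :: "point \<Rightarrow> 'b::real_normed_vector"
  assumes "(f has_derivative f') (at p within layer)" "p \<in> layer"
  shows "d_x f p = f' (1, 0, 0)" "d_y f p = f' (0, 1, 0)" "d_z f p = f' (0, 0, 1)"
  unfolding d_x_def d_y_def d_z_def using pderiv_within_eqI[OF thick_layer assms(2,1)] by auto

lemma layer_derivs_cong:
  assumes "\<And>q. q \<in> layer \<Longrightarrow> f q = g q" "p \<in> layer"
  shows "d_x f p = d_x g p" "d_y f p = d_y g p" "d_z f p = d_z g p"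
  unfolding d_x_def d_y_def d_z_def by (auto intro: pderiv_within_cong assms)

text \<open>The layer has no lateral boundary, so the restrictions to horizontal lines have
  two-sided derivatives; only the vertical derivative is relative to an interval. This is the bridge
  to one-variable calculus.\<close>

lemma layer_line_derivs:
  fixes f :: "point \<Rightarrow> real"
  assumes "f differentiable_on layer" "z \<in> {0..1}"
  shows "((\<lambda>s. f (s, y, z)) has_real_derivative d_x f (x, y, z)) (at x)"
    and "((\<lambda>s. f (x, s, z)) has_real_derivative d_y f (x, y, z)) (at y)"
    and "((\<lambda>s. f (x, y, s)) has_real_derivative d_z f (x, y, z)) (at z within {0..1})"
proof -
  have p: "(x, y, z) \<in> layer" using assms by (simp add: layer_eq)
  note D = has_derivative_layer[OF assms(1) p]
  have line: "(f \<circ> g has_derivative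
      (\<lambda>(a, b, c). a * d_x f (x, y, z) + b * d_y f (x, y, z) + c * d_z f (x, y, z)) \<circ> g') (at r within R)"
    if "(g has_derivative g') (at r within R)" "g ` R \<subseteq> layer" "g r = (x, y, z)" for g g' r R
    using diff_chain_within[OF that(1), of f] has_derivative_subset[OF D that(2)] that(3) by simp
  have "((\<lambda>s. (s, y, z)) has_derivative (\<lambda>h. (h, 0, 0))) (at x within UNIV)"
    "((\<lambda>s. (x, s, z)) has_derivative (\<lambda>h. (0, h, 0))) (at y within UNIV)"
    "((\<lambda>s. (x, y, s)) has_derivative (\<lambda>h. (0, 0, h))) (at z within {0..1})"
    by (auto intro!: derivative_eq_intros simp: zero_prod_def)
  from this[THEN line] show "((\<lambda>s. f (s, y, z)) has_real_derivative d_x f (x, y, z)) (at x)"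
    "((\<lambda>s. f (x, s, z)) has_real_derivative d_y f (x, y, z)) (at y)"
    "((\<lambda>s. f (x, y, s)) has_real_derivative d_z f (x, y, z)) (at z within {0..1})"
    using assms(2)
    by (auto simp: layer_eq has_field_derivative_def o_def image_subset_iff mult.commute[of _ "d_x f (x, y, z)"]
      mult.commute[of _ "d_y f (x, y, z)"] mult.commute[of _ "d_z f (x, y, z)"])
qed

text \<open>Horizontal translations map the layer into itself, so the chain rule applies within it.
  This is how periodicity passes to derivatives.\<close>

lemma layer_derivs_translate:
  fixes f :: "point \<Rightarrow> real"
  assumes "f differentiable_on layer" "\<And>q. q \<in> layer \<Longrightarrow> f (q + (a, b, 0)) = f q" "p \<in> layer"
  shows "d_x f (p + (a, b, 0)) = d_x f p" "d_y f (p + (a, b, 0)) = d_y f p"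
    "d_z f (p + (a, b, 0)) = d_z f p"
proof -
  let ?\<tau> = "\<lambda>q. q + (a, b, 0) :: point"
  have sub: "?\<tau> ` layer \<subseteq> layer" and p: "?\<tau> p \<in> layer"
    using assms(3) by (auto simp: layer_eq)
  have "(?\<tau> has_derivative (\<lambda>v. v)) (at p within layer)"
    by (auto intro!: derivative_eq_intros)
  from diff_chain_within[OF this has_derivative_subset[OF has_derivative_layer[OF assms(1) p] sub]]
  have "(f \<circ> ?\<tau> has_derivative
      (\<lambda>(a', b', c'). a' * d_x f (?\<tau> p) + b' * d_y f (?\<tau> p) + c' * d_z f (?\<tau> p))) (at p within layer)"
    by (simp add: o_def)
  then have "(f has_derivative
      (\<lambda>(a', b', c'). a' * d_x f (?\<tau> p) + b' * d_y f (?\<tau> p) + c' * d_z f (?\<tau> p))) (at p within layer)"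
    by (rule has_derivative_transform[OF assms(3), rotated]) (simp add: assms(2))
  from layer_derivs_eqI[OF this assms(3)]
  show "d_x f (p + (a, b, 0)) = d_x f p" "d_y f (p + (a, b, 0)) = d_y f p"
    "d_z f (p + (a, b, 0)) = d_z f p"
    by auto
qed

lemma layer_derivs_add:
  fixes f g :: "point \<Rightarrow> real"
  assumes "f differentiable_on layer" "g differentiable_on layer" "p \<in> layer"
  shows "d_x (\<lambda>p. f p + g p) p = d_x f p + d_x g p"
    "d_y (\<lambda>p. f p + g p) p = d_y f p + d_y g p"
    "d_z (\<lambda>p. f p + g p) p = d_z f p + d_z g p"
  using layer_derivs_eqI[OF has_derivative_add[OF has_derivative_layer[OF assms(1,3)]
        has_derivative_layer[OF assms(2,3)]] assms(3)]
  by auto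

lemma layer_derivs_mult:
  fixes f g :: "point \<Rightarrow> real"
  assumes "f differentiable_on layer" "g differentiable_on layer" "p \<in> layer"
  shows "d_x (\<lambda>p. f p * g p) p = f p * d_x g p + d_x f p * g p"
    "d_y (\<lambda>p. f p * g p) p = f p * d_y g p + d_y f p * g p"
    "d_z (\<lambda>p. f p * g p) p = f p * d_z g p + d_z f p * g p"
  using layer_derivs_eqI[OF has_derivative_mult[OF has_derivative_layer[OF assms(1,3)]
        has_derivative_layer[OF assms(2,3)]] assms(3)]
  by auto

lemma layer_derivs_const:
  assumes "p \<in> layer"
  shows "d_x (\<lambda>p. c) p = 0" "d_y (\<lambda>p. c) p = 0" "d_z (\<lambda>p. c) p = 0"
  using layer_derivs_eqI[OF has_derivative_const assms] by auto

lemma layer_derivs_bounded_linear: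
  assumes "bounded_linear h" "f differentiable_on layer" "p \<in> layer"
  shows "d_x (\<lambda>p. h (f p)) p = h (d_x f p)" "d_y (\<lambda>p. h (f p)) p = h (d_y f p)"
    "d_z (\<lambda>p. h (f p)) p = h (d_z f p)"
  using layer_derivs_eqI[OF bounded_linear.has_derivative[OF assms(1)
        has_derivative_layer[OF assms(2,3)]] assms(3)]
  by auto

section \<open>Smooth horizontally periodic functions\<close>

locale periodic_layer =
  fixes Lx Ly :: real
  assumes Lx_pos: "Lx > 0" and Ly_pos: "Ly > 0"
begin

definition tame :: "(point \<Rightarrow> real) \<Rightarrow> bool" where
  "tame f \<longleftrightarrow> smooth_on layer f \<and> horiz_periodic Lx Ly f"

lemma tame_differentiable: "tame f \<Longrightarrow> f differentiable_on layer"
  by (simp add: tame_def smooth_on_imp_differentiable)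

lemma tame_continuous: "tame f \<Longrightarrow> continuous_on layer f"
  by (simp add: tame_def smooth_on_imp_continuous)

lemma tame_periodic:
  assumes "tame f" "z \<in> {0..1}"
  shows "f (x + Lx, y, z) = f (x, y, z)" "f (x, y + Ly, z) = f (x, y, z)"
  using assms by (auto simp: tame_def horiz_periodic_def)

lemma tame_const: "tame (\<lambda>p. c)"
  by (simp add: tame_def smooth_on_def Ck_on_const thick_layer horiz_periodic_def)

lemma tame_add: "tame f \<Longrightarrow> tame g \<Longrightarrow> tame (\<lambda>p. f p + g p)"
  by (simp add: tame_def smooth_on_def Ck_on_add thick_layer horiz_periodic_def)

lemma tame_mult: "tame f \<Longrightarrow> tame g \<Longrightarrow> tame (\<lambda>p. f p * g p)"
  by (simp add: tame_def smooth_on_def Ck_on_mult thick_layer horiz_periodic_def)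

lemma tame_uminus: "tame f \<Longrightarrow> tame (\<lambda>p. - f p)"
  using tame_mult[OF tame_const[of "-1"]] by simp

lemma tame_diff: "tame f \<Longrightarrow> tame g \<Longrightarrow> tame (\<lambda>p. f p - g p)"
  using tame_add[OF _ tame_uminus] by fastforce

lemma tame_power: "tame f \<Longrightarrow> tame (\<lambda>p. f p ^ n)"
  by (induction n) (auto intro: tame_const tame_mult)

lemma tame_derivs:
  assumes "tame f"
  shows "tame (d_x f)" "tame (d_y f)" "tame (d_z f)"
proof -
  have "smooth_on layer (d_x f)" "smooth_on layer (d_y f)" "smooth_on layer (d_z f)"
    unfolding d_x_def d_y_def d_z_def using assms
    by (auto intro!: smooth_on_pderiv_within simp: tame_def Basis_point)
  moreover
  have "f (q + (Lx, 0, 0)) = f q" "f (q + (0, Ly, 0)) = f q" if "q \<in> layer" for q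
    using that tame_periodic[OF assms] by (auto simp: layer_eq)
  from layer_derivs_translate[OF tame_differentiable[OF assms] this(1)]
    layer_derivs_translate[OF tame_differentiable[OF assms] this(2)]
  have "horiz_periodic Lx Ly (d_x f)" "horiz_periodic Lx Ly (d_y f)" "horiz_periodic Lx Ly (d_z f)"
    by (auto simp: horiz_periodic_def layer_eq)
  ultimately show "tame (d_x f)" "tame (d_y f)" "tame (d_z f)"
    by (auto simp: tame_def)
qed

lemmas tame_intros = tame_const tame_add tame_mult tame_uminus tame_diff tame_power tame_derivs

lemma derivs_diff:
  assumes "tame f" "tame g" "p \<in> layer"
  shows "d_x (\<lambda>p. f p - g p) p = d_x f p - d_x g p"
    "d_y (\<lambda>p. f p - g p) p = d_y f p - d_y g p"
    "d_z (\<lambda>p. f p - g p) p = d_z f p - d_z g p"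
  using layer_derivs_eqI[OF has_derivative_diff[OF
        has_derivative_layer[OF tame_differentiable[OF assms(1)] assms(3)]
        has_derivative_layer[OF tame_differentiable[OF assms(2)] assms(3)]] assms(3)]
  by auto

lemma derivs_uminus:
  assumes "tame f" "p \<in> layer"
  shows "d_x (\<lambda>p. - f p) p = - d_x f p" "d_y (\<lambda>p. - f p) p = - d_y f p"
    "d_z (\<lambda>p. - f p) p = - d_z f p"
  using layer_derivs_eqI[OF has_derivative_minus[OF
        has_derivative_layer[OF tame_differentiable[OF assms(1)] assms(2)]] assms(2)]
  by auto

lemmas derivs_add = layer_derivs_add[OF tame_differentiable tame_differentiable]
lemmas derivs_mult = layer_derivs_mult[OF tame_differentiable tame_differentiable]

lemmas line_derivs = layer_line_derivs[OF tame_differentiable]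

text \<open>Write \<open>f\<close> as an integral of \<open>d_y f\<close> in \<open>y\<close>,
  differentiate in \<open>x\<close> under the integral sign, then differentiate in the upper limit.
  Everything happens in one horizontal plane, so the boundary planes need no special
  treatment.\<close>

lemma mixed_derivs:
  assumes f: "tame f" and p: "p \<in> layer"
  shows "d_x (d_y f) p = d_y (d_x f) p"
proof -
  obtain x y z where xyz: "p = (x, y, z)" and z: "z \<in> {0..1}" using p by (auto simp: layer_eq)
  \<comment> \<open>The base point \<open>y - 1\<close> is an arbitrary choice below
    \<open>y\<close>; it leaves \<open>s\<close> free to vary on both sides of
    \<open>y\<close>.\<close>
  have *: "d_x f (x, s, z) = d_x f (x, y - 1, z) + integral {y - 1..s} (\<lambda>r. d_x (d_y f) (x, r, z))"
    if s: "s \<in> {y - 1..y + 1}" for s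
  proof -
    have ftc: "f (x', s, z) = f (x', y - 1, z) + integral {y - 1..s} (\<lambda>r. d_y f (x', r, z))" for x'
    proof -
      have "((\<lambda>r. d_y f (x', r, z)) has_integral (f (x', s, z) - f (x', y - 1, z))) {y - 1..s}"
        using s line_derivs(2)[OF f z]
        by (intro fundamental_theorem_of_calculus)
          (auto simp: has_real_derivative_iff_has_vector_derivative[symmetric] has_field_derivative_at_within)
      from integral_unique[OF this] show ?thesis by simp
    qed
    have "((\<lambda>x'. integral (cbox (y - 1) s) (\<lambda>r. d_y f (x', r, z))) has_real_derivative
        integral (cbox (y - 1) s) (\<lambda>r. d_x (d_y f) (x, r, z))) (at x within UNIV)"
    proof (rule leibniz_rule_field_derivative)
      show "((\<lambda>x'. d_y f (x', r, z)) has_real_derivative d_x (d_y f) (x', r, z)) (at x' within UNIV)" for x' r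
        using line_derivs(1)[OF tame_derivs(2)[OF f] z] by simp
      show "(\<lambda>r. d_y f (x', r, z)) integrable_on cbox (y - 1) s" for x'
        using z by (intro integrable_continuous continuous_on_compose2[OF tame_continuous[OF tame_derivs(2)[OF f]]])
          (auto intro!: continuous_intros simp: layer_eq)
      show "continuous_on (UNIV \<times> cbox (y - 1) s) (\<lambda>(x', r). d_x (d_y f) (x', r, z))"
        unfolding case_prod_unfold using z
        by (intro continuous_on_compose2[OF tame_continuous[OF tame_derivs(1)[OF tame_derivs(2)[OF f]]]])
          (auto intro!: continuous_intros simp: layer_eq)
    qed auto
    then have "((\<lambda>x'. f (x', y - 1, z) + integral {y - 1..s} (\<lambda>r. d_y f (x', r, z))) has_real_derivative
        d_x f (x, y - 1, z) + integral {y - 1..s} (\<lambda>r. d_x (d_y f) (x, r, z))) (at x)"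
      using line_derivs(1)[OF f z] by (intro DERIV_add) auto
    moreover have "(\<lambda>x'. f (x', y - 1, z) + integral {y - 1..s} (\<lambda>r. d_y f (x', r, z))) = (\<lambda>x'. f (x', s, z))"
      by (rule ext) (rule ftc[symmetric])
    ultimately show ?thesis
      using DERIV_unique[OF line_derivs(1)[OF f z]] by simp
  qed
  have "((\<lambda>s. integral {y - 1..s} (\<lambda>r. d_x (d_y f) (x, r, z))) has_real_derivative
      d_x (d_y f) (x, y, z)) (at y within {y - 1..y + 1})"
    using z by (intro integral_has_real_derivative
        continuous_on_compose2[OF tame_continuous[OF tame_derivs(1)[OF tame_derivs(2)[OF f]]]])
      (auto intro!: continuous_intros simp: layer_eq)
  then have "((\<lambda>s. integral {y - 1..s} (\<lambda>r. d_x (d_y f) (x, r, z))) has_real_derivative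
      d_x (d_y f) (x, y, z)) (at y)"
    by (subst (asm) at_within_Icc_at) auto
  then have "((\<lambda>s. d_x f (x, y - 1, z) + integral {y - 1..s} (\<lambda>r. d_x (d_y f) (x, r, z))) has_real_derivative
      0 + d_x (d_y f) (x, y, z)) (at y)"
    by (intro DERIV_add DERIV_const)
  moreover have "eventually (\<lambda>s. s \<in> {y - 1<..<y + 1}) (nhds y)"
    by (intro eventually_nhds_in_open) auto
  then have "eventually (\<lambda>s. d_x f (x, y - 1, z) + integral {y - 1..s} (\<lambda>r. d_x (d_y f) (x, r, z))
      = d_x f (x, s, z)) (nhds y)"
    by (rule eventually_mono) (rule *[symmetric], simp)
  ultimately have "((\<lambda>s. d_x f (x, s, z)) has_real_derivative d_x (d_y f) (x, y, z)) (at y)"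
    using DERIV_cong_ev[OF refl, of "\<lambda>s. d_x f (x, y - 1, z) + integral {y - 1..s} (\<lambda>r. d_x (d_y f) (x, r, z))"
        "\<lambda>s. d_x f (x, s, z)" y] by simp
  then show ?thesis
    unfolding xyz using DERIV_unique[OF line_derivs(2)[OF tame_derivs(1)[OF f] z]] by metis
qed

end

section \<open>Inequalities for functions of one variable\<close>

text \<open>The integral of the square of \<open>r * f + s * g\<close> is a nonnegative quadratic
  form in \<open>r\<close> and \<open>s\<close>. Inserting \<open>r = ?B\<close> and
  \<open>s = - ?C\<close> gives the claim multiplied by \<open>?B\<close>, which is why
  \<open>?B = 0\<close> is treated apart.\<close>

lemma integral_Cauchy_Schwarz:
  fixes f g :: "'a::euclidean_space \<Rightarrow> real"
  assumes f: "continuous_on (cbox a b) f" and g: "continuous_on (cbox a b) g"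
  shows "(integral (cbox a b) (\<lambda>x. f x * g x))\<^sup>2 \<le>
    integral (cbox a b) (\<lambda>x. (f x)\<^sup>2) * integral (cbox a b) (\<lambda>x. (g x)\<^sup>2)"
    (is "?C\<^sup>2 \<le> ?A * ?B")
proof -
  have *: "r\<^sup>2 * ?A + 2 * r * s * ?C + s\<^sup>2 * ?B \<ge> 0" for r s
  proof -
    have "0 \<le> integral (cbox a b) (\<lambda>x. (r * f x + s * g x)\<^sup>2)"
      by (rule integral_nonneg) (auto intro!: integrable_continuous continuous_intros f g)
    also have "\<dots> = integral (cbox a b)
        (\<lambda>x. r\<^sup>2 * (f x)\<^sup>2 + (2 * r * s) * (f x * g x) + s\<^sup>2 * (g x)\<^sup>2)"
      by (rule integral_cong) (simp add: power2_eq_square algebra_simps)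
    also have "\<dots> = r\<^sup>2 * ?A + 2 * r * s * ?C + s\<^sup>2 * ?B"
      by (subst integral_add integral_mult_right,
          (auto intro!: integrable_continuous continuous_intros f g)[2])+ simp
    finally show ?thesis .
  qed
  have B: "?B \<ge> 0"
    by (rule integral_nonneg) (auto intro!: integrable_continuous continuous_intros g)
  show ?thesis
  proof (cases "?B = 0")
    case False
    have "?B * (?A * ?B - ?C\<^sup>2) = ?B\<^sup>2 * ?A + 2 * ?B * (- ?C) * ?C + (- ?C)\<^sup>2 * ?B"
      by (simp add: power2_eq_square algebra_simps)
    then have "?B * (?A * ?B - ?C\<^sup>2) \<ge> 0" using *[of ?B "- ?C"] by simp
    then show ?thesis using False B by (simp add: zero_le_mult_iff)
  next
    case True
    have "?C = 0"
    proof (rule ccontr)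
      assume "?C \<noteq> 0"
      \<comment> \<open>For \<open>?B = 0\<close> and \<open>r = 1\<close> the form is affine in
        \<open>s\<close>; this \<open>s\<close> is chosen to give it the value -1.\<close>
      then have "1\<^sup>2 * ?A + 2 * 1 * (- (?A + 1) / (2 * ?C)) * ?C + (- (?A + 1) / (2 * ?C))\<^sup>2 * ?B = -1"
        using True by (simp add: field_simps)
      then show False using *[of 1 "- (?A + 1) / (2 * ?C)"] by linarith
    qed
    then show ?thesis using True by simp
  qed
qed

text \<open>Comparison with the positive function \<open>cos (\<mu> * (x - c))\<close>, \<open>c\<close> the midpoint: for
  \<open>\<mu> < pi / (b - a)\<close> the difference of the integrands is a square minus the derivative of
  \<open>\<mu> * tan (\<mu> * (x - c)) * (f x)\<^sup>2\<close>.\<close>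

lemma wirtinger_Dirichlet:
  fixes f f' :: "real \<Rightarrow> real"
  assumes ab: "a < b"
    and f: "\<And>x. x \<in> {a..b} \<Longrightarrow> (f has_real_derivative f' x) (at x within {a..b})"
    and f': "continuous_on {a..b} f'" and "f a = 0" "f b = 0"
  shows "integral {a..b} (\<lambda>x. (f x)\<^sup>2) \<le> ((b - a) / pi)\<^sup>2 * integral {a..b} (\<lambda>x. (f' x)\<^sup>2)"
proof -
  have cf: "continuous_on {a..b} f"
    using f DERIV_continuous_on by blast
  let ?I = "integral {a..b} (\<lambda>x. (f x)\<^sup>2)" and ?J = "integral {a..b} (\<lambda>x. (f' x)\<^sup>2)"
  have le: "\<mu>\<^sup>2 * ?I \<le> ?J" if \<mu>: "\<mu> \<in> {0<..<pi / (b - a)}" for \<mu>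
  proof -
    define \<theta> where "\<theta> x = \<mu> * (x - (a + b) / 2)" for x
    define G' where "G' x = \<mu>\<^sup>2 * (1 + (tan (\<theta> x))\<^sup>2) * (f x)\<^sup>2 + 2 * \<mu> * tan (\<theta> x) * f x * f' x" for x
    have cos: "cos (\<theta> x) \<noteq> 0" if "x \<in> {a..b}" for x
    proof -
      have "\<bar>x - (a + b) / 2\<bar> \<le> (b - a) / 2"
        using that by (auto simp: abs_le_iff field_simps)
      then have "\<bar>\<theta> x\<bar> \<le> \<mu> * ((b - a) / 2)"
        using \<mu> by (simp add: \<theta>_def abs_mult mult_left_mono)
      also have "\<dots> < pi / 2" using \<mu> ab by (simp add: field_simps)
      finally have "- (pi / 2) < \<theta> x" "\<theta> x < pi / 2" by linarith+
      then show ?thesis using cos_gt_zero_pi by fastforce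
    qed
    have "((\<lambda>x. \<mu> * tan (\<theta> x) * (f x)\<^sup>2) has_real_derivative G' x) (at x within {a..b})"
      if "x \<in> {a..b}" for x
    proof -
      have "((\<lambda>x. tan (\<theta> x)) has_real_derivative (1 + (tan (\<theta> x))\<^sup>2) * \<mu>) (at x within {a..b})"
        using cos[OF that] unfolding tan_sec[OF cos[OF that]]
        by (auto intro!: derivative_eq_intros simp: \<theta>_def power_inverse)
      from DERIV_mult[OF DERIV_cmult[OF this] DERIV_power[OF f[OF that]], of \<mu> 2]
      show ?thesis
        by (rule DERIV_cong) (simp add: G'_def power2_eq_square algebra_simps)
    qed
    then have "(G' has_integral (\<mu> * tan (\<theta> b) * (f b)\<^sup>2 - \<mu> * tan (\<theta> a) * (f a)\<^sup>2)) {a..b}"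
      using ab by (intro fundamental_theorem_of_calculus)
        (auto simp: has_real_derivative_iff_has_vector_derivative)
    then have G': "(G' has_integral 0) {a..b}" using assms by simp
    have sq: "(\<lambda>x. (f x)\<^sup>2) integrable_on {a..b}" "(\<lambda>x. (f' x)\<^sup>2) integrable_on {a..b}"
      by (auto intro!: integrable_continuous_real continuous_intros cf f')
    have "((\<lambda>x. (f' x)\<^sup>2 - \<mu>\<^sup>2 * (f x)\<^sup>2 + G' x) has_integral (?J - \<mu>\<^sup>2 * ?I + 0)) {a..b}"
      using sq by (intro has_integral_add has_integral_diff has_integral_mult_right G') auto
    moreover have "0 \<le> (f' x)\<^sup>2 - \<mu>\<^sup>2 * (f x)\<^sup>2 + G' x" for x
    proof -
      have "(f' x)\<^sup>2 - \<mu>\<^sup>2 * (f x)\<^sup>2 + G' x = (f' x + \<mu> * tan (\<theta> x) * f x)\<^sup>2"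
        by (simp add: G'_def power2_eq_square algebra_simps)
      then show ?thesis by simp
    qed
    ultimately have "0 \<le> ?J - \<mu>\<^sup>2 * ?I + 0"
      by (rule has_integral_nonneg)
    then show ?thesis by simp
  qed
  \<comment> \<open>At the critical frequency the cosine vanishes at both end points and the tangent
    blows up there, so the sharp constant is reached only as a limit from below.\<close>
  have "((\<lambda>\<mu>. \<mu>\<^sup>2 * ?I) \<longlongrightarrow> (pi / (b - a))\<^sup>2 * ?I) (at_left (pi / (b - a)))"
    by (intro tendsto_intros)
  moreover have "eventually (\<lambda>\<mu>. \<mu>\<^sup>2 * ?I \<le> ?J) (at_left (pi / (b - a)))"
    by (rule eventually_mono[OF eventually_at_left_real le]) (use ab in auto)
  ultimately have "(pi / (b - a))\<^sup>2 * ?I \<le> ?J"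
    by (rule tendsto_upperbound) simp
  then show ?thesis using ab by (simp add: power_divide field_simps)
qed

lemma integral_periodic_shift:
  fixes g :: "real \<Rightarrow> real"
  assumes "continuous_on UNIV g" "\<And>x. g (x + L) = g x" "0 \<le> c" "c \<le> L"
  shows "integral {c..c + L} g = integral {0..L} g"
proof -
  have int: "g integrable_on {r..s}" for r s
    using assms(1) by (intro integrable_continuous_real) (auto intro: continuous_on_subset)
  have "integral {L..c + L} g = integral {0..c} g"
    using integral_shift[of 0 L c g] assms(2) continuous_on_subset[OF assms(1)]
    by (simp add: o_def add.commute)
  then show ?thesis
    using Henstock_Kurzweil_Integration.integral_combine[of c L "c + L" g]
      Henstock_Kurzweil_Integration.integral_combine[of 0 c L g] int assms(3,4) by simp
qed

text \<open>The intermediate value theorem gives \<open>c\<close> with \<open>f c = f (c + L / 2)\<close>; after subtracting this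
  value the Dirichlet inequality applies on both half periods.\<close>

lemma wirtinger_periodic:
  fixes f f' :: "real \<Rightarrow> real"
  assumes L: "L > 0" and f: "\<And>x. (f has_real_derivative f' x) (at x)"
    and f': "continuous_on UNIV f'" and per: "\<And>x. f (x + L) = f x"
    and mean: "integral {0..L} f = 0"
  shows "integral {0..L} (\<lambda>x. (f x)\<^sup>2) \<le> (L / (2 * pi))\<^sup>2 * integral {0..L} (\<lambda>x. (f' x)\<^sup>2)"
proof -
  have cf: "continuous_on S f" for S
    using f by (meson DERIV_continuous_on has_field_derivative_at_within)
  have cf': "continuous_on S f'" for S
    using f' continuous_on_subset by blast
  have per': "f' (x + L) = f' x" for x
  proof -
    have "(f has_real_derivative f' (x + L)) (at x)"
      using f[of "x + L"] by (simp add: DERIV_shift per)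
    then show ?thesis using DERIV_unique f by blast
  qed
  define h where "h x = f (x + L / 2) - f x" for x
  \<comment> \<open>Periodicity makes the values of \<open>h\<close> at \<open>0\<close> and at
    \<open>L / 2\<close> opposite, so \<open>h\<close> has a zero in between.\<close>
  have "\<exists>c\<in>{0..L / 2}. h c = 0"
  proof -
    have ch: "continuous_on {0..L / 2} h"
      unfolding h_def by (intro continuous_intros continuous_on_compose2[OF cf[of UNIV]]) auto
    have "h (L / 2) = - h 0" using per[of 0] by (simp add: h_def)
    then consider "h 0 \<le> 0" "0 \<le> h (L / 2)" | "h (L / 2) \<le> 0" "0 \<le> h 0" by linarith
    then show ?thesis
      using IVT'[of h 0 0 "L / 2", OF _ _ _ ch] IVT2'[of h "L / 2" 0 0, OF _ _ _ ch] L by cases force+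
  qed
  then obtain c where "c \<in> {0..L / 2}" "h c = 0" by blast
  then have c: "0 \<le> c" "c \<le> L / 2" "f (c + L / 2) = f c" by (simp_all add: h_def)
  define g where "g x = f x - f c" for x
  have g: "(g has_real_derivative f' x) (at x within S)" for x S
    unfolding g_def
    using DERIV_diff[OF has_field_derivative_at_within[OF f] DERIV_const] by fastforce
  have cg: "continuous_on S g" for S
    unfolding g_def by (intro continuous_intros cf)
  have int: "(\<lambda>x. (g x)\<^sup>2) integrable_on {r..s}" "(\<lambda>x. (f' x)\<^sup>2) integrable_on {r..s}"
    "f integrable_on {r..s}" "(\<lambda>x. (f x)\<^sup>2) integrable_on {r..s}" for r s
    by (auto intro!: integrable_continuous_real continuous_intros cg cf cf')
  have half: "integral {r..r + L / 2} (\<lambda>x. (g x)\<^sup>2)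
      \<le> (L / (2 * pi))\<^sup>2 * integral {r..r + L / 2} (\<lambda>x. (f' x)\<^sup>2)"
    if "g r = 0" "g (r + L / 2) = 0" for r
    using wirtinger_Dirichlet[of r "r + L / 2" g f', OF _ g cf'] that L by (simp add: mult.commute)
  have eq: "c + L / 2 + L / 2 = c + L" by simp
  have "g c = 0" "g (c + L / 2) = 0" "g (c + L) = 0"
    using c per[of c] by (auto simp: g_def)
  then have "integral {c..c + L} (\<lambda>x. (g x)\<^sup>2) \<le> (L / (2 * pi))\<^sup>2 * integral {c..c + L} (\<lambda>x. (f' x)\<^sup>2)"
    using add_mono[OF half[of c] half[of "c + L / 2", unfolded eq]] L
      Henstock_Kurzweil_Integration.integral_combine[of c "c + L / 2" "c + L", OF _ _ int(1)]
      Henstock_Kurzweil_Integration.integral_combine[of c "c + L / 2" "c + L", OF _ _ int(2)]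
    unfolding distrib_left[symmetric] by simp
  moreover have "integral {c..c + L} (\<lambda>x. (g x)\<^sup>2) = integral {0..L} (\<lambda>x. (g x)\<^sup>2)"
    by (rule integral_periodic_shift) (use c per L in \<open>auto intro!: continuous_intros cf simp: g_def\<close>)
  moreover have "integral {c..c + L} (\<lambda>x. (f' x)\<^sup>2) = integral {0..L} (\<lambda>x. (f' x)\<^sup>2)"
    by (rule integral_periodic_shift) (use c per' L in \<open>auto intro!: continuous_intros cf'\<close>)
  \<comment> \<open>Among all constants, subtracting the mean minimises the quadratic norm, and here
    the mean is zero.\<close>
  moreover have "integral {0..L} (\<lambda>x. (f x)\<^sup>2) \<le> integral {0..L} (\<lambda>x. (g x)\<^sup>2)"
  proof -
    have "((\<lambda>x. (f x)\<^sup>2 - 2 * f c * f x + (f c)\<^sup>2) has_integral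
        integral {0..L} (\<lambda>x. (f x)\<^sup>2) - 2 * f c * integral {0..L} f + (f c)\<^sup>2 * L) {0..L}"
      using int(3,4) has_integral_const_real[of "(f c)\<^sup>2" 0 L] L
      by (intro has_integral_add has_integral_diff has_integral_mult_right) (auto simp: mult.commute)
    moreover have "(\<lambda>x. (f x)\<^sup>2 - 2 * f c * f x + (f c)\<^sup>2) = (\<lambda>x. (g x)\<^sup>2)"
      by (auto simp: g_def power2_eq_square algebra_simps)
    ultimately show ?thesis using mean L by (simp add: integral_unique)
  qed
  ultimately show ?thesis by simp
qed

text \<open>Two points of a circle are joined by two arcs, and along at least one of them the
  variation of \<open>h\<close> is at most half the total. So \<open>h x\<close> exceeds
  \<open>h y\<close> by at most that amount for every \<open>y\<close>; averaging over
  \<open>y\<close> gives the bound.\<close>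

lemma periodic_sup_bound:
  fixes h h' :: "real \<Rightarrow> real"
  assumes L: "L > 0" and h: "\<And>x. x \<in> {0..L} \<Longrightarrow> (h has_real_derivative h' x) (at x within {0..L})"
    and h': "continuous_on {0..L} h'" and per: "h L = h 0" and x: "x \<in> {0..L}"
  shows "h x \<le> integral {0..L} h / L + integral {0..L} (\<lambda>s. \<bar>h' s\<bar>) / 2"
proof -
  define V where "V = integral {0..L} (\<lambda>s. \<bar>h' s\<bar>)"
  have ch: "continuous_on {0..L} h" using h DERIV_continuous_on by blast
  have int: "(\<lambda>s. \<bar>h' s\<bar>) integrable_on {r..s}" "h' integrable_on {r..s}" if "0 \<le> r" "s \<le> L" for r s
    using that by (auto intro!: integrable_continuous_real continuous_intros intro: continuous_on_subset[OF h'])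
  have var: "\<bar>h s - h r\<bar> \<le> integral {r..s} (\<lambda>s. \<bar>h' s\<bar>)" if "0 \<le> r" "r \<le> s" "s \<le> L" for r s
  proof -
    have "(h' has_integral (h s - h r)) {r..s}"
      using that by (intro fundamental_theorem_of_calculus)
        (auto simp: has_real_derivative_iff_has_vector_derivative[symmetric] intro!: DERIV_subset[OF h])
    then have "integral {r..s} h' = h s - h r" by (rule integral_unique)
    then show ?thesis
      using integral_norm_bound_integral[of h' "{r..s}" "\<lambda>s. \<bar>h' s\<bar>"] int that by simp
  qed
  have osc: "\<bar>h s - h r\<bar> \<le> V / 2" if "0 \<le> r" "r \<le> s" "s \<le> L" for r s
  proof -
    have "V = integral {0..r} (\<lambda>s. \<bar>h' s\<bar>) + integral {r..s} (\<lambda>s. \<bar>h' s\<bar>) + integral {s..L} (\<lambda>s. \<bar>h' s\<bar>)"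
      using Henstock_Kurzweil_Integration.integral_combine[of 0 r s "\<lambda>s. \<bar>h' s\<bar>"]
        Henstock_Kurzweil_Integration.integral_combine[of 0 s L "\<lambda>s. \<bar>h' s\<bar>"] int that by (simp add: V_def)
    moreover have "\<bar>h r - h 0\<bar> \<le> integral {0..r} (\<lambda>s. \<bar>h' s\<bar>)"
      "\<bar>h s - h r\<bar> \<le> integral {r..s} (\<lambda>s. \<bar>h' s\<bar>)"
      "\<bar>h L - h s\<bar> \<le> integral {s..L} (\<lambda>s. \<bar>h' s\<bar>)"
      using var that by auto
    ultimately show ?thesis unfolding per by linarith
  qed
  have "integral {0..L} (\<lambda>y. h x) \<le> integral {0..L} (\<lambda>y. h y + V / 2)"
  proof (rule integral_le)
    show "(\<lambda>y. h y + V / 2) integrable_on {0..L}"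
      by (auto intro!: integrable_continuous_real continuous_intros ch)
    fix y assume y: "y \<in> {0..L}"
    show "h x \<le> h y + V / 2"
    proof (cases "x \<le> y")
      case True
      with x y have "\<bar>h y - h x\<bar> \<le> V / 2" by (intro osc) auto
      then show ?thesis by linarith
    next
      case False
      with x y have "\<bar>h x - h y\<bar> \<le> V / 2" by (intro osc) auto
      then show ?thesis by linarith
    qed
  qed auto
  also have "\<dots> = integral {0..L} h + L * (V / 2)"
    using L by (subst integral_add) (auto intro!: integrable_continuous_real ch)
  finally show ?thesis using L by (simp add: V_def[symmetric] field_simps)
qed

section \<open>Integrals over horizontal planes and over the layer\<close>

context periodic_layer
begin

definition pint :: "(point \<Rightarrow> real) \<Rightarrow> real \<Rightarrow> real" where
  "pint f z = integral (cbox (0, 0) (Lx, Ly)) (\<lambda>(x, y). f (x, y, z))"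

text \<open>The vertical integral is kept outside because the estimates are made plane by plane;
  \<open>integral_domain_V\<close> identifies the result with the volume integral.\<close>

definition vint :: "(point \<Rightarrow> real) \<Rightarrow> real" where
  "vint f = integral {0..1} (pint f)"

lemma continuous_on_plane:
  assumes "continuous_on layer f" "z \<in> {0..1}"
  shows "continuous_on S (\<lambda>(x, y). f (x, y, z))"
  unfolding case_prod_unfold using assms(2)
  by (intro continuous_on_compose2[OF assms(1)]) (auto intro!: continuous_intros simp: layer_eq)

lemma plane_integrable:
  fixes f :: "point \<Rightarrow> real"
  assumes "continuous_on layer f" "z \<in> {0..1}"
  shows "(\<lambda>(x, y). f (x, y, z)) integrable_on cbox (0, 0) (Lx, Ly)"
  by (intro integrable_continuous continuous_on_plane assms)

lemma pint_iterated:
  fixes f :: "point \<Rightarrow> real"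
  assumes "continuous_on layer f" "z \<in> {0..1}"
  shows "pint f z = integral {0..Lx} (\<lambda>x. integral {0..Ly} (\<lambda>y. f (x, y, z)))"
    and "pint f z = integral {0..Ly} (\<lambda>y. integral {0..Lx} (\<lambda>x. f (x, y, z)))"
  using integral_prod_continuous[OF continuous_on_plane[OF assms]]
    integral_swap_continuous[where f = "\<lambda>x y. f (x, y, z)", OF continuous_on_plane[OF assms]]
  by (auto simp: pint_def box_real)

lemma continuous_on_pint:
  assumes "continuous_on layer f"
  shows "continuous_on {0..1} (pint f)"
proof -
  have "continuous_on ({0..1} \<times> cbox (0, 0) (Lx, Ly)) (\<lambda>(z, q). case q of (x, y) \<Rightarrow> f (x, y, z))"
    unfolding case_prod_unfold
    by (intro continuous_on_compose2[OF assms]) (auto intro!: continuous_intros simp: layer_eq)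
  from integral_continuous_on_param[OF this] show ?thesis
    by (simp add: pint_def[abs_def])
qed

lemma pint_integrable: "continuous_on layer f \<Longrightarrow> pint f integrable_on {0..1}"
  by (intro integrable_continuous_real continuous_on_pint)

lemma pint_cong: "(\<And>x y. f (x, y, z) = g (x, y, z)) \<Longrightarrow> pint f z = pint g z"
  by (simp add: pint_def)

lemma pint_add:
  assumes "continuous_on layer f" "continuous_on layer g" "z \<in> {0..1}"
  shows "pint (\<lambda>p. f p + g p) z = pint f z + pint g z"
  using integral_add[OF plane_integrable[OF assms(1,3)] plane_integrable[OF assms(2,3)]]
  by (simp add: pint_def case_prod_unfold)

lemma pint_diff:
  assumes "continuous_on layer f" "continuous_on layer g" "z \<in> {0..1}"
  shows "pint (\<lambda>p. f p - g p) z = pint f z - pint g z"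
  using integral_diff[OF plane_integrable[OF assms(1,3)] plane_integrable[OF assms(2,3)]]
  by (simp add: pint_def case_prod_unfold)

lemma pint_cmult: "pint (\<lambda>p. c * f p) z = c * pint f z"
  by (simp add: pint_def case_prod_unfold)

lemma pint_uminus: "pint (\<lambda>p. - f p) z = - pint f z"
  using pint_cmult[of "-1"] by simp

lemma pint_const: "pint (\<lambda>p. c) z = c * (Lx * Ly)"
  using Lx_pos Ly_pos by (simp add: pint_def case_prod_unfold content_Pair)

lemma pint_mono:
  assumes "continuous_on layer f" "continuous_on layer g" "z \<in> {0..1}"
    "\<And>x y. x \<in> {0..Lx} \<Longrightarrow> y \<in> {0..Ly} \<Longrightarrow> f (x, y, z) \<le> g (x, y, z)"
  shows "pint f z \<le> pint g z"
  unfolding pint_def using assms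
  by (intro integral_le plane_integrable) (auto simp: cbox_Pair_eq)

lemma pint_nonneg:
  assumes "continuous_on layer f" "z \<in> {0..1}" "\<And>p. f p \<ge> 0"
  shows "pint f z \<ge> 0"
  using pint_mono[OF continuous_on_const assms(1,2), of 0] assms(3) pint_const[of 0] by simp

lemma pint_Cauchy_Schwarz:
  assumes "continuous_on layer f" "continuous_on layer g" "z \<in> {0..1}"
  shows "(pint (\<lambda>p. f p * g p) z)\<^sup>2 \<le> pint (\<lambda>p. (f p)\<^sup>2) z * pint (\<lambda>p. (g p)\<^sup>2) z"
  using integral_Cauchy_Schwarz[OF continuous_on_plane[OF assms(1,3)] continuous_on_plane[OF assms(2,3)]]
  by (simp add: pint_def case_prod_unfold)

lemma pint_derivative:
  assumes "tame f" "z \<in> {0..1}"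
  shows "(pint f has_real_derivative pint (d_z f) z) (at z within {0..1})"
  unfolding pint_def[abs_def]
proof (rule leibniz_rule_field_derivative)
  fix z' :: real and q assume "z' \<in> {0..1}" "q \<in> cbox (0, 0) (Lx, Ly)"
  then show "((\<lambda>z. case q of (x, y) \<Rightarrow> f (x, y, z)) has_real_derivative
      (case q of (x, y) \<Rightarrow> d_z f (x, y, z'))) (at z' within {0..1})"
    using line_derivs(3)[OF assms(1)] by (cases q) auto
next
  show "continuous_on ({0..1} \<times> cbox (0, 0) (Lx, Ly)) (\<lambda>(z, q). case q of (x, y) \<Rightarrow> d_z f (x, y, z))"
    unfolding case_prod_unfold
    by (intro continuous_on_compose2[OF tame_continuous[OF tame_derivs(3)[OF assms(1)]]])
      (auto intro!: continuous_intros simp: layer_eq)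
qed (use assms plane_integrable[OF tame_continuous[OF assms(1)]] in auto)

lemma pint_d_x:
  assumes "tame f" "z \<in> {0..1}"
  shows "pint (d_x f) z = 0"
proof -
  have "integral {0..Lx} (\<lambda>x. d_x f (x, y, z)) = 0" for y
  proof -
    have "((\<lambda>x. d_x f (x, y, z)) has_integral (f (Lx, y, z) - f (0, y, z))) {0..Lx}"
      using Lx_pos line_derivs(1)[OF assms]
      by (intro fundamental_theorem_of_calculus)
        (auto simp: has_real_derivative_iff_has_vector_derivative[symmetric] has_field_derivative_at_within)
    then show ?thesis using tame_periodic(1)[OF assms, of 0 y] by (simp add: integral_unique)
  qed
  then show ?thesis
    using pint_iterated(2)[OF tame_continuous[OF tame_derivs(1)[OF assms(1)]] assms(2)] by simp
qed

lemma pint_d_y: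
  assumes "tame f" "z \<in> {0..1}"
  shows "pint (d_y f) z = 0"
proof -
  have "integral {0..Ly} (\<lambda>y. d_y f (x, y, z)) = 0" for x
  proof -
    have "((\<lambda>y. d_y f (x, y, z)) has_integral (f (x, Ly, z) - f (x, 0, z))) {0..Ly}"
      using Ly_pos line_derivs(2)[OF assms]
      by (intro fundamental_theorem_of_calculus)
        (auto simp: has_real_derivative_iff_has_vector_derivative[symmetric] has_field_derivative_at_within)
    then show ?thesis using tame_periodic(2)[OF assms, of x 0] by (simp add: integral_unique)
  qed
  then show ?thesis
    using pint_iterated(1)[OF tame_continuous[OF tame_derivs(2)[OF assms(1)]] assms(2)] by simp
qed

lemma vint_d_z:
  assumes "tame f"
  shows "vint (d_z f) = pint f 1 - pint f 0"
  unfolding vint_def using pint_derivative[OF assms]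
  by (intro integral_unique fundamental_theorem_of_calculus)
    (auto simp: has_real_derivative_iff_has_vector_derivative[symmetric])

lemma vint_cong: "(\<And>p. p \<in> layer \<Longrightarrow> f p = g p) \<Longrightarrow> vint f = vint g"
  unfolding vint_def by (intro integral_cong pint_cong) (simp add: layer_eq)

lemma vint_add:
  assumes "continuous_on layer f" "continuous_on layer g"
  shows "vint (\<lambda>p. f p + g p) = vint f + vint g"
  unfolding vint_def using assms
  by (subst integral_add[symmetric]) (auto intro!: integral_cong pint_add pint_integrable)

lemma vint_diff:
  assumes "continuous_on layer f" "continuous_on layer g"
  shows "vint (\<lambda>p. f p - g p) = vint f - vint g"
  unfolding vint_def using assms
  by (subst integral_diff[symmetric]) (auto intro!: integral_cong pint_diff pint_integrable)

lemma vint_cmult: "vint (\<lambda>p. c * f p) = c * vint f"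
  by (simp add: vint_def pint_cmult[abs_def])

text \<open>The contributions of opposite lateral faces cancel by periodicity, so only the vertical
  component needs boundary values.\<close>

lemma vint_divergence:
  assumes "tame F1" "tame F2" "tame F3"
    and "\<And>x y. F3 (x, y, 0) = 0" "\<And>x y. F3 (x, y, 1) = 0"
  shows "vint (\<lambda>p. d_x F1 p + d_y F2 p + d_z F3 p) = 0"
proof -
  have "vint (d_x F1) = 0" "vint (d_y F2) = 0"
    unfolding vint_def using assms pint_d_x pint_d_y by (auto intro!: integral_unique has_integral_is_0)
  moreover have "vint (d_z F3) = 0"
    using vint_d_z[OF assms(3)] assms(4,5) by (simp add: pint_def)
  ultimately show ?thesis
    using assms by (simp add: vint_add tame_continuous tame_derivs continuous_on_add)
qed

lemma domain_V_cbox: "domain_V Lx Ly = cbox (0, 0, 0) (Lx, Ly, 1)"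
  by (auto simp: domain_V_def cbox_Pair_eq)

text \<open>Splitting the nested product first separates \<open>x\<close> from
  \<open>(y, z)\<close>; two exchanges then move \<open>z\<close> past \<open>y\<close> and past
  \<open>x\<close>.\<close>

lemma integral_domain_V:
  assumes "continuous_on layer f"
  shows "integral (domain_V Lx Ly) f = vint f"
proof -
  have "continuous_on (cbox (0, 0, 0) (Lx, Ly, 1)) f"
    by (rule continuous_on_subset[OF assms]) (auto simp: layer_eq cbox_Pair_eq)
  then have "integral (domain_V Lx Ly) f = integral {0..Lx} (\<lambda>x. integral (cbox (0, 0) (Ly, 1)) (\<lambda>q. f (x, q)))"
    by (simp add: domain_V_cbox integral_prod_continuous box_real)
  also have "\<dots> = integral (cbox 0 Lx) (\<lambda>x. integral (cbox 0 1) (\<lambda>z. integral {0..Ly} (\<lambda>y. f (x, y, z))))"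
  proof -
    have "integral (cbox (0, 0) (Ly, 1)) (\<lambda>q. f (x, q)) = integral (cbox 0 1) (\<lambda>z. integral {0..Ly} (\<lambda>y. f (x, y, z)))" for x
    proof -
      have "continuous_on (cbox (0, 0) (Ly, 1)) (\<lambda>q. f (x, q))"
        by (intro continuous_on_compose2[OF assms])
          (auto intro!: continuous_intros simp: layer_eq cbox_Pair_eq)
      then show ?thesis
        using integral_prod_continuous[of 0 0 Ly 1 "\<lambda>q. f (x, q)"]
          integral_swap_continuous[of 0 0 Ly 1 "\<lambda>y z. f (x, y, z)"]
        by (simp add: box_real case_prod_unfold)
    qed
    then show ?thesis by (simp add: box_real)
  qed
  also have "\<dots> = integral (cbox 0 1) (\<lambda>z. integral (cbox 0 Lx) (\<lambda>x. integral {0..Ly} (\<lambda>y. f (x, y, z))))"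
  proof (rule integral_swap_continuous)
    have "continuous_on (cbox (0, 0) (Lx, 1) \<times> cbox 0 Ly) (\<lambda>(q, y). f (fst q, y, snd q))"
      unfolding case_prod_unfold
      by (intro continuous_on_compose2[OF assms])
        (auto intro!: continuous_intros simp: layer_eq cbox_Pair_eq)
    from integral_continuous_on_param[OF this]
    show "continuous_on (cbox (0, 0) (Lx, 1)) (\<lambda>(x, z). integral {0..Ly} (\<lambda>y. f (x, y, z)))"
      by (simp add: case_prod_unfold box_real)
  qed
  also have "\<dots> = vint f"
    unfolding vint_def box_real
    by (intro integral_cong) (simp add: pint_iterated(1)[OF assms])
  finally show ?thesis .
qed

end

section \<open>The vertical primitive\<close>

text \<open>Rescaling to a fixed interval of integration turns the dependence on the upper limit
  into dependence on a parameter, so continuity in all three variables follows at once. At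
  \<open>z = 0\<close> the substitution degenerates, but both sides vanish.\<close>

lemma vert_primitive_rescaled:
  assumes "z \<ge> 0"
  shows "vert_primitive f (x, y, z) = integral (cbox 0 1) (\<lambda>s. z * f (x, y, z * s))"
proof (cases "z = 0")
  case False
  then show ?thesis
    using integral_stretch_real[OF False, of 0 z "\<lambda>s. f (x, y, s)"] assms
    by (simp add: vert_primitive_def)
qed (simp add: vert_primitive_def)

lemma continuous_on_vert_primitive:
  assumes "continuous_on layer f"
  shows "continuous_on layer (vert_primitive f)"
proof -
  have "continuous_on (layer \<times> cbox 0 1)
      (\<lambda>(p, s). snd (snd p) * f (fst p, fst (snd p), snd (snd p) * s))"
    unfolding case_prod_unfold
    by (intro continuous_intros continuous_on_compose2[OF assms])
      (auto intro!: continuous_intros simp: layer_eq mult_le_one)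
  from integral_continuous_on_param[OF this] show ?thesis
    by (rule continuous_on_eq) (auto simp: layer_eq vert_primitive_rescaled)
qed

lemma continuous_on_vertical:
  assumes "continuous_on layer f" "S \<subseteq> {0..1}"
  shows "continuous_on S (\<lambda>s. f (x, y, s))"
  by (intro continuous_on_compose2[OF assms(1)])
    (use assms(2) in \<open>auto intro!: continuous_intros simp: layer_eq\<close>)

lemma vert_primitive_line_derivs:
  fixes f :: "point \<Rightarrow> real"
  assumes f: "f differentiable_on layer" "continuous_on layer (d_x f)" "continuous_on layer (d_y f)"
    and z: "z \<in> {0..1}"
  shows "((\<lambda>s. vert_primitive f (s, y, z)) has_real_derivative vert_primitive (d_x f) (x, y, z)) (at x)"
    and "((\<lambda>s. vert_primitive f (x, s, z)) has_real_derivative vert_primitive (d_y f) (x, y, z)) (at y)"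
    and "((\<lambda>s. vert_primitive f (x, y, s)) has_real_derivative f (x, y, z)) (at z within {0..1})"
proof -
  have cf: "continuous_on layer f" by (rule differentiable_imp_continuous_on[OF f(1)])
  have "((\<lambda>s. integral (cbox 0 z) (\<lambda>r. f (s, y, r))) has_real_derivative
      integral (cbox 0 z) (\<lambda>r. d_x f (x, y, r))) (at x within UNIV)"
  proof (rule leibniz_rule_field_derivative)
    show "continuous_on (UNIV \<times> cbox 0 z) (\<lambda>(s, r). d_x f (s, y, r))"
      unfolding case_prod_unfold using z
      by (intro continuous_on_compose2[OF f(2)]) (auto intro!: continuous_intros simp: layer_eq)
  qed (use layer_line_derivs(1)[OF f(1)] z in
      \<open>auto intro!: integrable_continuous_real continuous_on_vertical[OF cf]\<close>)
  then show "((\<lambda>s. vert_primitive f (s, y, z)) has_real_derivative vert_primitive (d_x f) (x, y, z)) (at x)"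
    by (simp add: vert_primitive_def)
  have "((\<lambda>s. integral (cbox 0 z) (\<lambda>r. f (x, s, r))) has_real_derivative
      integral (cbox 0 z) (\<lambda>r. d_y f (x, y, r))) (at y within UNIV)"
  proof (rule leibniz_rule_field_derivative)
    show "continuous_on (UNIV \<times> cbox 0 z) (\<lambda>(s, r). d_y f (x, s, r))"
      unfolding case_prod_unfold using z
      by (intro continuous_on_compose2[OF f(3)]) (auto intro!: continuous_intros simp: layer_eq)
  qed (use layer_line_derivs(2)[OF f(1)] z in
      \<open>auto intro!: integrable_continuous_real continuous_on_vertical[OF cf]\<close>)
  then show "((\<lambda>s. vert_primitive f (x, s, z)) has_real_derivative vert_primitive (d_y f) (x, y, z)) (at y)"
    by (simp add: vert_primitive_def)
  show "((\<lambda>s. vert_primitive f (x, y, s)) has_real_derivative f (x, y, z)) (at z within {0..1})"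
    using integral_has_real_derivative[OF continuous_on_vertical[OF cf order_refl] z]
    by (simp add: vert_primitive_def)
qed

text \<open>Continuous partial derivatives imply total differentiability. The argument is applied
  twice, first to the pair \<open>(y, z)\<close> and then to \<open>x\<close> together with that
  pair. \<open>blinfun_inner_right\<close> presents the derivative as a bounded linear map depending
  continuously on the point.\<close>

lemma has_derivative_vert_primitive:
  fixes f :: "point \<Rightarrow> real"
  assumes f: "f differentiable_on layer" "continuous_on layer (d_x f)" "continuous_on layer (d_y f)"
    and p: "p \<in> layer"
  shows "(vert_primitive f has_derivative
    (\<lambda>(a, b, c). a * vert_primitive (d_x f) p + (b * vert_primitive (d_y f) p + c * f p))) (at p within layer)"
proof -
  have cf: "continuous_on layer f" by (rule differentiable_imp_continuous_on[OF f(1)])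
  have cv: "continuous_on layer (vert_primitive (d_y f))" by (rule continuous_on_vert_primitive[OF f(3)])
  note lines = vert_primitive_line_derivs[OF f, unfolded has_field_derivative_def]
  have yz: "((\<lambda>(y, z). vert_primitive f (x, y, z)) has_derivative
      blinfun_inner_right (vert_primitive (d_y f) (x, y, z), f (x, y, z))) (at (y, z) within UNIV \<times> {0..1})"
    if z: "z \<in> {0..1}" for x y z
  proof -
    have "((\<lambda>(y, z). vert_primitive f (x, y, z)) has_derivative
        (\<lambda>(b, c). vert_primitive (d_y f) (x, y, z) * b + blinfun_inner_right (f (x, y, z)) c))
        (at (y, z) within UNIV \<times> {0..1})"
    proof (rule has_derivative_partialsI)
      have "continuous_on (UNIV \<times> {0..1}) (\<lambda>(y, z). blinfun_inner_right (f (x, y, z)))"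
        unfolding case_prod_unfold
        by (intro bounded_linear.continuous_on[OF bounded_linear_blinfun_inner_right]
            continuous_on_compose2[OF cf]) (auto intro!: continuous_intros simp: layer_eq)
      then show "continuous (at (y, z) within UNIV \<times> {0..1}) (\<lambda>(y, z). blinfun_inner_right (f (x, y, z)))"
        unfolding continuous_on_eq_continuous_within by (rule bspec) (use z in simp)
    qed (use lines z in auto)
    moreover have "(\<lambda>(b, c). vert_primitive (d_y f) (x, y, z) * b + blinfun_inner_right (f (x, y, z)) c)
        = blinfun_inner_right (vert_primitive (d_y f) (x, y, z), f (x, y, z))"
      by auto
    ultimately show ?thesis by simp
  qed
  obtain x y z where xyz: "p = (x, y, z)" and z: "z \<in> {0..1}" using p by (auto simp: layer_eq)
  have "((\<lambda>(x, q). vert_primitive f (x, q)) has_derivative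
      (\<lambda>(a, q). vert_primitive (d_x f) p * a
        + blinfun_inner_right (vert_primitive (d_y f) (x, (y, z)), f (x, (y, z))) q))
      (at (x, (y, z)) within UNIV \<times> UNIV \<times> {0..1})"
  proof (rule has_derivative_partialsI[where fy = "\<lambda>x q. blinfun_inner_right (vert_primitive (d_y f) (x, q), f (x, q))"])
    show "((\<lambda>x. vert_primitive f (x, (y, z))) has_derivative (*) (vert_primitive (d_x f) p)) (at x within UNIV)"
      using lines(1)[OF z] xyz by simp
    show "((\<lambda>q. vert_primitive f (x, q)) has_derivative
        blinfun_inner_right (vert_primitive (d_y f) (x, q), f (x, q))) (at q within UNIV \<times> {0..1})"
      if "q \<in> UNIV \<times> {0..1}" for x q
      using yz[of "snd q" x "fst q"] that by (auto simp: case_prod_unfold)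
    have "continuous_on layer (\<lambda>(x, q). blinfun_inner_right (vert_primitive (d_y f) (x, q), f (x, q)))"
      by (simp add: case_prod_unfold)
        (intro bounded_linear.continuous_on[OF bounded_linear_blinfun_inner_right] continuous_on_Pair cf cv)
    then show "continuous (at (x, y, z) within UNIV \<times> UNIV \<times> {0..1})
        (\<lambda>(x, q). blinfun_inner_right (vert_primitive (d_y f) (x, q), f (x, q)))"
      unfolding continuous_on_eq_continuous_within layer_eq by (rule bspec) (use z in simp)
  qed (use z in \<open>auto intro!: convex_Times\<close>)
  then show ?thesis
    by (simp add: xyz layer_eq case_prod_unfold inner_prod_def mult.commute)
qed

text \<open>Horizontal differentiation commutes with the primitive and vertical differentiation
  returns \<open>f\<close>. So the derivatives are again primitives of functions of order
  \<open>k\<close>, or \<open>f\<close> itself, and the induction closes.\<close>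

lemma Ck_on_vert_primitive:
  fixes f :: "point \<Rightarrow> real"
  shows "Ck_on k layer f \<Longrightarrow> Ck_on k layer (vert_primitive f)"
proof (induction k arbitrary: f)
  case 0
  then show ?case by (simp add: continuous_on_vert_primitive)
next
  case (Suc k)
  have Ck: "Ck_on k layer (d_x f)" "Ck_on k layer (d_y f)" "Ck_on k layer f"
    using Suc.prems Ck_on_mono[OF Suc.prems] by (auto simp: Basis_point d_x_def d_y_def)
  have C0: "continuous_on layer g" if "Ck_on k layer g" for g :: "point \<Rightarrow> real"
    using that by (cases k) (auto intro: differentiable_imp_continuous_on)
  have f: "f differentiable_on layer" "continuous_on layer (d_x f)" "continuous_on layer (d_y f)"
    using Suc.prems C0 Ck by auto
  show ?case
  proof (rule Ck_on_SucI[OF thick_layer, where f' = "\<lambda>v p. case v of (a, b, c) \<Rightarrow>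
        a * vert_primitive (d_x f) p + (b * vert_primitive (d_y f) p + c * f p)"])
    show "(vert_primitive f has_derivative (\<lambda>v. case v of (a, b, c) \<Rightarrow>
        a * vert_primitive (d_x f) p + (b * vert_primitive (d_y f) p + c * f p))) (at p within layer)"
      if "p \<in> layer" for p
      by (rule has_derivative_vert_primitive[OF f that])
    show "Ck_on k layer (\<lambda>p. case v of (a, b, c) \<Rightarrow>
        a * vert_primitive (d_x f) p + (b * vert_primitive (d_y f) p + c * f p))" if "v \<in> Basis" for v
      using that Suc.IH[OF Ck(1)] Suc.IH[OF Ck(2)] Ck(3) unfolding Basis_point by fastforce
  qed
qed

context periodic_layer
begin

lemma tame_vert_primitive:
  assumes "tame f"
  shows "tame (vert_primitive f)"
proof -
  have "vert_primitive f (x + Lx, y, z) = vert_primitive f (x, y, z)"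
    "vert_primitive f (x, y + Ly, z) = vert_primitive f (x, y, z)" if "z \<in> {0..1}" for x y z
    unfolding vert_primitive_def using that tame_periodic[OF assms] by (auto intro!: integral_cong)
  then show ?thesis
    using assms by (simp add: tame_def smooth_on_def Ck_on_vert_primitive horiz_periodic_def)
qed

lemma d_z_vert_primitive:
  assumes "tame f" "p \<in> layer"
  shows "d_z (vert_primitive f) p = f p"
  using layer_derivs_eqI(3)[OF has_derivative_vert_primitive[OF tame_differentiable[OF assms(1)]
        tame_continuous[OF tame_derivs(1)[OF assms(1)]] tame_continuous[OF tame_derivs(2)[OF assms(1)]] assms(2)] assms(2)]
  by simp

end

section \<open>Inequalities on horizontal planes\<close>

text \<open>Here \<open>s\<close> stands for the quadratic norm of a function on a plane,
  \<open>a\<close> and \<open>b\<close> for those of its two horizontal derivatives,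
  \<open>n\<close> for that of its horizontal gradient, and the second bound on \<open>s\<close> is
  Poincare's inequality. Since 2 * pi > 6, the term \<open>s / l\<close> is at most
  \<open>n / 6\<close> times the ratio of the longer period to \<open>l\<close>. What remains is the
  product of \<open>n / 6 + a\<close> and \<open>n / 6 + b\<close>, where 1/36 + 1/4 + 1/2 is below
  1.\<close>

lemma ladyzhenskaya_arith:
  fixes a b s n K Lx Ly :: real
  assumes pos: "Lx > 0" "Ly > 0" "a \<ge> 0" "b \<ge> 0" "s \<ge> 0" "n \<ge> 0"
    and n: "a\<^sup>2 + b\<^sup>2 = n\<^sup>2" and s: "s \<le> K * n" and K: "K = max Lx Ly / (2 * pi)"
  shows "(s\<^sup>2 / Lx + s * a) * (s\<^sup>2 / Ly + s * b) \<le> (max Lx Ly)\<^sup>2 / (Lx * Ly) * K\<^sup>2 * (n\<^sup>2)\<^sup>2"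
proof -
  have K0: "K \<ge> 0" using pos by (simp add: K)
  have row: "K / l \<le> max Lx Ly / l * (1 / 6)" "1 \<le> max Lx Ly / l" if "l > 0" "l = Lx \<or> l = Ly" for l
  proof -
    have "max Lx Ly * 6 \<le> max Lx Ly * (2 * pi)"
      using pos pi_gt3 by (intro mult_left_mono) auto
    then show "K / l \<le> max Lx Ly / l * (1 / 6)"
      using that by (simp add: K field_simps)
    show "1 \<le> max Lx Ly / l" using that by (auto simp: field_simps)
  qed
  have fac: "s / l + c \<le> max Lx Ly / l * (n / 6 + c)" if "l > 0" "l = Lx \<or> l = Ly" "c \<ge> 0" for l c
  proof -
    have "s / l + c \<le> (K / l) * n + 1 * c"
      using s that by (simp add: divide_right_mono)
    also have "\<dots> \<le> max Lx Ly / l * (1 / 6) * n + max Lx Ly / l * c"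
      using row[OF that(1,2)] pos(6) that(3) by (intro add_mono mult_right_mono) auto
    finally show ?thesis by (simp add: algebra_simps)
  qed
  have ab2: "a * b \<le> n\<^sup>2 / 2"
    using n sum_squares_bound[of a b] by simp
  have "(a + b)\<^sup>2 = n\<^sup>2 + 2 * (a * b)"
    using n by (simp add: power2_sum)
  \<comment> \<open>The factor 2 would suffice; 9 / 4 is used because its square root is
    rational.\<close>
  also have "\<dots> \<le> 9 / 4 * n\<^sup>2"
    using ab2 zero_le_power2[of n] by linarith
  finally have "(a + b)\<^sup>2 \<le> (3 / 2 * n)\<^sup>2"
    by (simp add: power2_eq_square)
  then have ab: "a + b \<le> 3 / 2 * n" by (rule power2_le_imp_le) (use pos in simp)
  have "(n / 6 + a) * (n / 6 + b) = n\<^sup>2 / 36 + n / 6 * (a + b) + a * b"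
    by (simp add: power2_eq_square algebra_simps)
  also have "\<dots> \<le> n\<^sup>2 / 36 + n / 6 * (3 / 2 * n) + n\<^sup>2 / 2"
    using mult_left_mono[OF ab, of "n / 6"] ab2 pos by simp
  also have "\<dots> \<le> n\<^sup>2" by (simp add: power2_eq_square)
  finally have q: "(n / 6 + a) * (n / 6 + b) \<le> n\<^sup>2" .
  have "(s\<^sup>2 / Lx + s * a) * (s\<^sup>2 / Ly + s * b) = s\<^sup>2 * ((s / Lx + a) * (s / Ly + b))"
    by (simp add: power2_eq_square algebra_simps)
  also have "\<dots> \<le> (K * n)\<^sup>2 * ((max Lx Ly / Lx * (n / 6 + a)) * (max Lx Ly / Ly * (n / 6 + b)))"
    using pos s K0 fac[of Lx a] fac[of Ly b]
    by (intro mult_mono power_mono) (auto intro!: add_nonneg_nonneg mult_nonneg_nonneg divide_nonneg_pos)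
  also have "\<dots> = (max Lx Ly)\<^sup>2 / (Lx * Ly) * K\<^sup>2 * n\<^sup>2 * ((n / 6 + a) * (n / 6 + b))"
    by (simp add: power2_eq_square)
  also have "\<dots> \<le> (max Lx Ly)\<^sup>2 / (Lx * Ly) * K\<^sup>2 * n\<^sup>2 * n\<^sup>2"
    using pos by (intro mult_left_mono[OF q]) auto
  finally show ?thesis by (simp add: power2_eq_square mult.assoc)
qed

context periodic_layer
begin

definition hgrad2 :: "(point \<Rightarrow> real) \<Rightarrow> real \<Rightarrow> real" where
  "hgrad2 f z = pint (\<lambda>p. (d_x f p)\<^sup>2 + (d_y f p)\<^sup>2) z"

text \<open>The Poincare constant of a periodic rectangle. It lacks the vertical entry
  \<open>pi\<close> of \<open>lambda_1\<close>, hence is at most \<open>C_P\<close>.\<close>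

definition K_P :: real where
  "K_P = max Lx Ly / (2 * pi)"

text \<open>Poincare's inequality is already absorbed: the square root of \<open>K_L\<close> is
  \<open>K_P * max Lx Ly / sqrt (Lx * Ly)\<close>, to be compared with \<open>C_1\<close>.\<close>

definition K_L :: real where
  "K_L = (max Lx Ly)\<^sup>2 / (Lx * Ly) * K_P\<^sup>2"

lemma K_P_pos: "K_P > 0"
  using Lx_pos by (simp add: K_P_def)

lemma K_L_pos: "K_L > 0"
  using K_P_pos Lx_pos Ly_pos by (simp add: K_L_def)

lemma continuous_on_row:
  fixes f :: "point \<Rightarrow> real"
  assumes "continuous_on layer f" "z \<in> {0..1}"
  shows "continuous_on S (\<lambda>y. integral {0..Lx} (\<lambda>x. f (x, y, z)))"
    "continuous_on S (\<lambda>x. integral {0..Ly} (\<lambda>y. f (x, y, z)))"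
    "continuous_on S (\<lambda>x. f (x, y, z))" "continuous_on S (\<lambda>y. f (x, y, z))"
proof -
  have "continuous_on (S \<times> cbox 0 Lx) (\<lambda>(y, x). f (x, y, z))"
    "continuous_on (S \<times> cbox 0 Ly) (\<lambda>(x, y). f (x, y, z))"
    unfolding case_prod_unfold using assms(2)
    by (intro continuous_on_compose2[OF assms(1)], auto intro!: continuous_intros simp: layer_eq)+
  from integral_continuous_on_param[where f = "\<lambda>y x. f (x, y, z)", OF this(1)]
    integral_continuous_on_param[where f = "\<lambda>x y. f (x, y, z)", OF this(2)]
  show "continuous_on S (\<lambda>y. integral {0..Lx} (\<lambda>x. f (x, y, z)))"
    "continuous_on S (\<lambda>x. integral {0..Ly} (\<lambda>y. f (x, y, z)))" by simp_all
  show "continuous_on S (\<lambda>x. f (x, y, z))" "continuous_on S (\<lambda>y. f (x, y, z))"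
    using assms(2) by (intro continuous_on_compose2[OF assms(1)], auto intro!: continuous_intros simp: layer_eq)+
qed

lemma hgrad2_nonneg:
  assumes "tame f" "z \<in> {0..1}"
  shows "hgrad2 f z \<ge> 0"
  unfolding hgrad2_def using assms
  by (intro pint_nonneg tame_continuous tame_intros) auto

lemma hgrad2_eq:
  assumes "tame f" "z \<in> {0..1}"
  shows "hgrad2 f z = pint (\<lambda>p. (d_x f p)\<^sup>2) z + pint (\<lambda>p. (d_y f p)\<^sup>2) z"
  unfolding hgrad2_def using assms by (intro pint_add tame_continuous tame_intros)

lemma continuous_on_hgrad2: "tame f \<Longrightarrow> continuous_on {0..1} (hgrad2 f)"
  unfolding hgrad2_def[abs_def] by (intro continuous_on_pint tame_continuous tame_intros)

text \<open>In each row \<open>f\<close> splits orthogonally into its row mean \<open>m y\<close>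
  and a remainder. The periodic Wirtinger inequality in \<open>x\<close> controls the remainder. The
  same inequality in \<open>y\<close> controls \<open>m\<close>, which has mean zero, and Jensen's
  inequality bounds the square of \<open>m'\<close> by the row mean of that of
  \<open>d_y f\<close>.\<close>

lemma pint_poincare:
  assumes f: "tame f" and z: "z \<in> {0..1}" and mean: "pint f z = 0"
  shows "pint (\<lambda>p. (f p)\<^sup>2) z \<le> K_P\<^sup>2 * hgrad2 f z"
proof -
  have cf: "continuous_on layer f" "continuous_on layer (d_x f)" "continuous_on layer (d_y f)"
    using f by (auto intro: tame_continuous tame_derivs)
  have csq: "continuous_on layer (\<lambda>p. (f p)\<^sup>2)" "continuous_on layer (\<lambda>p. (d_x f p)\<^sup>2)"
    "continuous_on layer (\<lambda>p. (d_y f p)\<^sup>2)"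
    by (auto intro!: continuous_intros cf)
  note rows = continuous_on_row[OF _ z]
  define m where "m y = integral {0..Lx} (\<lambda>x. f (x, y, z)) / Lx" for y
  define m' where "m' y = integral {0..Lx} (\<lambda>x. d_y f (x, y, z)) / Lx" for y
  have cm: "continuous_on S m" "continuous_on S m'" for S
    unfolding m_def m'_def using Lx_pos by (auto intro!: continuous_intros rows cf)
  have m: "(m has_real_derivative m' y) (at y)" for y
  proof -
    have "((\<lambda>y. integral (cbox 0 Lx) (\<lambda>x. f (x, y, z))) has_real_derivative
        integral (cbox 0 Lx) (\<lambda>x. d_y f (x, y, z))) (at y within UNIV)"
    proof (rule leibniz_rule_field_derivative)
      show "continuous_on (UNIV \<times> cbox 0 Lx) (\<lambda>(y, x). d_y f (x, y, z))"
        unfolding case_prod_unfold using z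
        by (intro continuous_on_compose2[OF cf(3)]) (auto intro!: continuous_intros simp: layer_eq)
    qed (use line_derivs(2)[OF f z] in \<open>auto intro!: integrable_continuous_real rows cf\<close>)
    from DERIV_cdivide[OF this, of Lx] show ?thesis by (simp add: m_def[abs_def] m'_def)
  qed
  have "integral {0..Ly} (\<lambda>y. (m y)\<^sup>2) \<le> (Ly / (2 * pi))\<^sup>2 * integral {0..Ly} (\<lambda>y. (m' y)\<^sup>2)"
  proof (rule wirtinger_periodic[OF Ly_pos m cm(2)])
    show "m (y + Ly) = m y" for y
      by (simp add: m_def tame_periodic(2)[OF f z])
    show "integral {0..Ly} m = 0"
      using mean pint_iterated(2)[OF cf(1) z] by (simp add: m_def[abs_def])
  qed
  also have "\<dots> \<le> K_P\<^sup>2 * integral {0..Ly} (\<lambda>y. integral {0..Lx} (\<lambda>x. (d_y f (x, y, z))\<^sup>2) / Lx)"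
  proof (intro mult_mono integral_le integral_nonneg)
    show "(m' y)\<^sup>2 \<le> integral {0..Lx} (\<lambda>x. (d_y f (x, y, z))\<^sup>2) / Lx" for y
      using integral_Cauchy_Schwarz[of 0 Lx "\<lambda>x. d_y f (x, y, z)" "\<lambda>x. 1"] rows(3)[OF cf(3)] Lx_pos
      by (simp add: m'_def power_divide power2_eq_square divide_simps)
    show "(Ly / (2 * pi))\<^sup>2 \<le> K_P\<^sup>2"
      unfolding K_P_def using Ly_pos by (intro power_mono divide_right_mono) auto
  qed (use Lx_pos in \<open>auto intro!: integrable_continuous_real continuous_intros cm rows csq\<close>)
  also have "\<dots> = K_P\<^sup>2 * pint (\<lambda>p. (d_y f p)\<^sup>2) z / Lx"
    using pint_iterated(2)[OF csq(3) z] by simp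
  finally have mean_part: "Lx * integral {0..Ly} (\<lambda>y. (m y)\<^sup>2) \<le> K_P\<^sup>2 * pint (\<lambda>p. (d_y f p)\<^sup>2) z"
    using Lx_pos by (simp add: field_simps)
  have row: "integral {0..Lx} (\<lambda>x. (f (x, y, z))\<^sup>2)
      \<le> K_P\<^sup>2 * integral {0..Lx} (\<lambda>x. (d_x f (x, y, z))\<^sup>2) + Lx * (m y)\<^sup>2" for y
  proof -
    have int: "(\<lambda>x. f (x, y, z)) integrable_on {0..Lx}" "(\<lambda>x. (f (x, y, z))\<^sup>2) integrable_on {0..Lx}"
      by (auto intro!: integrable_continuous_real rows cf csq)
    have "((\<lambda>x. (f (x, y, z))\<^sup>2 - 2 * m y * f (x, y, z) + (m y)\<^sup>2) has_integral
        integral {0..Lx} (\<lambda>x. (f (x, y, z))\<^sup>2) - 2 * m y * integral {0..Lx} (\<lambda>x. f (x, y, z)) + (m y)\<^sup>2 * Lx) {0..Lx}"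
      using int has_integral_const_real[of "(m y)\<^sup>2" 0 Lx] Lx_pos
      by (intro has_integral_add has_integral_diff has_integral_mult_right) (auto simp: mult.commute)
    moreover have "(\<lambda>x. (f (x, y, z))\<^sup>2 - 2 * m y * f (x, y, z) + (m y)\<^sup>2) = (\<lambda>x. (f (x, y, z) - m y)\<^sup>2)"
      by (auto simp: power2_eq_square algebra_simps)
    moreover have "integral {0..Lx} (\<lambda>x. f (x, y, z)) = Lx * m y" using Lx_pos by (simp add: m_def)
    ultimately have "integral {0..Lx} (\<lambda>x. (f (x, y, z) - m y)\<^sup>2)
        = integral {0..Lx} (\<lambda>x. (f (x, y, z))\<^sup>2) - Lx * (m y)\<^sup>2"
      by (simp add: integral_unique power2_eq_square algebra_simps)
    moreover have "integral {0..Lx} (\<lambda>x. (f (x, y, z) - m y)\<^sup>2)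
        \<le> (Lx / (2 * pi))\<^sup>2 * integral {0..Lx} (\<lambda>x. (d_x f (x, y, z))\<^sup>2)"
    proof (rule wirtinger_periodic[OF Lx_pos])
      show "((\<lambda>x. f (x, y, z) - m y) has_real_derivative d_x f (x, y, z)) (at x)" for x
        using DERIV_diff[OF line_derivs(1)[OF f z] DERIV_const] by fastforce
      show "integral {0..Lx} (\<lambda>x. f (x, y, z) - m y) = 0"
        using int(1) Lx_pos by (subst integral_diff) (auto simp: m_def)
    qed (use tame_periodic(1)[OF f z] in \<open>auto intro!: rows cf\<close>)
    moreover have "(Lx / (2 * pi))\<^sup>2 * integral {0..Lx} (\<lambda>x. (d_x f (x, y, z))\<^sup>2)
        \<le> K_P\<^sup>2 * integral {0..Lx} (\<lambda>x. (d_x f (x, y, z))\<^sup>2)"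
      unfolding K_P_def using Lx_pos
      by (intro mult_right_mono power_mono divide_right_mono integral_nonneg)
        (auto intro!: integrable_continuous_real rows csq)
    ultimately show ?thesis by linarith
  qed
  have "pint (\<lambda>p. (f p)\<^sup>2) z = integral {0..Ly} (\<lambda>y. integral {0..Lx} (\<lambda>x. (f (x, y, z))\<^sup>2))"
    by (rule pint_iterated(2)[OF csq(1) z])
  also have "\<dots> \<le> integral {0..Ly} (\<lambda>y. K_P\<^sup>2 * integral {0..Lx} (\<lambda>x. (d_x f (x, y, z))\<^sup>2) + Lx * (m y)\<^sup>2)"
    by (intro integral_le row) (auto intro!: integrable_continuous_real continuous_intros rows csq cm)
  also have "\<dots> = K_P\<^sup>2 * pint (\<lambda>p. (d_x f p)\<^sup>2) z + Lx * integral {0..Ly} (\<lambda>y. (m y)\<^sup>2)"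
    by (subst integral_add)
      (auto intro!: integrable_continuous_real continuous_intros rows csq cm simp: pint_iterated(2)[OF csq(2) z])
  finally show ?thesis
    using mean_part hgrad2_eq[OF f z] by (simp add: algebra_simps)
qed

text \<open>On each line \<open>f\<^sup>2\<close> is at most its mean plus half its total variation; multiplying the bounds along
  the two directions majorises \<open>f ^ 4\<close> by a product of a function of \<open>y\<close> and a function of \<open>x\<close>.\<close>

lemma pint_ladyzhenskaya:
  assumes f: "tame f" and z: "z \<in> {0..1}" and mean: "pint f z = 0"
  shows "pint (\<lambda>p. (f p) ^ 4) z \<le> K_L * (hgrad2 f z)\<^sup>2"
proof -
  note rows = continuous_on_row[OF _ z]
  have cf: "continuous_on layer f" "continuous_on layer (d_x f)" "continuous_on layer (d_y f)"
    using f by (auto intro: tame_continuous tame_derivs)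
  have c2: "continuous_on layer (\<lambda>p. (f p)\<^sup>2)" "continuous_on layer (\<lambda>p. (f p) ^ 4)"
    "continuous_on layer (\<lambda>p. \<bar>f p\<bar> * \<bar>d_x f p\<bar>)" "continuous_on layer (\<lambda>p. \<bar>f p\<bar> * \<bar>d_y f p\<bar>)"
    by (auto intro!: continuous_intros cf)
  define \<alpha> where "\<alpha> y = integral {0..Lx} (\<lambda>x. (f (x, y, z))\<^sup>2) / Lx
      + integral {0..Lx} (\<lambda>x. \<bar>f (x, y, z)\<bar> * \<bar>d_x f (x, y, z)\<bar>)" for y
  define \<beta> where "\<beta> x = integral {0..Ly} (\<lambda>y. (f (x, y, z))\<^sup>2) / Ly
      + integral {0..Ly} (\<lambda>y. \<bar>f (x, y, z)\<bar> * \<bar>d_y f (x, y, z)\<bar>)" for x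
  have c\<alpha>: "continuous_on S \<alpha>" for S
    unfolding \<alpha>_def[abs_def] using Lx_pos by (intro continuous_intros rows(1) c2) auto
  have c\<beta>: "continuous_on S \<beta>" for S
    unfolding \<beta>_def[abs_def] using Ly_pos by (intro continuous_intros rows(2) c2) auto
  have \<alpha>: "(f (x, y, z))\<^sup>2 \<le> \<alpha> y" if "x \<in> {0..Lx}" for x y
  proof -
    have "((\<lambda>x. (f (x, y, z))\<^sup>2) has_real_derivative 2 * (d_x f (x, y, z) * f (x, y, z))) (at x within S)" for x S
      using DERIV_power[OF has_field_derivative_at_within[OF line_derivs(1)[OF f z]], where n = 2]
      by simp
    then have "(f (x, y, z))\<^sup>2 \<le> integral {0..Lx} (\<lambda>x. (f (x, y, z))\<^sup>2) / Lx
        + integral {0..Lx} (\<lambda>x. \<bar>2 * (d_x f (x, y, z) * f (x, y, z))\<bar>) / 2"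
      using that tame_periodic(1)[OF f z, of 0 y]
      by (intro periodic_sup_bound[OF Lx_pos]) (auto intro!: continuous_intros rows cf)
    then show ?thesis by (simp add: \<alpha>_def abs_mult mult.commute)
  qed
  have \<beta>: "(f (x, y, z))\<^sup>2 \<le> \<beta> x" if "y \<in> {0..Ly}" for x y
  proof -
    have "((\<lambda>y. (f (x, y, z))\<^sup>2) has_real_derivative 2 * (d_y f (x, y, z) * f (x, y, z))) (at y within S)" for y S
      using DERIV_power[OF has_field_derivative_at_within[OF line_derivs(2)[OF f z]], where n = 2]
      by simp
    then have "(f (x, y, z))\<^sup>2 \<le> integral {0..Ly} (\<lambda>y. (f (x, y, z))\<^sup>2) / Ly
        + integral {0..Ly} (\<lambda>y. \<bar>2 * (d_y f (x, y, z) * f (x, y, z))\<bar>) / 2"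
      using that tame_periodic(2)[OF f z, of x 0]
      by (intro periodic_sup_bound[OF Ly_pos]) (auto intro!: continuous_intros rows cf)
    then show ?thesis by (simp add: \<beta>_def abs_mult mult.commute)
  qed
  let ?F = "pint (\<lambda>p. (f p)\<^sup>2) z" and ?X = "pint (\<lambda>p. (d_x f p)\<^sup>2) z" and ?Y = "pint (\<lambda>p. (d_y f p)\<^sup>2) z"
  have nonneg: "?F \<ge> 0" "?X \<ge> 0" "?Y \<ge> 0" "hgrad2 f z \<ge> 0"
    using f z by (auto intro!: pint_nonneg tame_continuous tame_intros hgrad2_nonneg)
  have "(pint (\<lambda>p. \<bar>f p\<bar> * \<bar>d_x f p\<bar>) z)\<^sup>2 \<le> ?F * ?X" "(pint (\<lambda>p. \<bar>f p\<bar> * \<bar>d_y f p\<bar>) z)\<^sup>2 \<le> ?F * ?Y"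
    using pint_Cauchy_Schwarz[OF continuous_on_rabs[OF cf(1)] continuous_on_rabs[OF cf(2)] z]
      pint_Cauchy_Schwarz[OF continuous_on_rabs[OF cf(1)] continuous_on_rabs[OF cf(3)] z] by auto
  then have prod: "pint (\<lambda>p. \<bar>f p\<bar> * \<bar>d_x f p\<bar>) z \<le> sqrt ?F * sqrt ?X"
    "pint (\<lambda>p. \<bar>f p\<bar> * \<bar>d_y f p\<bar>) z \<le> sqrt ?F * sqrt ?Y"
    by (auto simp flip: real_sqrt_mult intro: real_le_rsqrt)
  have \<alpha>_int: "integral {0..Ly} \<alpha> = ?F / Lx + pint (\<lambda>p. \<bar>f p\<bar> * \<bar>d_x f p\<bar>) z"
    unfolding \<alpha>_def[abs_def] using Lx_pos pint_iterated(2)[OF c2(1) z] pint_iterated(2)[OF c2(3) z]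
    by (subst integral_add) (auto intro!: integrable_continuous_real continuous_intros rows c2)
  have \<beta>_int: "integral {0..Lx} \<beta> = ?F / Ly + pint (\<lambda>p. \<bar>f p\<bar> * \<bar>d_y f p\<bar>) z"
    unfolding \<beta>_def[abs_def] using Ly_pos pint_iterated(1)[OF c2(1) z] pint_iterated(1)[OF c2(4) z]
    by (subst integral_add) (auto intro!: integrable_continuous_real continuous_intros rows c2)
  have "\<alpha> y \<ge> 0" "\<beta> x \<ge> 0" for x y
    unfolding \<alpha>_def \<beta>_def using Lx_pos Ly_pos
    by (auto intro!: add_nonneg_nonneg divide_nonneg_pos integral_nonneg integrable_continuous_real rows c2)
  then have "pint (\<lambda>p. (f p) ^ 4) z \<le> integral {0..Lx} (\<lambda>x. integral {0..Ly} (\<lambda>y. \<alpha> y * \<beta> x))"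
    unfolding pint_iterated(1)[OF c2(2) z]
  proof (intro integral_le)
    fix x y assume "x \<in> {0..Lx}" "y \<in> {0..Ly}"
    then have "(f (x, y, z))\<^sup>2 * (f (x, y, z))\<^sup>2 \<le> \<alpha> y * \<beta> x"
      using \<alpha> \<beta> \<open>\<And>y. \<alpha> y \<ge> 0\<close> by (intro mult_mono) auto
    then show "(f (x, y, z)) ^ 4 \<le> \<alpha> y * \<beta> x"
      by (simp add: power_add[symmetric])
  qed (auto intro!: integrable_continuous_real continuous_intros rows c2 c\<alpha> c\<beta>)
  also have "\<dots> = integral {0..Ly} \<alpha> * integral {0..Lx} \<beta>"
    by simp
  also have "\<dots> \<le> ((sqrt ?F)\<^sup>2 / Lx + sqrt ?F * sqrt ?X) * ((sqrt ?F)\<^sup>2 / Ly + sqrt ?F * sqrt ?Y)"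
    unfolding \<alpha>_int \<beta>_int using prod nonneg Lx_pos Ly_pos
    by (intro mult_mono) (auto intro!: add_nonneg_nonneg divide_nonneg_pos pint_nonneg c2 z)
  also have "\<dots> \<le> (max Lx Ly)\<^sup>2 / (Lx * Ly) * K_P\<^sup>2 * ((sqrt (hgrad2 f z))\<^sup>2)\<^sup>2"
  proof (rule ladyzhenskaya_arith)
    show "sqrt ?F \<le> K_P * sqrt (hgrad2 f z)"
      using real_sqrt_le_mono[OF pint_poincare[OF f z mean]] K_P_pos by (simp add: real_sqrt_mult)
  qed (use nonneg Lx_pos Ly_pos hgrad2_eq[OF f z] K_P_def in auto)
  finally show ?thesis using nonneg by (simp add: K_L_def)
qed

text \<open>Hoelder's inequality with exponents 4, 4, 2, carried out as two Cauchy-Schwarz steps;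
  Ladyzhenskaya's inequality handles the two factors taken in the fourth power norm.\<close>

lemma pint_trilinear:
  assumes f: "tame f" "pint f z = 0" and g: "tame g" "pint g z = 0" and h: "tame h" and z: "z \<in> {0..1}"
  shows "(pint (\<lambda>p. f p * g p * h p) z)\<^sup>2 \<le> K_L * hgrad2 f z * hgrad2 g z * pint (\<lambda>p. (h p)\<^sup>2) z"
proof -
  have "(pint (\<lambda>p. (f p)\<^sup>2 * (g p)\<^sup>2) z)\<^sup>2 \<le> pint (\<lambda>p. ((f p)\<^sup>2)\<^sup>2) z * pint (\<lambda>p. ((g p)\<^sup>2)\<^sup>2) z"
    using f g z by (intro pint_Cauchy_Schwarz tame_continuous tame_intros)
  also have "\<dots> \<le> (K_L * (hgrad2 f z)\<^sup>2) * (K_L * (hgrad2 g z)\<^sup>2)"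
    using pint_ladyzhenskaya[OF f(1) z f(2)] pint_ladyzhenskaya[OF g(1) z g(2)] K_L_pos f g z
    by (intro mult_mono) (auto intro!: pint_nonneg tame_continuous tame_intros)
  also have "\<dots> = (K_L * hgrad2 f z * hgrad2 g z)\<^sup>2"
    by (simp add: power2_eq_square)
  finally have sq: "pint (\<lambda>p. (f p)\<^sup>2 * (g p)\<^sup>2) z \<le> K_L * hgrad2 f z * hgrad2 g z"
    by (rule power2_le_imp_le) (use f g z K_L_pos hgrad2_nonneg in auto)
  have "(pint (\<lambda>p. f p * g p * h p) z)\<^sup>2 \<le> pint (\<lambda>p. (f p * g p)\<^sup>2) z * pint (\<lambda>p. (h p)\<^sup>2) z"
    using f g h z by (intro pint_Cauchy_Schwarz tame_continuous tame_intros)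
  also have "\<dots> \<le> K_L * hgrad2 f z * hgrad2 g z * pint (\<lambda>p. (h p)\<^sup>2) z"
    unfolding power_mult_distrib using h z
    by (intro mult_right_mono[OF sq] pint_nonneg tame_continuous tame_intros) auto
  finally show ?thesis .
qed

text \<open>The squared Hessian and the squared Laplacian differ by twice the Hessian determinant up
  to sign, which is a divergence and integrates to zero by periodicity. Being an identity, this
  costs no constant.\<close>

lemma hgrad2_hgrad:
  assumes f: "tame f" and z: "z \<in> {0..1}"
  shows "hgrad2 (d_x f) z + hgrad2 (d_y f) z = pint (\<lambda>p. (horiz_laplacian f p)\<^sup>2) z"
proof -
  note t = f f[THEN tame_derivs(1)] f[THEN tame_derivs(2)]
  \<comment> \<open>Expanding \<open>?div\<close> below produces two third-order terms, which cancel
    by this symmetry.\<close>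
  have third: "d_x (d_y (d_y f)) p = d_y (d_y (d_x f)) p" if "p \<in> layer" for p
    using mixed_derivs[OF t(3) that] layer_derivs_cong(2)[OF mixed_derivs[OF f] that] by simp
  let ?div = "\<lambda>p. 2 * (d_y (\<lambda>p. d_x f p * d_y (d_x f) p) p - d_x (\<lambda>p. d_x f p * d_y (d_y f) p) p)"
  have "hgrad2 (d_x f) z + hgrad2 (d_y f) z
      = pint (\<lambda>p. ((d_x (d_x f) p)\<^sup>2 + (d_y (d_x f) p)\<^sup>2) + ((d_x (d_y f) p)\<^sup>2 + (d_y (d_y f) p)\<^sup>2)) z"
    unfolding hgrad2_def using f z by (intro pint_add[symmetric] tame_continuous tame_intros)
  also have "\<dots> = pint (\<lambda>p. (d_x (d_x f) p + d_y (d_y f) p)\<^sup>2 + ?div p) z"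
  proof (rule pint_cong)
    fix x y
    have p: "(x, y, z) \<in> layer" using z by (simp add: layer_eq)
    show "((d_x (d_x f) (x, y, z))\<^sup>2 + (d_y (d_x f) (x, y, z))\<^sup>2) + ((d_x (d_y f) (x, y, z))\<^sup>2 + (d_y (d_y f) (x, y, z))\<^sup>2)
        = (d_x (d_x f) (x, y, z) + d_y (d_y f) (x, y, z))\<^sup>2 + ?div (x, y, z)"
      by (simp add: derivs_mult t tame_derivs p third mixed_derivs[OF f p] power2_eq_square algebra_simps)
  qed
  also have "\<dots> = pint (\<lambda>p. (d_x (d_x f) p + d_y (d_y f) p)\<^sup>2) z + pint ?div z"
    using f z by (intro pint_add tame_continuous tame_intros)
  also have "pint ?div z = 2 * (pint (d_y (\<lambda>p. d_x f p * d_y (d_x f) p)) z - pint (d_x (\<lambda>p. d_x f p * d_y (d_y f) p)) z)"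
    using f z by (subst pint_cmult, subst pint_diff) (auto intro!: tame_continuous tame_intros)
  also have "\<dots> = 0"
    using f z by (simp add: pint_d_x pint_d_y tame_derivs tame_mult)
  finally show ?thesis by (simp add: horiz_laplacian_def)
qed

end

section \<open>The transport estimate\<close>

lemma C_P_bounds:
  assumes "Lx > 0" "Ly > 0"
  shows "max Lx Ly / (2 * pi) \<le> C_P Lx Ly" "1 / pi \<le> C_P Lx Ly"
proof -
  have pos: "lambda_1 Lx Ly > 0" and le: "lambda_1 Lx Ly \<le> pi"
    "lambda_1 Lx Ly \<le> 2 * pi / Lx" "lambda_1 Lx Ly \<le> 2 * pi / Ly"
    using assms by (auto simp: lambda_1_def)
  show "1 / pi \<le> C_P Lx Ly"
    using pos le by (simp add: C_P_def frac_le)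
  have "L / (2 * pi) \<le> C_P Lx Ly" if "L > 0" "lambda_1 Lx Ly \<le> 2 * pi / L" for L
    using that pos by (simp add: C_P_def field_simps)
  with assms le show "max Lx Ly / (2 * pi) \<le> C_P Lx Ly"
    by (simp add: max_def)
qed

text \<open>The larger aspect ratio is the square of \<open>max Lx Ly / sqrt (Lx * Ly)\<close>, the
  very ratio that also appears in \<open>K_L\<close>. The two Ladyzhenskaya constants therefore
  differ by a numerical factor only.\<close>

lemma C_L_squared:
  assumes "Lx > 0" "Ly > 0"
  shows "(C_L Lx Ly)\<^sup>2 = sqrt (3 * pi / 32) * (max Lx Ly / sqrt (Lx * Ly))"
proof -
  have sq: "max (Lx / Ly) (Ly / Lx) = (max Lx Ly / sqrt (Lx * Ly))\<^sup>2"
  proof (cases "Lx \<le> Ly")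
    case True
    then have "Lx / Ly \<le> Ly / Lx" using assms by (intro frac_le) auto
    then show ?thesis using assms True by (simp add: power_divide max_def power2_eq_square)
  next
    case False
    then have "Ly / Lx \<le> Lx / Ly" using assms by (intro frac_le) auto
    then show ?thesis using assms False by (auto simp add: power_divide max_def power2_eq_square)
  qed
  have "(C_L Lx Ly)\<^sup>2 = sqrt (3 * pi / 32 * max (Lx / Ly) (Ly / Lx))"
  proof -
    have "(X powr (1 / 4))\<^sup>2 = sqrt X" if "X \<ge> 0" for X :: real
      using powr_half_sqrt[OF that] powr_add[of X "1 / 4" "1 / 4"] by (simp add: power2_eq_square)
    then show ?thesis unfolding C_L_def using assms by (simp add: le_max_iff_disj)
  qed
  then show ?thesis
    unfolding sq real_sqrt_mult[of "3 * pi / 32"] real_sqrt_abs using assms by (simp add: le_max_iff_disj)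
qed

text \<open>If the second term on the left is large, then \<open>Lx * Ly\<close> is small and \<open>C_2\<close>, which is of order
  \<open>1 / (Lx * Ly)\<close>, dominates.\<close>

lemma A_2_lower_bound:
  assumes pos: "Lx > 0" "Ly > 0"
  shows "C_P Lx Ly * (max Lx Ly / sqrt (Lx * Ly) + 1 / (2 * pi * sqrt (Lx * Ly))) \<le> A_2 Lx Ly"
proof -
  define a where "a = sqrt (Lx * Ly)"
  define q where "q = max Lx Ly / a"
  define k where "k = sqrt (3 * pi / 32)"
  have a: "a > 0" "a\<^sup>2 = Lx * Ly" using pos by (auto simp: a_def)
  \<comment> \<open>The square of 0.53 is 0.2809, just below 9/32, which \<open>pi > 3\<close> makes
    a lower bound for the radicand.\<close>
  have k: "k \<ge> 53 / 100"
    unfolding k_def using pi_gt3 by (intro real_le_rsqrt) (simp add: power2_eq_square)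
  have "Lx * Ly \<le> max Lx Ly * max Lx Ly" using pos by (intro mult_mono) auto
  then have "a \<le> max Lx Ly" unfolding a_def using pos by (intro real_le_lsqrt) (auto simp: power2_eq_square)
  then have q: "q \<ge> 1" using a by (simp add: q_def)
  have CP: "C_P Lx Ly \<ge> 1 / pi" "C_P Lx Ly > 0"
    using C_P_bounds(2)[OF pos] pi_gt_zero by (auto intro: less_le_trans[of 0 "1 / pi"])
  have A2: "A_2 Lx Ly = C_P Lx Ly * (k * q * max 3 (C_2 Lx Ly))"
    by (simp add: A_2_def C_1_def C_L_squared[OF pos] k_def q_def a_def)
  \<comment> \<open>The threshold in the case distinction is what is left of 3 * 53/100 = 159/100
    after one copy of \<open>q\<close> is spent.\<close>
  have "q + 1 / (2 * pi * a) \<le> k * q * max 3 (C_2 Lx Ly)"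
  proof (cases "1 / (2 * pi * a) \<le> 59 / 100 * q")
    case True
    have "q + 1 / (2 * pi * a) \<le> 53 / 100 * q * 3" using True by simp
    also have "\<dots> \<le> k * q * max 3 (C_2 Lx Ly)"
      using k q by (intro mult_mono) auto
    finally show ?thesis .
  next
    case False
    then have 1: "118 / 100 * (pi * (q * a)) < 1" using a by (simp add: field_simps)
    have "3 * (1 * a) \<le> pi * (q * a)"
      using a q pi_gt3 by (intro mult_mono) auto
    with 1 have a_le: "a \<le> 1 / 3" by simp
    have "pi * q * a\<^sup>2 + a / 2 = (pi * (q * a)) * a + a / 2"
      by (simp add: power2_eq_square)
    also have "\<dots> \<le> 1 * a + a / 2"
      using 1 a by (intro add_mono mult_right_mono) auto
    \<comment> \<open>The target 2 / 3 is 1/6 + 1/2, the numerator of \<open>C_2\<close> times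
      \<open>pi\<close> when \<open>C_P\<close> is replaced by its lower bound
      \<open>1 / pi\<close>.\<close>
    also have "\<dots> \<le> 2 / 3" using a_le by simp
    finally have "(pi * q * a\<^sup>2 + a / 2) / (pi * a\<^sup>2) \<le> (2 / 3) / (pi * a\<^sup>2)"
      using a(1) by (intro divide_right_mono) auto
    moreover have "(pi * q * a\<^sup>2 + a / 2) / (pi * a\<^sup>2) = q + 1 / (2 * pi * a)"
      "(2 / 3) / (pi * a\<^sup>2) = (1 / (6 * pi) + (1 / pi) / 2) / a\<^sup>2"
      using a(1) by (simp_all add: field_simps power2_eq_square)
    ultimately have "q + 1 / (2 * pi * a) \<le> (1 / (6 * pi) + (1 / pi) / 2) / a\<^sup>2"
      by simp
    also have "\<dots> \<le> (1 / (6 * pi) + C_P Lx Ly / 2) / a\<^sup>2"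
      using CP by (intro divide_right_mono add_mono) auto
    \<comment> \<open>The square of \<open>C_L\<close> in the denominator of \<open>C_2\<close> is
      \<open>k * q\<close> and cancels the prefactor.\<close>
    also have "\<dots> = k * q * C_2 Lx Ly"
    proof -
      have "C_2 Lx Ly = (1 / (6 * pi) + C_P Lx Ly / 2) * (1 / (a\<^sup>2 * (k * q)))"
        unfolding a(2) by (simp add: C_2_def C_L_squared[OF pos] k_def q_def a_def)
      then show ?thesis using k q by simp
    qed
    also have "\<dots> \<le> k * q * max 3 (C_2 Lx Ly)"
      using k q by (intro mult_left_mono) auto
    finally show ?thesis .
  qed
  then show ?thesis
    unfolding A2 using CP by (intro mult_left_mono) (auto simp: q_def a_def)
qed

lemma cauchy_schwarz_2: "\<bar>a * c\<bar> + \<bar>b * d\<bar> \<le> sqrt (a\<^sup>2 + b\<^sup>2) * sqrt (c\<^sup>2 + d\<^sup>2)"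
  for a b c d :: real
  using norm_cauchy_schwarz[of "(\<bar>a\<bar>, \<bar>b\<bar>)" "(\<bar>c\<bar>, \<bar>d\<bar>)"] by (simp add: norm_prod_def abs_mult)

lemma cauchy_schwarz_3:
  "\<bar>a * d\<bar> + \<bar>b * e\<bar> + \<bar>c * f\<bar> \<le> sqrt (a\<^sup>2 + b\<^sup>2 + c\<^sup>2) * sqrt (d\<^sup>2 + e\<^sup>2 + f\<^sup>2)"
  for a b c d e f :: real
  using norm_cauchy_schwarz[of "(\<bar>a\<bar>, \<bar>b\<bar>, \<bar>c\<bar>)" "(\<bar>d\<bar>, \<bar>e\<bar>, \<bar>f\<bar>)"]
  by (simp add: norm_prod_def abs_mult add.assoc)

section \<open>Splitting a field into its horizontal mean and its fluctuation\<close>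

context periodic_layer
begin

definition grad2 :: "(point \<Rightarrow> real) \<Rightarrow> point \<Rightarrow> real" where
  "grad2 f p = (d_x f p)\<^sup>2 + (d_y f p)\<^sup>2 + (d_z f p)\<^sup>2"

lemma tame_grad2: "tame f \<Longrightarrow> tame (grad2 f)"
  unfolding grad2_def[abs_def] by (intro tame_intros)

lemma pint_grad2:
  assumes "tame f" "z \<in> {0..1}"
  shows "pint (grad2 f) z = hgrad2 f z + pint (\<lambda>p. (d_z f p)\<^sup>2) z"
  unfolding grad2_def[abs_def] hgrad2_def using assms by (intro pint_add tame_continuous tame_intros)

lemma vint_nonneg:
  assumes "continuous_on layer f" "\<And>p. f p \<ge> 0"
  shows "vint f \<ge> 0"
  unfolding vint_def using assms by (intro integral_nonneg pint_integrable pint_nonneg)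

lemma vint_grad2:
  assumes "tame f"
  shows "vint (grad2 f) = integral {0..1} (hgrad2 f) + vint (\<lambda>p. (d_z f p)\<^sup>2)"
proof -
  have "vint (grad2 f) = integral {0..1} (\<lambda>z. hgrad2 f z + pint (\<lambda>p. (d_z f p)\<^sup>2) z)"
    unfolding vint_def using assms by (intro integral_cong pint_grad2)
  then show ?thesis
    unfolding vint_def using assms
    by (subst (asm) integral_add) (auto intro!: pint_integrable integrable_continuous_real
        continuous_on_hgrad2 continuous_on_pint tame_continuous tame_intros)
qed

definition hmean :: "(point \<Rightarrow> real) \<Rightarrow> real \<Rightarrow> real" where
  "hmean f z = pint f z / (Lx * Ly)"

lemma hgrad2_diff_const:
  assumes "tame f" "z \<in> {0..1}"
  shows "hgrad2 (\<lambda>p. f p - c) z = hgrad2 f z"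
  unfolding hgrad2_def using assms
  by (intro pint_cong) (simp add: derivs_diff layer_derivs_const tame_const layer_eq)

lemma pint_fluctuation:
  assumes "tame f" "z \<in> {0..1}"
  shows "pint (\<lambda>p. f p - hmean f z) z = 0"
  using pint_diff[OF tame_continuous[OF assms(1)] tame_continuous[OF tame_const] assms(2)] Lx_pos Ly_pos
  by (simp add: pint_const hmean_def)

lemma hmean_derivative:
  assumes "tame f" "z \<in> {0..1}"
  shows "(hmean f has_real_derivative hmean (d_z f) z) (at z within {0..1})"
  unfolding hmean_def[abs_def] using pint_derivative[OF assms] by (intro DERIV_cdivide)

lemma hmean_squared_le:
  assumes "tame f" "z \<in> {0..1}"
  shows "Lx * Ly * (hmean f z)\<^sup>2 \<le> pint (\<lambda>p. (f p)\<^sup>2) z"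
  using pint_Cauchy_Schwarz[OF tame_continuous[OF assms(1)] tame_continuous[OF tame_const[of 1]] assms(2)]
    Lx_pos Ly_pos
  by (simp add: hmean_def pint_const power2_eq_square field_simps)

lemma pint_eq_0: "(\<And>x y. f (x, y, z) = 0) \<Longrightarrow> pint f z = 0"
  using pint_cong[of f z "\<lambda>p. 0"] pint_const[of 0] by simp

text \<open>Horizontal averaging commutes with \<open>d_z\<close>, so the Dirichlet inequality on
  the unit interval applies to the profile of means; Jensen's inequality then returns to plane
  integrals.\<close>

lemma hmean_wirtinger:
  assumes f: "tame f" and "pint f 0 = 0" "pint f 1 = 0"
  shows "pi\<^sup>2 * (Lx * Ly) * integral {0..1} (\<lambda>z. (hmean f z)\<^sup>2) \<le> vint (\<lambda>p. (d_z f p)\<^sup>2)"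
proof -
  have c: "continuous_on {0..1} (hmean (d_z f))"
    unfolding hmean_def[abs_def] using f Lx_pos Ly_pos
    by (intro continuous_intros continuous_on_pint tame_continuous tame_intros) auto
  have "hmean f 0 = 0" "hmean f 1 = 0"
    using assms by (simp_all add: hmean_def)
  then have "integral {0..1} (\<lambda>z. (hmean f z)\<^sup>2) \<le> ((1 - 0) / pi)\<^sup>2 * integral {0..1} (\<lambda>z. (hmean (d_z f) z)\<^sup>2)"
    by (intro wirtinger_Dirichlet hmean_derivative[OF f] c) auto
  then have "pi\<^sup>2 * (Lx * Ly) * integral {0..1} (\<lambda>z. (hmean f z)\<^sup>2)
      \<le> (Lx * Ly) * integral {0..1} (\<lambda>z. (hmean (d_z f) z)\<^sup>2)"
    using Lx_pos Ly_pos by (simp add: power_divide field_simps)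
  also have "\<dots> = integral {0..1} (\<lambda>z. Lx * Ly * (hmean (d_z f) z)\<^sup>2)"
    by simp
  also have "\<dots> \<le> vint (\<lambda>p. (d_z f p)\<^sup>2)"
    unfolding vint_def using f c
    by (intro integral_le hmean_squared_le pint_integrable tame_continuous tame_intros)
      (auto intro!: integrable_continuous_real continuous_intros)
  finally show ?thesis .
qed

lemma abs_pint_mult_le:
  assumes v: "tame v" "pint v z = 0" and w: "tame w" and z: "z \<in> {0..1}"
  shows "\<bar>pint (\<lambda>p. v p * w p) z\<bar> \<le> K_P * sqrt (hgrad2 v z) * sqrt (pint (\<lambda>p. (w p)\<^sup>2) z)"
proof -
  have "(pint (\<lambda>p. v p * w p) z)\<^sup>2 \<le> pint (\<lambda>p. (v p)\<^sup>2) z * pint (\<lambda>p. (w p)\<^sup>2) z"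
    using v w z by (intro pint_Cauchy_Schwarz tame_continuous)
  also have "\<dots> \<le> K_P\<^sup>2 * hgrad2 v z * pint (\<lambda>p. (w p)\<^sup>2) z"
    using w z by (intro mult_right_mono pint_poincare v pint_nonneg tame_continuous tame_intros) auto
  finally have "sqrt ((pint (\<lambda>p. v p * w p) z)\<^sup>2) \<le> sqrt (K_P\<^sup>2 * hgrad2 v z * pint (\<lambda>p. (w p)\<^sup>2) z)"
    by (rule real_sqrt_le_mono)
  then show ?thesis using K_P_pos by (simp add: real_sqrt_mult)
qed

lemma abs_pint_trilinear_le:
  assumes "tame f" "pint f z = 0" "tame g" "tame h" "z \<in> {0..1}"
  shows "\<bar>pint (\<lambda>p. f p * (g p - hmean g z) * h p) z\<bar>
    \<le> sqrt K_L * sqrt (hgrad2 f z) * (sqrt (hgrad2 g z) * sqrt (pint (\<lambda>p. (h p)\<^sup>2) z))"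
proof -
  have "(pint (\<lambda>p. f p * (g p - hmean g z) * h p) z)\<^sup>2
      \<le> K_L * hgrad2 f z * hgrad2 g z * pint (\<lambda>p. (h p)\<^sup>2) z"
    using pint_trilinear[OF assms(1,2) tame_diff[OF assms(3) tame_const] pint_fluctuation assms(4)] assms(3,5)
    by (simp add: hgrad2_diff_const)
  then have "sqrt ((pint (\<lambda>p. f p * (g p - hmean g z) * h p) z)\<^sup>2)
      \<le> sqrt (K_L * hgrad2 f z * hgrad2 g z * pint (\<lambda>p. (h p)\<^sup>2) z)"
    by (rule real_sqrt_le_mono)
  then show ?thesis by (simp add: real_sqrt_mult mult.assoc)
qed

text \<open>The derivative of \<open>w\<close> along the field, (B . grad) w. With \<open>w\<close>
  a component of the same field this is a component of the magnetic tension.\<close>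

definition adv :: "(point \<Rightarrow> real) \<Rightarrow> (point \<Rightarrow> real) \<Rightarrow> (point \<Rightarrow> real) \<Rightarrow> (point \<Rightarrow> real) \<Rightarrow> point \<Rightarrow> real" where
  "adv B1 B2 B3 w p = B1 p * d_x w p + B2 p * d_y w p + B3 p * d_z w p"

lemma tame_adv: "tame B1 \<Longrightarrow> tame B2 \<Longrightarrow> tame B3 \<Longrightarrow> tame w \<Longrightarrow> tame (adv B1 B2 B3 w)"
  unfolding adv_def[abs_def] by (intro tame_intros)

text \<open>The fluctuation of the field has mean zero and falls under the trilinear estimate
  together with \<open>v\<close>. The mean is constant on the plane and leaves the integral; what
  remains is bilinear, and Poincare's inequality for \<open>v\<close> suffices. The third component
  has no mean, so the second term involves only horizontal derivatives of \<open>w\<close>.\<close>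

lemma abs_pint_adv_le:
  assumes v: "tame v" "pint v z = 0" and B: "tame B1" "tame B2" "tame B3" "pint B3 z = 0"
    and w: "tame w" and z: "z \<in> {0..1}"
  shows "\<bar>pint (\<lambda>p. v p * adv B1 B2 B3 w p) z\<bar> \<le>
    sqrt K_L * sqrt (hgrad2 B1 z + hgrad2 B2 z + hgrad2 B3 z) * (sqrt (hgrad2 v z) * sqrt (pint (grad2 w) z))
    + K_P * sqrt ((hmean B1 z)\<^sup>2 + (hmean B2 z)\<^sup>2) * (sqrt (hgrad2 v z) * sqrt (hgrad2 w z))"
proof -
  let ?t = "\<lambda>g h. pint (\<lambda>p. v p * (g p - hmean g z) * h p) z"
  have split: "pint (\<lambda>p. v p * adv B1 B2 B3 w p) z =
      (?t B1 (d_x w) + ?t B2 (d_y w) + ?t B3 (d_z w))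
      + (hmean B1 z * pint (\<lambda>p. v p * d_x w p) z + hmean B2 z * pint (\<lambda>p. v p * d_y w p) z)"
  proof -
    have "pint (\<lambda>p. v p * adv B1 B2 B3 w p) z = pint (\<lambda>p. v p * (B1 p - hmean B1 z) * d_x w p
        + v p * (B2 p - hmean B2 z) * d_y w p + v p * (B3 p - hmean B3 z) * d_z w p
        + (hmean B1 z * (v p * d_x w p) + hmean B2 z * (v p * d_y w p))) z"
      by (rule pint_cong) (simp add: adv_def hmean_def B(4) algebra_simps)
    also have "\<dots> = ?t B1 (d_x w) + ?t B2 (d_y w) + ?t B3 (d_z w)
        + (pint (\<lambda>p. hmean B1 z * (v p * d_x w p)) z + pint (\<lambda>p. hmean B2 z * (v p * d_y w p)) z)"
      using v(1) B(1-3) w z by (simp add: pint_add tame_continuous tame_intros)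
    finally show ?thesis by (simp add: pint_cmult)
  qed
  define V where "V = sqrt (hgrad2 v z)"
  define X Y Z where "X = sqrt (pint (\<lambda>p. (d_x w p)\<^sup>2) z)" and "Y = sqrt (pint (\<lambda>p. (d_y w p)\<^sup>2) z)"
    and "Z = sqrt (pint (\<lambda>p. (d_z w p)\<^sup>2) z)"
  have nn: "hgrad2 v z \<ge> 0" "hgrad2 B1 z \<ge> 0" "hgrad2 B2 z \<ge> 0" "hgrad2 B3 z \<ge> 0"
    "pint (\<lambda>p. (d_x w p)\<^sup>2) z \<ge> 0" "pint (\<lambda>p. (d_y w p)\<^sup>2) z \<ge> 0" "pint (\<lambda>p. (d_z w p)\<^sup>2) z \<ge> 0"
    using v B w z by (auto intro!: hgrad2_nonneg pint_nonneg tame_continuous tame_intros)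
  then have V: "V \<ge> 0" and XYZ: "X \<ge> 0" "Y \<ge> 0" "Z \<ge> 0"
    by (auto simp: V_def X_def Y_def Z_def)
  have grads: "hgrad2 w z = X\<^sup>2 + Y\<^sup>2" "pint (grad2 w) z = X\<^sup>2 + Y\<^sup>2 + Z\<^sup>2"
    using nn by (simp_all add: pint_grad2[OF w z] hgrad2_eq[OF w z] X_def Y_def Z_def)
  have "\<bar>?t B1 (d_x w) + ?t B2 (d_y w) + ?t B3 (d_z w)\<bar>
      \<le> sqrt K_L * V * (sqrt (hgrad2 B1 z) * X + sqrt (hgrad2 B2 z) * Y + sqrt (hgrad2 B3 z) * Z)"
    using abs_pint_trilinear_le[OF v B(1) tame_derivs(1)[OF w] z]
      abs_pint_trilinear_le[OF v B(2) tame_derivs(2)[OF w] z]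
      abs_pint_trilinear_le[OF v B(3) tame_derivs(3)[OF w] z]
    unfolding distrib_left V_def X_def Y_def Z_def by linarith
  also have "\<dots> \<le> sqrt K_L * V * (sqrt (hgrad2 B1 z + hgrad2 B2 z + hgrad2 B3 z) * sqrt (X\<^sup>2 + Y\<^sup>2 + Z\<^sup>2))"
    using cauchy_schwarz_3[of "sqrt (hgrad2 B1 z)" X "sqrt (hgrad2 B2 z)" Y "sqrt (hgrad2 B3 z)" Z] nn V XYZ K_L_pos
    by (intro mult_left_mono) (auto simp: abs_mult)
  finally have 1: "\<bar>?t B1 (d_x w) + ?t B2 (d_y w) + ?t B3 (d_z w)\<bar> \<le> \<dots>" .
  have "\<bar>hmean B1 z * pint (\<lambda>p. v p * d_x w p) z + hmean B2 z * pint (\<lambda>p. v p * d_y w p) z\<bar>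
      \<le> \<bar>hmean B1 z\<bar> * \<bar>pint (\<lambda>p. v p * d_x w p) z\<bar> + \<bar>hmean B2 z\<bar> * \<bar>pint (\<lambda>p. v p * d_y w p) z\<bar>"
    unfolding abs_mult[symmetric] by (rule abs_triangle_ineq)
  also have "\<dots> \<le> \<bar>hmean B1 z\<bar> * (K_P * V * X) + \<bar>hmean B2 z\<bar> * (K_P * V * Y)"
    unfolding V_def X_def Y_def
    by (intro add_mono mult_left_mono abs_pint_mult_le v tame_derivs w z) auto
  also have "\<dots> = K_P * V * (\<bar>hmean B1 z * X\<bar> + \<bar>hmean B2 z * Y\<bar>)"
    using XYZ by (simp add: abs_mult algebra_simps)
  also have "\<dots> \<le> K_P * V * (sqrt ((hmean B1 z)\<^sup>2 + (hmean B2 z)\<^sup>2) * sqrt (X\<^sup>2 + Y\<^sup>2))"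
    using cauchy_schwarz_2 V K_P_pos by (intro mult_left_mono) auto
  finally have 2: "\<bar>hmean B1 z * pint (\<lambda>p. v p * d_x w p) z + hmean B2 z * pint (\<lambda>p. v p * d_y w p) z\<bar> \<le> \<dots>" .
  show ?thesis
    unfolding split grads V_def[symmetric]
    by (rule order_trans[OF order_trans[OF abs_triangle_ineq add_mono[OF 1 2]]]) (simp only: mult_ac order_refl)
qed

lemma pint_transport_le:
  assumes phi: "tame \<phi>" and B: "tame B1" "tame B2" "tame B3" "pint B3 z = 0" and z: "z \<in> {0..1}"
    and M: "M \<ge> 0" "pint (\<lambda>p. (horiz_laplacian \<phi> p)\<^sup>2) z \<le> M\<^sup>2"
  shows "\<bar>pint (\<lambda>p. d_y \<phi> p * adv B1 B2 B3 B1 p - d_x \<phi> p * adv B1 B2 B3 B2 p) z\<bar> \<le>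
    M * (sqrt K_L * pint (\<lambda>p. grad2 B1 p + grad2 B2 p + grad2 B3 p) z
      + K_P / (2 * pi * sqrt (Lx * Ly)) *
        (pi\<^sup>2 * (Lx * Ly) * ((hmean B1 z)\<^sup>2 + (hmean B2 z)\<^sup>2) + (hgrad2 B1 z + hgrad2 B2 z)))"
proof -
  let ?H = "hgrad2 B1 z + hgrad2 B2 z + hgrad2 B3 z" and ?h = "hgrad2 B1 z + hgrad2 B2 z"
  let ?G = "pint (grad2 B1) z + pint (grad2 B2) z"
  define c where "c = sqrt ((hmean B1 z)\<^sup>2 + (hmean B2 z)\<^sup>2)"
  define e where "e = pint (\<lambda>p. grad2 B1 p + grad2 B2 p + grad2 B3 p) z"
  define a where "a = sqrt (Lx * Ly)"
  define V1 where "V1 = sqrt (hgrad2 (d_y \<phi>) z)"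
  define V2 where "V2 = sqrt (hgrad2 (d_x \<phi>) z)"
  have a: "a > 0" "a\<^sup>2 = Lx * Ly" using Lx_pos Ly_pos by (auto simp: a_def)
  have c: "c \<ge> 0" "c\<^sup>2 = (hmean B1 z)\<^sup>2 + (hmean B2 z)\<^sup>2" by (auto simp: c_def)
  have e: "e = ?G + pint (grad2 B3) z"
    unfolding e_def using B(1-3) z by (simp add: pint_add tame_continuous tame_add tame_grad2)
  have nn: "hgrad2 (d_y \<phi>) z \<ge> 0" "hgrad2 (d_x \<phi>) z \<ge> 0" "hgrad2 B1 z \<ge> 0" "hgrad2 B2 z \<ge> 0" "hgrad2 B3 z \<ge> 0"
    using phi B z by (auto intro!: hgrad2_nonneg tame_derivs)
  have nz: "pint (\<lambda>p. (d_z B1 p)\<^sup>2) z \<ge> 0" "pint (\<lambda>p. (d_z B2 p)\<^sup>2) z \<ge> 0" "pint (\<lambda>p. (d_z B3 p)\<^sup>2) z \<ge> 0"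
    using B z by (auto intro!: pint_nonneg tame_continuous tame_intros)
  have le: "?H \<le> e" "?G \<le> e" "0 \<le> pint (grad2 B1) z" "0 \<le> pint (grad2 B2) z" "0 \<le> e"
    using nn nz B z unfolding e by (simp_all add: pint_grad2)
  have mean: "pint (d_y \<phi>) z = 0" "pint (d_x \<phi>) z = 0"
    using pint_d_x[OF phi z] pint_d_y[OF phi z] by auto
  \<comment> \<open>The pair \<open>d_y \<phi>\<close>, \<open>- d_x \<phi>\<close> has as its
    gradient the Hessian of \<open>\<phi>\<close> up to order and sign, whose norm equals that of
    the horizontal Laplacian.\<close>
  have VM: "sqrt (V1\<^sup>2 + V2\<^sup>2) \<le> M"
    using hgrad2_hgrad[OF phi z] M nn by (intro real_le_lsqrt) (auto simp: V1_def V2_def add.commute)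
  have "\<bar>pint (\<lambda>p. d_y \<phi> p * adv B1 B2 B3 B1 p - d_x \<phi> p * adv B1 B2 B3 B2 p) z\<bar>
      \<le> \<bar>pint (\<lambda>p. d_y \<phi> p * adv B1 B2 B3 B1 p) z\<bar> + \<bar>pint (\<lambda>p. d_x \<phi> p * adv B1 B2 B3 B2 p) z\<bar>"
    using phi B z by (subst pint_diff) (auto intro!: tame_continuous tame_mult tame_derivs tame_adv)
  also have "\<dots> \<le> sqrt K_L * sqrt ?H * (V1 * sqrt (pint (grad2 B1) z) + V2 * sqrt (pint (grad2 B2) z))
      + K_P * c * (V1 * sqrt (hgrad2 B1 z) + V2 * sqrt (hgrad2 B2 z))"
    using abs_pint_adv_le[OF tame_derivs(2)[OF phi] mean(1) B B(1) z]
      abs_pint_adv_le[OF tame_derivs(1)[OF phi] mean(2) B B(2) z]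
    unfolding V1_def V2_def c_def distrib_left by linarith
  also have "\<dots> \<le> sqrt K_L * sqrt ?H * (M * sqrt ?G) + K_P * c * (M * sqrt ?h)"
  proof -
    have "V1 * sqrt (pint (grad2 B1) z) + V2 * sqrt (pint (grad2 B2) z) \<le> sqrt (V1\<^sup>2 + V2\<^sup>2) * sqrt ?G"
      "V1 * sqrt (hgrad2 B1 z) + V2 * sqrt (hgrad2 B2 z) \<le> sqrt (V1\<^sup>2 + V2\<^sup>2) * sqrt ?h"
      using cauchy_schwarz_2[of V1 "sqrt (pint (grad2 B1) z)" V2 "sqrt (pint (grad2 B2) z)"]
        cauchy_schwarz_2[of V1 "sqrt (hgrad2 B1 z)" V2 "sqrt (hgrad2 B2 z)"] nn le
      by (simp_all add: V1_def V2_def abs_mult)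
    moreover have "sqrt (V1\<^sup>2 + V2\<^sup>2) * sqrt ?G \<le> M * sqrt ?G" "sqrt (V1\<^sup>2 + V2\<^sup>2) * sqrt ?h \<le> M * sqrt ?h"
      using VM nn le by (auto intro!: mult_right_mono)
    ultimately show ?thesis
      using nn c(1) K_L_pos K_P_pos by (intro add_mono mult_left_mono mult_nonneg_nonneg) auto
  qed
  also have "\<dots> = M * (sqrt K_L * (sqrt ?H * sqrt ?G) + K_P * (c * sqrt ?h))"
    by (simp add: algebra_simps)
  also have "\<dots> \<le> M * (sqrt K_L * e + K_P * ((pi\<^sup>2 * a\<^sup>2 * c\<^sup>2 + ?h) / (2 * pi * a)))"
  proof (intro mult_left_mono add_mono)
    have "sqrt ?H * sqrt ?G \<le> sqrt e * sqrt e"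
      using le nn by (intro mult_mono) auto
    then show "sqrt ?H * sqrt ?G \<le> e" using le by simp
    \<comment> \<open>Young's inequality. The weight \<open>pi * a\<close> is chosen so that, after
      integration in \<open>z\<close>, \<open>hmean_wirtinger\<close> bounds the first square by the
      vertical part of the gradient norm, while the second square is the horizontal part.\<close>
    have "2 * (pi * a * c) * sqrt ?h \<le> (pi * a * c)\<^sup>2 + (sqrt ?h)\<^sup>2"
      by (rule sum_squares_bound)
    then show "c * sqrt ?h \<le> (pi\<^sup>2 * a\<^sup>2 * c\<^sup>2 + ?h) / (2 * pi * a)"
      using a nn by (simp add: power_mult_distrib field_simps)
  qed (use M K_L_pos K_P_pos in auto)
  finally show ?thesis
    unfolding a(2) c(2) by (simp add: e_def a_def)
qed

text \<open>The gradient norm is charged twice: with coefficient \<open>sqrt K_L\<close> for the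
  fluctuation and with \<open>K_P / (2 * pi * sqrt (Lx * Ly))\<close> for the mean. Mean and
  fluctuation are recombined only here, because controlling the mean needs integration over the
  whole height.\<close>

lemma vint_transport_le:
  assumes phi: "tame \<phi>" and B: "tame B1" "tame B2" "tame B3" "\<And>z. z \<in> {0..1} \<Longrightarrow> pint B3 z = 0"
    and bdry: "\<And>x y. B1 (x, y, 0) = 0" "\<And>x y. B1 (x, y, 1) = 0"
      "\<And>x y. B2 (x, y, 0) = 0" "\<And>x y. B2 (x, y, 1) = 0"
    and M: "M \<ge> 0" "\<And>z. z \<in> {0..1} \<Longrightarrow> pint (\<lambda>p. (horiz_laplacian \<phi> p)\<^sup>2) z \<le> M\<^sup>2"
  shows "vint (\<lambda>p. d_y \<phi> p * adv B1 B2 B3 B1 p - d_x \<phi> p * adv B1 B2 B3 B2 p)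
    \<le> A_2 Lx Ly * M * vint (\<lambda>p. grad2 B1 p + grad2 B2 p + grad2 B3 p)"
proof -
  let ?c = "K_P / (2 * pi * sqrt (Lx * Ly))"
  let ?e = "\<lambda>p. grad2 B1 p + grad2 B2 p + grad2 B3 p"
  let ?m = "\<lambda>z. (hmean B1 z)\<^sup>2 + (hmean B2 z)\<^sup>2"
  have te: "tame ?e" using B by (intro tame_add tame_grad2)
  have cm: "continuous_on {0..1} (hmean B1)" "continuous_on {0..1} (hmean B2)"
    using hmean_derivative B DERIV_continuous_on by blast+
  have pos: "?c \<ge> 0" using K_P_pos Lx_pos Ly_pos by simp
  have "vint (\<lambda>p. d_y \<phi> p * adv B1 B2 B3 B1 p - d_x \<phi> p * adv B1 B2 B3 B2 p)
      \<le> integral {0..1} (\<lambda>z. M * (sqrt K_L * pint ?e z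
        + ?c * (pi\<^sup>2 * (Lx * Ly) * ?m z + (hgrad2 B1 z + hgrad2 B2 z))))"
    unfolding vint_def
  proof (rule integral_le)
    show "pint (\<lambda>p. d_y \<phi> p * adv B1 B2 B3 B1 p - d_x \<phi> p * adv B1 B2 B3 B2 p) integrable_on {0..1}"
      using phi B by (intro pint_integrable tame_continuous tame_diff tame_mult tame_derivs tame_adv)
    show "(\<lambda>z. M * (sqrt K_L * pint ?e z
        + ?c * (pi\<^sup>2 * (Lx * Ly) * ?m z + (hgrad2 B1 z + hgrad2 B2 z)))) integrable_on {0..1}"
      using B te
      by (intro integrable_continuous_real continuous_intros cm continuous_on_pint continuous_on_hgrad2 tame_continuous)
    fix z :: real assume "z \<in> {0..1}"
    then show "pint (\<lambda>p. d_y \<phi> p * adv B1 B2 B3 B1 p - d_x \<phi> p * adv B1 B2 B3 B2 p) z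
        \<le> M * (sqrt K_L * pint ?e z + ?c * (pi\<^sup>2 * (Lx * Ly) * ?m z + (hgrad2 B1 z + hgrad2 B2 z)))"
      using pint_transport_le[OF phi B(1-3) B(4) _ M(1) M(2)] abs_le_D1 by blast
  qed
  also have "\<dots> = M * (sqrt K_L * vint ?e
      + ?c * (pi\<^sup>2 * (Lx * Ly) * (integral {0..1} (\<lambda>z. (hmean B1 z)\<^sup>2) + integral {0..1} (\<lambda>z. (hmean B2 z)\<^sup>2))
        + (integral {0..1} (hgrad2 B1) + integral {0..1} (hgrad2 B2))))"
    unfolding vint_def using B te
    by (intro integral_unique has_integral_mult_right has_integral_add integrable_integral
        pint_integrable integrable_continuous_real continuous_on_hgrad2 tame_continuous continuous_intros cm)
  also have "\<dots> \<le> M * (sqrt K_L * vint ?e + ?c * vint ?e)"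
  proof (intro mult_left_mono add_mono M(1) pos order_refl)
    \<comment> \<open>The profiles of means of \<open>B1\<close> and \<open>B2\<close> vanish at
      both ends because the components themselves do.\<close>
    have "pi\<^sup>2 * (Lx * Ly) * (integral {0..1} (\<lambda>z. (hmean B1 z)\<^sup>2) + integral {0..1} (\<lambda>z. (hmean B2 z)\<^sup>2))
        + (integral {0..1} (hgrad2 B1) + integral {0..1} (hgrad2 B2))
        \<le> (vint (\<lambda>p. (d_z B1 p)\<^sup>2) + vint (\<lambda>p. (d_z B2 p)\<^sup>2))
        + (integral {0..1} (hgrad2 B1) + integral {0..1} (hgrad2 B2))"
      using hmean_wirtinger[OF B(1)] hmean_wirtinger[OF B(2)] pint_eq_0[of B1] pint_eq_0[of B2] bdry
      by (simp add: distrib_left)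
    also have "\<dots> = vint (grad2 B1) + vint (grad2 B2)"
      using B by (simp add: vint_grad2)
    also have "\<dots> \<le> vint (grad2 B1) + vint (grad2 B2) + vint (grad2 B3)"
      using vint_nonneg[OF tame_continuous[OF tame_grad2[OF B(3)]]] by (simp add: grad2_def)
    also have "\<dots> = vint ?e"
      using B by (simp add: vint_add tame_continuous tame_grad2 tame_add)
    finally show "pi\<^sup>2 * (Lx * Ly) * (integral {0..1} (\<lambda>z. (hmean B1 z)\<^sup>2) + integral {0..1} (\<lambda>z. (hmean B2 z)\<^sup>2))
        + (integral {0..1} (hgrad2 B1) + integral {0..1} (hgrad2 B2)) \<le> vint ?e" .
  qed (use K_L_pos in simp)
  also have "\<dots> = (sqrt K_L + ?c) * (M * vint ?e)"
    by (simp add: algebra_simps)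
  also have "\<dots> \<le> A_2 Lx Ly * (M * vint ?e)"
  proof (rule mult_right_mono)
    have "sqrt K_L + ?c = K_P * (max Lx Ly / sqrt (Lx * Ly) + 1 / (2 * pi * sqrt (Lx * Ly)))"
      using K_P_pos Lx_pos by (simp add: K_L_def real_sqrt_mult real_sqrt_divide algebra_simps)
    also have "\<dots> \<le> C_P Lx Ly * (max Lx Ly / sqrt (Lx * Ly) + 1 / (2 * pi * sqrt (Lx * Ly)))"
      using C_P_bounds(1)[OF Lx_pos Ly_pos] Lx_pos Ly_pos
      by (intro mult_right_mono) (auto simp: K_P_def less_max_iff_disj intro!: add_nonneg_nonneg divide_nonneg_nonneg)
    also have "\<dots> \<le> A_2 Lx Ly" by (rule A_2_lower_bound[OF Lx_pos Ly_pos])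
    finally show "sqrt K_L + ?c \<le> A_2 Lx Ly" .
    show "0 \<le> M * vint ?e"
      using te M by (intro mult_nonneg_nonneg vint_nonneg tame_continuous) (auto simp: grad2_def)
  qed
  finally show ?thesis by (simp add: mult.assoc)
qed

end

section \<open>Energy balance\<close>

context periodic_layer
begin

text \<open>Pythagoras on each plane: the plane inequality bounds the fluctuation, the Dirichlet
  inequality the mean. It serves only to show that a nonzero field has a nonzero gradient, so the
  constant is not optimised.\<close>

lemma vint_fluctuation_poincare:
  assumes f: "tame f" and "pint f 0 = 0" "pint f 1 = 0"
  shows "vint (\<lambda>p. (f p)\<^sup>2) \<le> (K_P\<^sup>2 + 1 / pi\<^sup>2) * vint (grad2 f)"
proof -
  have c: "continuous_on {0..1} (hmean f)"
    using hmean_derivative[OF f] DERIV_continuous_on by blast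
  have "pint (\<lambda>p. (f p)\<^sup>2) z \<le> K_P\<^sup>2 * hgrad2 f z + Lx * Ly * (hmean f z)\<^sup>2" if z: "z \<in> {0..1}" for z
  proof -
    have "pint (\<lambda>p. (f p - hmean f z)\<^sup>2) z
        = pint (\<lambda>p. (f p)\<^sup>2 - 2 * hmean f z * f p + (hmean f z)\<^sup>2) z"
      by (rule pint_cong) (simp add: power2_eq_square algebra_simps)
    also have "\<dots> = pint (\<lambda>p. (f p)\<^sup>2) z - 2 * hmean f z * pint f z + (hmean f z)\<^sup>2 * (Lx * Ly)"
      using f z by (simp add: pint_add pint_diff pint_cmult pint_const tame_continuous tame_intros)
    also have "pint f z = hmean f z * (Lx * Ly)"
      using Lx_pos Ly_pos by (simp add: hmean_def)
    finally have "pint (\<lambda>p. (f p - hmean f z)\<^sup>2) z = pint (\<lambda>p. (f p)\<^sup>2) z - Lx * Ly * (hmean f z)\<^sup>2"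
      by (simp add: power2_eq_square)
    moreover have "pint (\<lambda>p. (f p - hmean f z)\<^sup>2) z \<le> K_P\<^sup>2 * hgrad2 f z"
      using pint_poincare[OF tame_diff[OF f tame_const] z pint_fluctuation[OF f z]] hgrad2_diff_const[OF f z]
      by simp
    ultimately show ?thesis by linarith
  qed
  then have "vint (\<lambda>p. (f p)\<^sup>2) \<le> integral {0..1} (\<lambda>z. K_P\<^sup>2 * hgrad2 f z + Lx * Ly * (hmean f z)\<^sup>2)"
    unfolding vint_def using f c
    by (intro integral_le pint_integrable integrable_continuous_real continuous_intros
        continuous_on_hgrad2 tame_continuous tame_intros) auto
  also have "\<dots> = K_P\<^sup>2 * integral {0..1} (hgrad2 f) + Lx * Ly * integral {0..1} (\<lambda>z. (hmean f z)\<^sup>2)"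
    using f c
    by (intro integral_unique has_integral_add has_integral_mult_right integrable_integral
        integrable_continuous_real continuous_intros continuous_on_hgrad2)
  also have "\<dots> \<le> K_P\<^sup>2 * vint (grad2 f) + 1 / pi\<^sup>2 * vint (grad2 f)"
  proof -
    have nn: "integral {0..1} (hgrad2 f) \<ge> 0" "vint (\<lambda>p. (d_z f p)\<^sup>2) \<ge> 0"
      using f by (auto intro!: integral_nonneg integrable_continuous_real continuous_on_hgrad2 hgrad2_nonneg
          vint_nonneg tame_continuous tame_intros)
    have "Lx * Ly * integral {0..1} (\<lambda>z. (hmean f z)\<^sup>2) \<le> 1 / pi\<^sup>2 * vint (\<lambda>p. (d_z f p)\<^sup>2)"
      using hmean_wirtinger[OF assms] by (simp add: field_simps)
    also have "\<dots> \<le> 1 / pi\<^sup>2 * vint (grad2 f)"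
      unfolding vint_grad2[OF f] using nn by (intro mult_left_mono) auto
    finally show ?thesis
      unfolding vint_grad2[OF f] using nn by (intro add_mono mult_left_mono) auto
  qed
  finally show ?thesis by (simp add: distrib_right)
qed

text \<open>The boundary condition is put on a product so as to cover both situations: tangential
  components vanish on the boundary planes, while for the normal component it is the normal
  derivative that vanishes.\<close>

lemma vint_mult_laplacian:
  assumes f: "tame f"
    and "\<And>x y. f (x, y, 0) * d_z f (x, y, 0) = 0" "\<And>x y. f (x, y, 1) * d_z f (x, y, 1) = 0"
  shows "vint (\<lambda>p. f p * laplacian f p) = - vint (grad2 f)"
proof -
  have t: "tame (laplacian f)"
    unfolding laplacian_def[abs_def] using f by (intro tame_intros)
  have "0 = vint (\<lambda>p. d_x (\<lambda>p. f p * d_x f p) p + d_y (\<lambda>p. f p * d_y f p) p + d_z (\<lambda>p. f p * d_z f p) p)"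
    using assms by (intro vint_divergence[symmetric] tame_intros)
  also have "\<dots> = vint (\<lambda>p. f p * laplacian f p + grad2 f p)"
    by (rule vint_cong)
      (simp add: derivs_mult f tame_derivs laplacian_def grad2_def power2_eq_square algebra_simps)
  also have "\<dots> = vint (\<lambda>p. f p * laplacian f p) + vint (grad2 f)"
    using f t by (intro vint_add tame_continuous tame_mult tame_grad2)
  finally show ?thesis by simp
qed

text \<open>The integrands differ by the divergence of the cross product of \<open>E\<close> and
  \<open>B\<close>. Each term of its vertical component contains a tangential component of
  \<open>B\<close>, so nothing leaves through the boundary planes.\<close>

lemma vint_mult_curl:
  assumes E: "tame E1" "tame E2" "tame E3" and B: "tame B1" "tame B2" "tame B3"
    and bdry: "\<And>x y. B1 (x, y, 0) = 0" "\<And>x y. B1 (x, y, 1) = 0"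
      "\<And>x y. B2 (x, y, 0) = 0" "\<And>x y. B2 (x, y, 1) = 0"
  shows "vint (\<lambda>p. B1 p * (d_y E3 p - d_z E2 p) + B2 p * (d_z E1 p - d_x E3 p) + B3 p * (d_x E2 p - d_y E1 p))
    = vint (\<lambda>p. (d_y B3 p - d_z B2 p) * E1 p + (d_z B1 p - d_x B3 p) * E2 p + (d_x B2 p - d_y B1 p) * E3 p)"
    (is "vint ?l = vint ?r")
proof -
  have "0 = vint (\<lambda>p. d_x (\<lambda>p. B3 p * E2 p - B2 p * E3 p) p + d_y (\<lambda>p. B1 p * E3 p - B3 p * E1 p) p
      + d_z (\<lambda>p. B2 p * E1 p - B1 p * E2 p) p)"
    using assms by (intro vint_divergence[symmetric] tame_intros) auto
  also have "\<dots> = vint (\<lambda>p. ?l p - ?r p)"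
    by (rule vint_cong) (simp add: derivs_mult derivs_diff tame_mult E B algebra_simps)
  also have "\<dots> = vint ?l - vint ?r"
    using E B by (intro vint_diff tame_continuous tame_intros)
  finally show ?thesis by simp
qed

lemma vint_solenoidal_grad:
  assumes "tame u1" "tame u2" "tame u3" and f: "tame f"
    and div: "\<And>p. p \<in> layer \<Longrightarrow> d_x u1 p + d_y u2 p + d_z u3 p = 0"
    and "\<And>x y. u3 (x, y, 0) = 0" "\<And>x y. u3 (x, y, 1) = 0"
  shows "vint (\<lambda>p. u1 p * d_x f p + u2 p * d_y f p + u3 p * d_z f p) = 0"
proof -
  have "0 = vint (\<lambda>p. d_x (\<lambda>p. f p * u1 p) p + d_y (\<lambda>p. f p * u2 p) p + d_z (\<lambda>p. f p * u3 p) p)"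
    using assms by (intro vint_divergence[symmetric] tame_intros) auto
  also have "\<dots> = vint (\<lambda>p. u1 p * d_x f p + u2 p * d_y f p + u3 p * d_z f p)"
  proof (rule vint_cong)
    fix p assume p: "p \<in> layer"
    have "d_x (\<lambda>p. f p * u1 p) p + d_y (\<lambda>p. f p * u2 p) p + d_z (\<lambda>p. f p * u3 p) p
        = u1 p * d_x f p + u2 p * d_y f p + u3 p * d_z f p + f p * (d_x u1 p + d_y u2 p + d_z u3 p)"
      using assms(1-4) p by (simp add: derivs_mult algebra_simps)
    then show "d_x (\<lambda>p. f p * u1 p) p + d_y (\<lambda>p. f p * u2 p) p + d_z (\<lambda>p. f p * u3 p) p
        = u1 p * d_x f p + u2 p * d_y f p + u3 p * d_z f p"
      by (simp add: div[OF p])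
  qed
  finally show ?thesis by simp
qed

text \<open>A Jacobian is a horizontal divergence by the symmetry of mixed derivatives. It will
  dispose of the part of the velocity that has a stream function on each plane.\<close>

lemma vint_horizontal_jacobian:
  assumes "tame f" "tame g"
  shows "vint (\<lambda>p. d_x f p * d_y g p - d_y f p * d_x g p) = 0"
proof -
  have "vint (\<lambda>p. d_x f p * d_y g p - d_y f p * d_x g p)
      = vint (\<lambda>p. d_x (\<lambda>p. - (d_y f p * g p)) p + d_y (\<lambda>p. d_x f p * g p) p + d_z (\<lambda>p. 0) p)"
    using assms
    by (intro vint_cong)
      (simp add: derivs_mult derivs_uminus layer_derivs_const tame_derivs tame_mult mixed_derivs)
  also have "\<dots> = 0"
    using assms by (intro vint_divergence tame_intros) auto
  finally show ?thesis .
qed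

text \<open>The horizontal momentum equations determine the horizontal velocity up to
  \<open>(- d_y q, d_x q)\<close> with \<open>q = P + \<Lambda> / 2 * |B|\<^sup>2\<close>, whose contribution integrates to zero.\<close>

lemma lorentz_work:
  assumes u: "tame u1" "tame u2" "tame u3" and B: "tame B1" "tame B2" "tame B3" and P: "tame P" and T: "tame T"
    and div: "\<And>p. p \<in> layer \<Longrightarrow> d_x u1 p + d_y u2 p + d_z u3 p = 0"
    and ubdry: "\<And>x y. u3 (x, y, 0) = 0" "\<And>x y. u3 (x, y, 1) = 0"
    and mom: "\<And>p. p \<in> layer \<Longrightarrow> - u2 p + d_x P p
        = \<Lambda> * ((d_z B1 p - d_x B3 p) * B3 p - (d_x B2 p - d_y B1 p) * B2 p)"
      "\<And>p. p \<in> layer \<Longrightarrow> u1 p + d_y P p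
        = \<Lambda> * ((d_x B2 p - d_y B1 p) * B1 p - (d_y B3 p - d_z B2 p) * B3 p)"
      "\<And>p. p \<in> layer \<Longrightarrow> d_z P p
        = \<Lambda> * ((d_y B3 p - d_z B2 p) * B2 p - (d_z B1 p - d_x B3 p) * B1 p) + Ra * T p"
    and "\<Lambda> \<noteq> 0" and phi: "\<phi> = vert_primitive T"
  shows "vint (\<lambda>p. (d_y B3 p - d_z B2 p) * (u2 p * B3 p - u3 p * B2 p)
      + (d_z B1 p - d_x B3 p) * (u3 p * B1 p - u1 p * B3 p)
      + (d_x B2 p - d_y B1 p) * (u1 p * B2 p - u2 p * B1 p))
    = Ra * vint (\<lambda>p. d_y \<phi> p * adv B1 B2 B3 B1 p - d_x \<phi> p * adv B1 B2 B3 B2 p)"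
    (is "vint ?w = Ra * vint ?j")
proof -
  define c where "c = \<Lambda> / 2"
  \<comment> \<open>The Lorentz force is tension minus the gradient of magnetic pressure;
    \<open>q\<close> absorbs the latter into \<open>P\<close>, so that the tension
    \<open>adv\<close> remains.\<close>
  define q where "q p = P p + c * (B1 p * B1 p + B2 p * B2 p + B3 p * B3 p)" for p
  have q: "tame q" unfolding q_def[abs_def] by (intro tame_intros B P)
  have \<phi>: "tame \<phi>" unfolding phi by (rule tame_vert_primitive[OF T])
  have tw: "tame ?w" using u B by (intro tame_intros)
  have tj: "tame ?j" using B \<phi> by (intro tame_diff tame_mult tame_derivs tame_adv)
  \<comment> \<open>Testing the momentum equation with the velocity: the pressure does no work on a
    solenoidal field and the rotation term is orthogonal to it.\<close>
  have "0 = vint (\<lambda>p. u1 p * d_x P p + u2 p * d_y P p + u3 p * d_z P p)"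
    by (rule vint_solenoidal_grad[symmetric]) (fact u P div ubdry)+
  also have "\<dots> = vint (\<lambda>p. Ra * (T p * u3 p) - \<Lambda> * ?w p)"
  proof (rule vint_cong)
    fix p assume p: "p \<in> layer"
    have "u1 p * d_x P p + u2 p * d_y P p + u3 p * d_z P p
        = u1 p * (- u2 p + d_x P p) + u2 p * (u1 p + d_y P p) + u3 p * d_z P p"
      by (simp add: algebra_simps)
    also have "\<dots> = Ra * (T p * u3 p) - \<Lambda> * ?w p"
      unfolding mom[OF p] by (simp add: algebra_simps)
    finally show "u1 p * d_x P p + u2 p * d_y P p + u3 p * d_z P p = Ra * (T p * u3 p) - \<Lambda> * ?w p" .
  qed
  also have "\<dots> = Ra * vint (\<lambda>p. T p * u3 p) - \<Lambda> * vint ?w"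
    using u T tw by (subst vint_diff) (auto intro!: tame_continuous tame_mult tame_const simp: vint_cmult)
  finally have work: "\<Lambda> * vint ?w = Ra * vint (\<lambda>p. T p * u3 p)" by simp
  \<comment> \<open>The same identity with \<open>\<phi>\<close> in place of the pressure; its
    vertical term is exactly the buoyancy work.\<close>
  have "0 = vint (\<lambda>p. u1 p * d_x \<phi> p + u2 p * d_y \<phi> p + u3 p * d_z \<phi> p)"
    by (rule vint_solenoidal_grad[symmetric]) (fact u \<phi> div ubdry)+
  also have "\<dots> = vint (\<lambda>p. (T p * u3 p - \<Lambda> * ?j p) - (d_x \<phi> p * d_y q p - d_y \<phi> p * d_x q p))"
  proof (rule vint_cong)
    fix p assume p: "p \<in> layer"
    have dq: "d_x q p = d_x P p + \<Lambda> * (B1 p * d_x B1 p + B2 p * d_x B2 p + B3 p * d_x B3 p)"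
      "d_y q p = d_y P p + \<Lambda> * (B1 p * d_y B1 p + B2 p * d_y B2 p + B3 p * d_y B3 p)"
      unfolding q_def[abs_def] using B P p
      by (simp_all add: derivs_add derivs_mult layer_derivs_const tame_add tame_mult tame_const)
        (simp_all add: c_def algebra_simps)
    have u2: "u2 p = d_x q p - \<Lambda> * adv B1 B2 B3 B1 p"
      using mom(1)[OF p] by (simp add: dq adv_def algebra_simps)
    have u1: "u1 p = \<Lambda> * adv B1 B2 B3 B2 p - d_y q p"
      using mom(2)[OF p] by (simp add: dq adv_def algebra_simps)
    have dz: "d_z \<phi> p = T p" unfolding phi by (rule d_z_vert_primitive[OF T p])
    show "u1 p * d_x \<phi> p + u2 p * d_y \<phi> p + u3 p * d_z \<phi> p
        = (T p * u3 p - \<Lambda> * ?j p) - (d_x \<phi> p * d_y q p - d_y \<phi> p * d_x q p)"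
      unfolding u1 u2 dz by (simp add: algebra_simps)
  qed
  also have "\<dots> = (vint (\<lambda>p. T p * u3 p) - vint (\<lambda>p. \<Lambda> * ?j p))
      - vint (\<lambda>p. d_x \<phi> p * d_y q p - d_y \<phi> p * d_x q p)"
  proof -
    have t: "tame (\<lambda>p. T p * u3 p)" "tame (\<lambda>p. \<Lambda> * ?j p)" "tame (\<lambda>p. d_x \<phi> p * d_y q p - d_y \<phi> p * d_x q p)"
      by (rule tame_mult[OF T u(3)], rule tame_mult[OF tame_const tj],
          intro tame_diff tame_mult tame_derivs \<phi> q)
    show ?thesis
      using vint_diff[OF tame_continuous[OF tame_diff[OF t(1,2)]] tame_continuous[OF t(3)]]
        vint_diff[OF tame_continuous[OF t(1)] tame_continuous[OF t(2)]] by simp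
  qed
  \<comment> \<open>Both identities carry the factor \<open>\<Lambda>\<close>, which therefore
    cancels from the result.\<close>
  finally have "vint (\<lambda>p. T p * u3 p) = \<Lambda> * vint ?j"
    unfolding vint_horizontal_jacobian[OF \<phi> q] by (simp add: vint_cmult)
  with work \<open>\<Lambda> \<noteq> 0\<close> show ?thesis by simp
qed

text \<open>The horizontal part of the divergence integrates to zero over a period, so the flux
  through horizontal planes does not depend on height.\<close>

lemma pint_solenoidal:
  assumes B: "tame B1" "tame B2" "tame B3"
    and div: "\<And>p. p \<in> layer \<Longrightarrow> d_x B1 p + d_y B2 p + d_z B3 p = 0"
    and "pint B3 0 = 0" and z: "z \<in> {0..1}"
  shows "pint B3 z = 0"
proof -
  have "pint (d_z B3) s = 0" if s: "s \<in> {0..1}" for s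
  proof -
    have "pint (d_z B3) s = pint (\<lambda>p. - d_x B1 p - d_y B2 p) s"
    proof (rule pint_cong)
      fix x y
      have "(x, y, s) \<in> layer" using s by (simp add: layer_eq)
      from div[OF this] show "d_z B3 (x, y, s) = - d_x B1 (x, y, s) - d_y B2 (x, y, s)" by simp
    qed
    also have "\<dots> = 0"
      using B s by (simp add: pint_uminus pint_diff pint_d_x pint_d_y tame_continuous tame_derivs tame_uminus)
    finally show ?thesis .
  qed
  then have "(pint B3 has_real_derivative 0) (at s within {0..1})" if "s \<in> {0..1}" for s
    using pint_derivative[OF B(3) that] that by simp
  then have "pint B3 z = pint B3 0"
    using has_field_derivative_zero_constant[of "{0..1::real}" "pint B3"] z
    by (metis atLeastAtMost_iff convex_real_interval(5) order_refl zero_le_one)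
  then show ?thesis using assms by simp
qed

lemma plane_derivs_0:
  assumes "tame f" "z \<in> {0..1}" "\<And>x y. f (x, y, z) = 0"
  shows "d_x f (x, y, z) = 0" "d_y f (x, y, z) = 0"
  using DERIV_unique[OF line_derivs(1)[OF assms(1,2), of y x], of 0]
    DERIV_unique[OF line_derivs(2)[OF assms(1,2), of x y], of 0] assms(3) by simp_all

text \<open>A real supremum dominates its set only if the set is bounded above; here the plane norm
  is continuous in \<open>z\<close> on a compact interval.\<close>

lemma pint_le_norm_Linf_L2:
  assumes f: "continuous_on layer f" and z: "z \<in> {0..1}"
  shows "norm_Linf_L2 Lx Ly f \<ge> 0" "pint (\<lambda>p. (f p)\<^sup>2) z \<le> (norm_Linf_L2 Lx Ly f)\<^sup>2"
proof -
  let ?g = "\<lambda>z. sqrt (pint (\<lambda>p. (f p)\<^sup>2) z)"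
  have c: "continuous_on layer (\<lambda>p. (f p)\<^sup>2)" by (intro continuous_intros f)
  have M: "norm_Linf_L2 Lx Ly f = (SUP z\<in>{0..1}. ?g z)"
    by (simp add: norm_Linf_L2_def pint_def)
  have "continuous_on {0..1} ?g" by (intro continuous_intros continuous_on_pint c)
  then have "bdd_above (?g ` {0..1})"
    by (intro bounded_imp_bdd_above compact_imp_bounded compact_continuous_image) auto
  then have le: "?g z \<le> norm_Linf_L2 Lx Ly f" unfolding M using z by (rule cSUP_upper2) auto
  have nn: "pint (\<lambda>p. (f p)\<^sup>2) z \<ge> 0" by (rule pint_nonneg[OF c z]) simp
  then show "norm_Linf_L2 Lx Ly f \<ge> 0" using le real_sqrt_ge_zero order_trans by blast
  have "(?g z)\<^sup>2 \<le> (norm_Linf_L2 Lx Ly f)\<^sup>2" by (intro power_mono le) (simp add: nn)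
  then show "pint (\<lambda>p. (f p)\<^sup>2) z \<le> (norm_Linf_L2 Lx Ly f)\<^sup>2" using nn by simp
qed

lemma tame_laplacian: "tame f \<Longrightarrow> tame (laplacian f)"
  unfolding laplacian_def[abs_def] by (intro tame_add tame_derivs)

text \<open>With \<open>r = 1 / Rm\<close> the integrand on the left is the inner product of
  \<open>B\<close> with its time derivative after the induction equation has been inserted;
  \<open>E1\<close>, \<open>E2\<close>, \<open>E3\<close> form the cross product of \<open>u\<close>
  and \<open>B\<close>.\<close>

lemma energy_rate_le:
  assumes u: "tame u1" "tame u2" "tame u3" and B: "tame B1" "tame B2" "tame B3" and P: "tame P" and T: "tame T"
    and divu: "\<And>p. p \<in> layer \<Longrightarrow> d_x u1 p + d_y u2 p + d_z u3 p = 0"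
    and divB: "\<And>p. p \<in> layer \<Longrightarrow> d_x B1 p + d_y B2 p + d_z B3 p = 0"
    and ubdry: "\<And>x y. u3 (x, y, 0) = 0" "\<And>x y. u3 (x, y, 1) = 0"
    and bdry: "\<And>x y. B1 (x, y, 0) = 0" "\<And>x y. B1 (x, y, 1) = 0"
      "\<And>x y. B2 (x, y, 0) = 0" "\<And>x y. B2 (x, y, 1) = 0"
    and flux: "pint B3 0 = 0"
    and mom: "\<And>p. p \<in> layer \<Longrightarrow> - u2 p + d_x P p
        = \<Lambda> * ((d_z B1 p - d_x B3 p) * B3 p - (d_x B2 p - d_y B1 p) * B2 p)"
      "\<And>p. p \<in> layer \<Longrightarrow> u1 p + d_y P p
        = \<Lambda> * ((d_x B2 p - d_y B1 p) * B1 p - (d_y B3 p - d_z B2 p) * B3 p)"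
      "\<And>p. p \<in> layer \<Longrightarrow> d_z P p
        = \<Lambda> * ((d_y B3 p - d_z B2 p) * B2 p - (d_z B1 p - d_x B3 p) * B1 p) + Ra * T p"
    and pos: "\<Lambda> > 0" "Ra > 0"
    and E: "E1 = (\<lambda>p. u2 p * B3 p - u3 p * B2 p)" "E2 = (\<lambda>p. u3 p * B1 p - u1 p * B3 p)"
      "E3 = (\<lambda>p. u1 p * B2 p - u2 p * B1 p)"
  shows "vint (\<lambda>p. (B1 p * (d_y E3 p - d_z E2 p) + B2 p * (d_z E1 p - d_x E3 p) + B3 p * (d_x E2 p - d_y E1 p))
      + r * (B1 p * laplacian B1 p + B2 p * laplacian B2 p + B3 p * laplacian B3 p))
    \<le> (Ra * A_2 Lx Ly * norm_Linf_L2 Lx Ly (horiz_laplacian (vert_primitive T)) - r)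
      * vint (\<lambda>p. grad2 B1 p + grad2 B2 p + grad2 B3 p)" (is "vint (\<lambda>p. ?c p + r * ?l p) \<le> (_ * ?M - r) * ?D")
proof -
  let ?\<phi> = "vert_primitive T"
  let ?w = "\<lambda>p. (d_y B3 p - d_z B2 p) * E1 p + (d_z B1 p - d_x B3 p) * E2 p + (d_x B2 p - d_y B1 p) * E3 p"
  have tE: "tame E1" "tame E2" "tame E3"
    unfolding E using u B by (auto intro: tame_diff tame_mult)
  have \<phi>: "tame ?\<phi>" by (rule tame_vert_primitive[OF T])
  have tc: "tame ?c" by (intro tame_intros tE B)
  have tl: "tame ?l" by (intro tame_add tame_mult tame_laplacian B)
  have t: "continuous_on layer (\<lambda>p. B1 p * laplacian B1 p)" "continuous_on layer (\<lambda>p. B2 p * laplacian B2 p)"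
    "continuous_on layer (\<lambda>p. B3 p * laplacian B3 p)" "continuous_on layer (grad2 B1)"
    "continuous_on layer (grad2 B2)" "continuous_on layer (grad2 B3)"
    using B by (auto intro: tame_continuous tame_mult tame_laplacian tame_grad2)
  \<comment> \<open>On a boundary plane the tangential components vanish along with their horizontal
    derivatives, so the solenoidal condition becomes a Neumann condition for the normal
    component.\<close>
  have B3z: "d_z B3 (x, y, z) = 0" if "z = 0 \<or> z = 1" for x y z
  proof -
    have "z \<in> {0..1}" "(x, y, z) \<in> layer" "\<And>x y. B1 (x, y, z) = 0" "\<And>x y. B2 (x, y, z) = 0"
      using that bdry by (auto simp: layer_eq)
    then show ?thesis
      using divB[of "(x, y, z)"] plane_derivs_0(1)[OF B(1)] plane_derivs_0(2)[OF B(2)] by simp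
  qed
  have split: "vint (\<lambda>p. ?c p + r * ?l p) = vint ?c + r * vint ?l"
    using vint_add[OF tame_continuous[OF tc] tame_continuous[OF tame_mult[OF tame_const tl]]]
    by (simp add: vint_cmult)
  have diss: "vint ?l = - vint (\<lambda>p. grad2 B1 p + grad2 B2 p + grad2 B3 p)"
  proof -
    have "vint (\<lambda>p. B1 p * laplacian B1 p) = - vint (grad2 B1)"
      "vint (\<lambda>p. B2 p * laplacian B2 p) = - vint (grad2 B2)"
      "vint (\<lambda>p. B3 p * laplacian B3 p) = - vint (grad2 B3)"
      by (intro vint_mult_laplacian B; simp add: bdry B3z)+
    then show ?thesis by (simp add: vint_add t continuous_on_add)
  qed
  have "vint ?c = vint ?w"
    by (rule vint_mult_curl[OF tE B bdry])
  also have "\<dots> = Ra * vint (\<lambda>p. d_y ?\<phi> p * adv B1 B2 B3 B1 p - d_x ?\<phi> p * adv B1 B2 B3 B2 p)"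
    unfolding E by (rule lorentz_work[OF u B P T divu ubdry mom]) (use pos in auto)
  also have "\<dots> \<le> Ra * (A_2 Lx Ly * ?M * ?D)"
  proof (intro mult_left_mono vint_transport_le \<phi> B bdry)
    have c: "continuous_on layer (horiz_laplacian ?\<phi>)"
      unfolding horiz_laplacian_def[abs_def] using \<phi> by (intro tame_continuous tame_add tame_derivs)
    show "pint B3 z = 0" if "z \<in> {0..1}" for z
      by (rule pint_solenoidal[OF B divB flux that])
    show "?M \<ge> 0" using pint_le_norm_Linf_L2(1)[OF c, of 0] by simp
    show "pint (\<lambda>p. (horiz_laplacian ?\<phi> p)\<^sup>2) z \<le> ?M\<^sup>2" if "z \<in> {0..1}" for z
      by (rule pint_le_norm_Linf_L2(2)[OF c that])
  qed (use pos in simp)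
  finally show ?thesis unfolding split diss by (simp add: algebra_simps)
qed

text \<open>Exactness of the flux is decisive: a uniform vertical field meets the other conditions
  and has zero gradient.\<close>

lemma vint_squares_le:
  assumes B: "tame B1" "tame B2" "tame B3"
    and divB: "\<And>p. p \<in> layer \<Longrightarrow> d_x B1 p + d_y B2 p + d_z B3 p = 0"
    and bdry: "\<And>x y. B1 (x, y, 0) = 0" "\<And>x y. B1 (x, y, 1) = 0"
      "\<And>x y. B2 (x, y, 0) = 0" "\<And>x y. B2 (x, y, 1) = 0"
    and flux: "pint B3 0 = 0"
  shows "vint (\<lambda>p. (B1 p)\<^sup>2 + (B2 p)\<^sup>2 + (B3 p)\<^sup>2)
    \<le> (K_P\<^sup>2 + 1 / pi\<^sup>2) * vint (\<lambda>p. grad2 B1 p + grad2 B2 p + grad2 B3 p)"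
proof -
  have "pint B3 1 = 0" by (rule pint_solenoidal[OF B divB flux]) auto
  then have "vint (\<lambda>p. (B1 p)\<^sup>2) \<le> (K_P\<^sup>2 + 1 / pi\<^sup>2) * vint (grad2 B1)"
    "vint (\<lambda>p. (B2 p)\<^sup>2) \<le> (K_P\<^sup>2 + 1 / pi\<^sup>2) * vint (grad2 B2)"
    "vint (\<lambda>p. (B3 p)\<^sup>2) \<le> (K_P\<^sup>2 + 1 / pi\<^sup>2) * vint (grad2 B3)"
    using flux bdry by (auto intro!: vint_fluctuation_poincare B pint_eq_0)
  then show ?thesis
    using B by (simp add: vint_add tame_continuous tame_intros tame_grad2 distrib_left)
qed

end

section \<open>Vector fields\<close>

lemma vec_derivs:
  fixes F :: "point \<Rightarrow> real^3"
  assumes "F differentiable_on layer" "p \<in> layer"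
  shows "d_x F p $ i = d_x (\<lambda>q. F q $ i) p" "d_y F p $ i = d_y (\<lambda>q. F q $ i) p"
    "d_z F p $ i = d_z (\<lambda>q. F q $ i) p"
  using layer_derivs_bounded_linear[OF bounded_linear_vec_nth assms] by simp_all

text \<open>Projection and first derivatives commute at points of the layer. This is enough for
  second derivatives, since a derivative within the layer sees only values there.\<close>

lemma vec_laplacian:
  fixes F :: "point \<Rightarrow> real^3"
  assumes F: "smooth_on layer F" and p: "p \<in> layer"
  shows "laplacian F p $ i = laplacian (\<lambda>q. F q $ i) p"
proof -
  have "smooth_on layer (d_x F)" "smooth_on layer (d_y F)" "smooth_on layer (d_z F)"
    unfolding d_x_def d_y_def d_z_def by (intro smooth_on_pderiv_within F; simp add: Basis_point)+
  note d = this[THEN smooth_on_imp_differentiable] F[THEN smooth_on_imp_differentiable]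
  show ?thesis
    using vec_derivs(1)[OF d(1) p] vec_derivs(2)[OF d(2) p] vec_derivs(3)[OF d(3) p]
      layer_derivs_cong(1)[OF vec_derivs(1)[OF d(4)] p] layer_derivs_cong(2)[OF vec_derivs(2)[OF d(4)] p]
      layer_derivs_cong(3)[OF vec_derivs(3)[OF d(4)] p]
    by (simp add: laplacian_def)
qed

lemma differentiable_on_cross3:
  fixes F G :: "'a::euclidean_space \<Rightarrow> real^3"
  assumes "F differentiable_on S" "G differentiable_on S"
  shows "(\<lambda>q. cross3 (F q) (G q)) differentiable_on S"
  using assms bounded_bilinear.FDERIV[OF bilinear_cross[unfolded bilinear_conv_bounded_bilinear]]
  unfolding differentiable_on_def differentiable_def by blast

lemma curl_components:
  assumes "F differentiable_on layer" "p \<in> layer"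
  shows "curl F p $ 1 = d_y (\<lambda>q. F q $ 3) p - d_z (\<lambda>q. F q $ 2) p"
    "curl F p $ 2 = d_z (\<lambda>q. F q $ 1) p - d_x (\<lambda>q. F q $ 3) p"
    "curl F p $ 3 = d_x (\<lambda>q. F q $ 2) p - d_y (\<lambda>q. F q $ 1) p"
  using vec_derivs[OF assms] by (simp_all add: curl_def)

context periodic_layer
begin

lemma tame_component:
  fixes F :: "point \<Rightarrow> real^3"
  assumes "smooth_on layer F" "horiz_periodic Lx Ly F"
  shows "tame (\<lambda>p. F p $ i)"
  using assms Ck_on_bounded_linear[OF thick_layer bounded_linear_vec_nth, of _ F i]
  by (auto simp: tame_def smooth_on_def horiz_periodic_def)

text \<open>Differentiation under the integral sign, relative to \<open>I\<close> because
  \<open>t\<close> may be an end point of the time interval; joint smoothness provides the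
  continuity that Leibniz's rule requires.\<close>

lemma magnetic_energy_derivative:
  assumes I: "is_interval I" "interior I \<noteq> {}" and B: "smooth_field I B" and t: "t \<in> I"
  shows "((\<lambda>s. magnetic_energy Lx Ly (B s)) has_real_derivative
    integral (domain_V Lx Ly) (\<lambda>p. B t p \<bullet> d_t I B t p)) (at t within I)"
proof -
  let ?S = "I \<times> layer" and ?F = "\<lambda>(t, p). B t p"
  define D where "D s p = pderiv_within ?S (1, 0) ?F (s, p)" for s p
  have S: "{(t, p). t \<in> I \<and> p \<in> layer} = ?S" by auto
  have smooth: "smooth_on ?S ?F" using B by (simp add: smooth_field_def S)
  have cF: "continuous_on ?S (\<lambda>(s, p). B s p)" by (rule smooth_on_imp_continuous[OF smooth])
  have cD: "continuous_on ?S (\<lambda>(s, p). D s p)"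
  proof -
    have "(1 :: real, 0 :: point) \<in> Basis" by (auto simp: Basis_prod_def)
    from smooth_on_imp_continuous[OF smooth_on_pderiv_within[OF smooth this]]
    show ?thesis by (rule continuous_on_eq) (auto simp: D_def)
  qed
  have sub: "cbox (0, 0, 0) (Lx, Ly, 1) \<subseteq> layer"
    by (auto simp: layer_eq cbox_Pair_eq)
  have deriv: "((\<lambda>s. B s p) has_vector_derivative D s p) (at s within I)" if "s \<in> I" "p \<in> layer" for s p
  proof -
    have "(?F has_derivative (\<lambda>v. pderiv_within ?S v ?F (s, p))) (at (s, p) within ?S)"
      using that by (intro has_derivative_pderiv_within smooth_on_imp_differentiable smooth) auto
    then have F: "(?F has_derivative (\<lambda>v. pderiv_within ?S v ?F (s, p))) (at (s, p) within (\<lambda>s. (s, p)) ` I)"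
      by (rule has_derivative_subset) (use that in auto)
    then interpret linear "\<lambda>v. pderiv_within ?S v ?F (s, p)" by (rule has_derivative_linear)
    have "((\<lambda>s. (s, p)) has_derivative (\<lambda>h. (h, 0))) (at s within I)"
      by (auto intro!: derivative_eq_intros)
    from diff_chain_within[OF this F]
    have "((\<lambda>s. B s p) has_derivative (\<lambda>h. pderiv_within ?S (h, 0) ?F (s, p))) (at s within I)"
      by (simp add: o_def)
    moreover have "pderiv_within ?S (h, 0) ?F (s, p) = h *\<^sub>R D s p" for h
      using scale[of h "(1, 0)"] by (simp add: D_def)
    ultimately show ?thesis by (simp add: has_vector_derivative_def)
  qed
  \<comment> \<open>A vector derivative within \<open>I\<close> is determined only at a limit point
    of \<open>I\<close>; a nondegenerate interval consists of such points.\<close>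
  have "at t within I \<noteq> bot"
  proof -
    have "t islimpt I"
      unfolding islimpt_approachable dist_real_def
    proof (intro allI impI)
      fix e :: real assume "e > 0"
      with thick_interval[OF I] t obtain d where "0 < \<bar>d\<bar>" "\<bar>d\<bar> < e" "t + d *\<^sub>R 1 \<in> I"
        unfolding thick_def Basis_real_def by blast
      then show "\<exists>x'\<in>I. x' \<noteq> t \<and> \<bar>x' - t\<bar> < e" by (intro bexI[of _ "t + d"]) auto
    qed
    then show ?thesis by (simp add: trivial_limit_within)
  qed
  then have dt: "d_t I B t p = D t p" if "p \<in> layer" for p
    unfolding d_t_def using deriv[OF t that] by (rule vector_derivative_within)
  have "((\<lambda>s. integral (cbox (0, 0, 0) (Lx, Ly, 1)) (\<lambda>p. (norm (B s p))\<^sup>2)) has_real_derivative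
      integral (cbox (0, 0, 0) (Lx, Ly, 1)) (\<lambda>p. 2 * (B t p \<bullet> D t p))) (at t within I)"
  proof (rule leibniz_rule_field_derivative)
    fix s and p :: point assume s: "s \<in> I" and "p \<in> cbox (0, 0, 0) (Lx, Ly, 1)"
    then have "((\<lambda>s. B s p \<bullet> B s p) has_derivative (\<lambda>h. B s p \<bullet> (h *\<^sub>R D s p) + (h *\<^sub>R D s p) \<bullet> B s p)) (at s within I)"
      using deriv[of s p] sub unfolding has_vector_derivative_def by (intro has_derivative_inner) auto
    then show "((\<lambda>s. (norm (B s p))\<^sup>2) has_real_derivative 2 * (B s p \<bullet> D s p)) (at s within I)"
      unfolding has_field_derivative_def power2_norm_eq_inner
      by (rule has_derivative_eq_rhs) (auto simp: inner_commute algebra_simps)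
  next
    fix s assume s: "s \<in> I"
    show "(\<lambda>p. (norm (B s p))\<^sup>2) integrable_on cbox (0, 0, 0) (Lx, Ly, 1)"
      by (intro integrable_continuous continuous_intros continuous_on_compose2[OF cF, of _ "\<lambda>p. (s, p)", simplified])
        (use s sub in auto)
  next
    show "continuous_on (I \<times> cbox (0, 0, 0) (Lx, Ly, 1)) (\<lambda>(s, p). 2 * (B s p \<bullet> D s p))"
      using continuous_on_subset[OF cF, of "I \<times> cbox (0, 0, 0) (Lx, Ly, 1)"]
        continuous_on_subset[OF cD, of "I \<times> cbox (0, 0, 0) (Lx, Ly, 1)"] sub
      unfolding case_prod_unfold by (intro continuous_intros) auto
  qed (use t I in \<open>auto simp: is_interval_convex\<close>)
  from DERIV_cmult[OF this, of "1 / 2"]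
  have "((\<lambda>s. magnetic_energy Lx Ly (B s)) has_real_derivative
      integral (domain_V Lx Ly) (\<lambda>p. B t p \<bullet> D t p)) (at t within I)"
    by (simp add: magnetic_energy_def domain_V_cbox)
  moreover have "integral (domain_V Lx Ly) (\<lambda>p. B t p \<bullet> D t p) = integral (domain_V Lx Ly) (\<lambda>p. B t p \<bullet> d_t I B t p)"
    using dt by (intro integral_cong) (auto simp: domain_V_def layer_eq)
  ultimately show ?thesis by simp
qed

lemma vint_eq_0_imp:
  assumes f: "continuous_on layer f" "\<And>p. f p \<ge> 0" "vint f = 0" and p: "p \<in> domain_V Lx Ly"
  shows "f p = 0"
proof -
  have "(Lx / 2, Ly / 2, 1 / 2) \<in> box (0, 0, 0) ((Lx, Ly, 1) :: point)"
    using Lx_pos Ly_pos by (simp add: mem_box Basis_point)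
  then have "box (0, 0, 0) ((Lx, Ly, 1) :: point) \<noteq> {}" by blast
  moreover have "continuous_on (cbox (0, 0, 0) (Lx, Ly, 1)) f"
    by (rule continuous_on_subset[OF f(1)]) (auto simp: layer_eq cbox_Pair_eq)
  ultimately show ?thesis
    using integral_cbox_eq_0_iff[of "(0, 0, 0)" "(Lx, Ly, 1)" f] integral_domain_V[OF f(1)] f p
    by (simp add: domain_V_cbox)
qed

end

section \<open>The dynamo bound at one instant\<close>

theorem theorem3p6:
  fixes Lx Ly \<Lambda> Ra Rm t dE :: real
    and I :: "real set"
    and u B :: "real \<Rightarrow> point \<Rightarrow> real^3"
    and P T :: "real \<Rightarrow> point \<Rightarrow> real"
  assumes "Lx > 0" and "Ly > 0" and "\<Lambda> > 0" and "Ra > 0" and "Rm > 0"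
    and "is_interval I" and "interior I \<noteq> {}"
    and "smooth_taylor_solution Lx Ly \<Lambda> Ra Rm I u B P T"
    and "\<forall>s\<in>I. exact_flux Lx Ly (B s)"
    and "t \<in> I"
    and "\<exists>p\<in>domain_V Lx Ly. B t p \<noteq> 0"
    and "((\<lambda>s. magnetic_energy Lx Ly (B s)) has_real_derivative dE) (at t within I)"
    and "dE \<ge> 0"
  shows "Ra * A_2 Lx Ly * norm_Linf_L2 Lx Ly (horiz_laplacian (vert_primitive (T t))) \<ge> 1 / Rm"
proof -
  interpret periodic_layer Lx Ly by unfold_locales fact+
  note sol = assms(8)[unfolded smooth_taylor_solution_def]
  have slice: "smooth_on layer (f t)" if "smooth_field I f" for f :: "real \<Rightarrow> point \<Rightarrow> 'b::real_normed_vector"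
  proof -
    have "{(t, p). t \<in> I \<and> p \<in> layer} = I \<times> layer" by auto
    with that have "smooth_on (I \<times> layer) (\<lambda>(t, p). f t p)" by (simp add: smooth_field_def)
    from smooth_on_slice[OF thick_Times[OF thick_interval thick_layer] thick_layer assms(10) this] assms(6,7)
    show ?thesis by simp
  qed
  have su: "smooth_on layer (u t)" and sB: "smooth_on layer (B t)" and sP: "smooth_on layer (P t)"
    and sT: "smooth_on layer (T t)"
    using sol slice by blast+
  note du = smooth_on_imp_differentiable[OF su] and dB = smooth_on_imp_differentiable[OF sB]
  have per: "horiz_periodic Lx Ly (u t)" "horiz_periodic Lx Ly (B t)" "horiz_periodic Lx Ly (P t)"
    "horiz_periodic Lx Ly (T t)" and
    eqs: "\<And>p. p \<in> layer \<Longrightarrow> cross3 e_z (u t p) + grad (P t) p =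
             \<Lambda> *\<^sub>R cross3 (curl (B t) p) (B t p) + (Ra * T t p) *\<^sub>R e_z"
      "\<And>p. p \<in> layer \<Longrightarrow> divergence (u t) p = 0"
      "\<And>p. p \<in> layer \<Longrightarrow> d_t I B t p - curl (\<lambda>q. cross3 (u t q) (B t q)) p = (1 / Rm) *\<^sub>R laplacian (B t) p"
      "\<And>p. p \<in> layer \<Longrightarrow> divergence (B t) p = 0" and
    bc: "\<And>x y. u t (x, y, 0) \<bullet> (- e_z) = 0" "\<And>x y. u t (x, y, 1) \<bullet> e_z = 0"
      "\<And>x y. cross3 (B t (x, y, 0)) (- e_z) = 0" "\<And>x y. cross3 (B t (x, y, 1)) e_z = 0"
    using sol assms(10) by blast+
  define u1 u2 u3 where "u1 = (\<lambda>p. u t p $ 1)" and "u2 = (\<lambda>p. u t p $ 2)" and "u3 = (\<lambda>p. u t p $ 3)"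
  define B1 B2 B3 where "B1 = (\<lambda>p. B t p $ 1)" and "B2 = (\<lambda>p. B t p $ 2)" and "B3 = (\<lambda>p. B t p $ 3)"
  note comps = u1_def u2_def u3_def B1_def B2_def B3_def
  define E1 E2 E3 where "E1 = (\<lambda>p. u2 p * B3 p - u3 p * B2 p)" and "E2 = (\<lambda>p. u3 p * B1 p - u1 p * B3 p)"
    and "E3 = (\<lambda>p. u1 p * B2 p - u2 p * B1 p)"
  have tu: "tame u1" "tame u2" "tame u3" and tB: "tame B1" "tame B2" "tame B3"
    unfolding comps using tame_component su sB per by auto
  have tP: "tame (P t)" and tT: "tame (T t)"
    using sP sT per by (auto simp: tame_def)
  have ez: "e_z $ 1 = 0" "e_z $ 2 = 0" "e_z $ 3 = 1"
    by (simp_all add: e_z_def axis_def)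
  have divs: "d_x u1 p + d_y u2 p + d_z u3 p = 0" "d_x B1 p + d_y B2 p + d_z B3 p = 0" if "p \<in> layer" for p
    using eqs(2,4)[OF that] vec_derivs[OF du that] vec_derivs[OF dB that] by (simp_all add: divergence_def comps)
  have ubdry: "u3 (x, y, 0) = 0" "u3 (x, y, 1) = 0" for x y
    using bc(1,2)[of x y] by (simp_all add: u3_def inner_vec_def sum_3 ez)
  \<comment> \<open>The cross product with the vertical unit vector sees the tangential components
    only.\<close>
  have bdry: "B1 (x, y, 0) = 0" "B1 (x, y, 1) = 0" "B2 (x, y, 0) = 0" "B2 (x, y, 1) = 0" for x y
    using bc(3,4)[of x y] by (simp_all add: comps vec_eq_iff forall_3 cross_components ez)
  \<comment> \<open>The sign comes from the outward normal at the bottom; the flux through every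
    other plane then vanishes by the solenoidal condition.\<close>
  have flux: "pint B3 0 = 0"
  proof -
    have "pint (\<lambda>p. - B3 p) 0 = 0"
      using assms(9,10) by (simp add: exact_flux_def pint_def B3_def inner_vec_def sum_3 ez)
    then show ?thesis by (simp add: pint_uminus)
  qed
  have mom: "- u2 p + d_x (P t) p = \<Lambda> * ((d_z B1 p - d_x B3 p) * B3 p - (d_x B2 p - d_y B1 p) * B2 p)"
    "u1 p + d_y (P t) p = \<Lambda> * ((d_x B2 p - d_y B1 p) * B1 p - (d_y B3 p - d_z B2 p) * B3 p)"
    "d_z (P t) p = \<Lambda> * ((d_y B3 p - d_z B2 p) * B2 p - (d_z B1 p - d_x B3 p) * B1 p) + Ra * T t p"
    if "p \<in> layer" for p
    using eqs(1)[OF that]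
    by (simp_all add: vec_eq_iff forall_3 cross_components curl_components[OF dB that] grad_def ez comps mult.commute)
  define M where "M = norm_Linf_L2 Lx Ly (horiz_laplacian (vert_primitive (T t)))"
  define D where "D = vint (\<lambda>p. grad2 B1 p + grad2 B2 p + grad2 B3 p)"
  let ?r = "\<lambda>p. (B1 p * (d_y E3 p - d_z E2 p) + B2 p * (d_z E1 p - d_x E3 p) + B3 p * (d_x E2 p - d_y E1 p))
      + 1 / Rm * (B1 p * laplacian B1 p + B2 p * laplacian B2 p + B3 p * laplacian B3 p)"
  have rate: "B t p \<bullet> d_t I B t p = ?r p" if p: "p \<in> layer" for p
  proof -
    have dt: "d_t I B t p = curl (\<lambda>q. cross3 (u t q) (B t q)) p + (1 / Rm) *\<^sub>R laplacian (B t) p"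
      using eqs(3)[OF p] by (simp add: algebra_simps)
    have E: "(\<lambda>q. cross3 (u t q) (B t q) $ 1) = E1" "(\<lambda>q. cross3 (u t q) (B t q) $ 2) = E2"
      "(\<lambda>q. cross3 (u t q) (B t q) $ 3) = E3"
      by (simp_all add: fun_eq_iff cross_components E1_def E2_def E3_def comps mult.commute)
    note curls = curl_components[OF differentiable_on_cross3[OF du dB] p, unfolded E]
    show ?thesis
      unfolding dt inner_vec_def sum_3
      by (simp add: curls vec_laplacian[OF sB p] B1_def B2_def B3_def algebra_simps add_divide_distrib)
  qed
  have tE: "tame E1" "tame E2" "tame E3"
    unfolding E1_def E2_def E3_def using tu tB by (auto intro: tame_diff tame_mult)
  have "continuous_on layer ?r"
    by (intro tame_continuous tame_add tame_mult tame_diff tame_derivs tame_const tame_laplacian tE tB)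
  then have "integral (domain_V Lx Ly) ?r = vint ?r" by (rule integral_domain_V)
  moreover have "integral (domain_V Lx Ly) (\<lambda>p. B t p \<bullet> d_t I B t p) = integral (domain_V Lx Ly) ?r"
    by (intro integral_cong rate) (auto simp: domain_V_def layer_def)
  \<comment> \<open>Derivatives within a nondegenerate interval are unique, so the given
    \<open>dE\<close> agrees with the computed rate; both linear maps are evaluated at 1.\<close>
  moreover have "dE = integral (domain_V Lx Ly) (\<lambda>p. B t p \<bullet> d_t I B t p)"
  proof -
    note unique = frechet_derivative_within_thick[OF thick_interval[OF assms(6,7)] assms(10)]
    have B: "smooth_field I B" using sol by blast
    show ?thesis
      using fun_cong[OF trans[OF sym[OF unique[OF assms(12)[unfolded has_field_derivative_def]]]
            unique[OF magnetic_energy_derivative[OF assms(6,7) B assms(10), unfolded has_field_derivative_def]]], of 1]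
      by simp
  qed
  moreover have "vint ?r \<le> (Ra * A_2 Lx Ly * M - 1 / Rm) * D"
    unfolding M_def D_def
    by (rule energy_rate_le[OF tu tB tP tT divs ubdry bdry flux mom assms(3,4) E1_def E2_def E3_def])
  ultimately have nonneg: "0 \<le> (Ra * A_2 Lx Ly * M - 1 / Rm) * D"
    using assms(13) by simp
  have cB: "continuous_on layer (\<lambda>p. (B1 p)\<^sup>2 + (B2 p)\<^sup>2 + (B3 p)\<^sup>2)"
    by (intro tame_continuous tame_add tame_power tB)
  \<comment> \<open>The common factor can be divided out only if it is positive; were it zero, the
    field would vanish on the whole domain.\<close>
  have "D \<noteq> 0"
  proof
    assume "D = 0"
    then have "vint (\<lambda>p. (B1 p)\<^sup>2 + (B2 p)\<^sup>2 + (B3 p)\<^sup>2) \<le> 0"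
      using vint_squares_le[OF tB divs(2) bdry flux] by (simp add: D_def)
    moreover have "vint (\<lambda>p. (B1 p)\<^sup>2 + (B2 p)\<^sup>2 + (B3 p)\<^sup>2) \<ge> 0"
      by (rule vint_nonneg[OF cB]) simp
    ultimately have "vint (\<lambda>p. (B1 p)\<^sup>2 + (B2 p)\<^sup>2 + (B3 p)\<^sup>2) = 0" by simp
    from vint_eq_0_imp[OF cB _ this]
    have "(B1 p)\<^sup>2 + (B2 p)\<^sup>2 + (B3 p)\<^sup>2 = 0" if "p \<in> domain_V Lx Ly" for p
      using that by simp
    then have "B t p = 0" if "p \<in> domain_V Lx Ly" for p
      using that by (simp add: vec_eq_iff forall_3 comps add_nonneg_eq_0_iff)
    then show False using assms(11) by blast
  qed
  moreover have "D \<ge> 0"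
    unfolding D_def by (intro vint_nonneg tame_continuous tame_add tame_grad2 tB) (simp add: grad2_def)
  ultimately have "D > 0" by simp
  with nonneg have "0 \<le> Ra * A_2 Lx Ly * M - 1 / Rm"
    by (simp add: zero_le_mult_iff)
  then show ?thesis by (simp add: M_def)
qed

end
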